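(* (Existence of optimal trajectories on a general network.) Let $\mathcal N$ be a network and let the data $(\ell_i)_i$, $(\ell_{*j})_j$, $(g_i)_i$, $(g_{*j})_j$ satisfy the standing assumptions listed in the context. Then for each $(x,t)\in\mathcal N\times[0,T]$ there exists an optimal trajectory, i.e. $y\in\Gamma_t[x]$ such that $J_t(x;y)=\inf_{\hat y\in\Gamma_t[x]}J_t(x;\hat y)$.
   Context: Network: $\mathcal N$ is a connected subset of $\mathbb R^d$ made of a finite set of vertices $\mathcal V=\{O_1,\dots,O_n\}$ and finitely many closed edges $J_1,\dots,J_N$, each edge $J_i$ being either the segment joining two distinct vertices $O_{j_1},O_{j_2}$ ($j_1<j_2$), of length $l_i\in(0,\infty)$, parametrized by $\pi_i:[0,l_i]\to J_i$, $\pi_i(s)=[(l_i-s)O_{j_1}+sO_{j_2}]/l_i$, or a half-line starting at a vertex $O_j$ with unit direction $e_i$ ($l_i=\infty$), parametrized by $\pi_i:[0,\infty)\to J_i$, $\pi_i(s)=O_j+se_i$. For $i\ne i'$, $J_i\cap J_{i'}$ is empty or a single vertex. Write $e_i=\pi_i'$ for the unit direction of $J_i$ and $I_i=[0,l_i]$ (or $[0,\infty)$ if $l_i=\infty$). Fix $T>0$ and $p>1$. Trajectories: for $x\in\mathcal N$, $t\in[0,T]$, $\Gamma_t[x]$ is the set of $y\in C([t,T];\mathcal N)\cap W^{1,p}(t,T;\mathbb R^d)$ with $y(t)=x$ (for a.e. $s$ with $y(s)\in J_i\setminus\mathcal V$, $y'(s)$ is a multiple of $e_i$). Data: $g_{*j}\in\mathbb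 R$, $g_i\in C_b(I_i)$ (bounded continuous), $\ell_{*j}\in C([0,T])$, $\ell_i\in C(I_i\times\mathbb R\times[0,T])$, $(y,a,s)\mapsto\ell_i(y,a,s)$, differentiable in $(y,a)$ with $\partial_y\ell_i,\partial_a\ell_i$ continuous in $(y,a,s)$. Standing assumptions (for all $i,j$): (H1) there is $C_0>0$ with $\ell_i(y,a,s)\ge C_0(|a|^p-1)$ and $\ell_{*j}(s)\ge-C_0$; (H2) for any $r>0$ there is a modulus of continuity $\omega_r$ with $|\ell_i(y,a,t_1)-\ell_i(y,a,t_2)|\le(1+|a|^p)\omega_r(|t_1-t_2|)$ for $y\in I_i\cap[0,r]$, $a\in\mathbb R$, $t_1,t_2\in[0,T]$; (H3) for any $r>0$ there is $\tilde c(r)\ge0$ with $|\partial_y\ell_i(y,a,s)|\le\tilde c(r)(|a|^p+1)$, $|\partial_a\ell_i(y,a,s)|\le\tilde c(r)(|a|^{p-1}+1)$ for $y\in I_i\cap[0,r]$, $a\in\mathbb R$, $s\in[0,T]$; (H4) $a\mapsto\ell_i(y,a,s)$ is strictly convex. Costs: $\ell_{O_j}(\tau)=\min\{\ell_{*j}(\tau),\min_{i:\,O_j\in J_i}\ell_i(\pi_i^{-1}(O_j),0,\tau)\}$; $L(y,\alpha,\tau)=\sum_{i=1}^N\ell_i(\pi_i^{-1}(y),\alpha\cdot e_i,\tau)\mathbf 1_{y\in J_i\setminus\mathcal V}+\sum_{j=1}^n\ell_{O_j}(\tau)\mathbf 1_{y=O_j}$; $g(y)=\sum_ig_i(\pi_i^{-1}(y))\mathbf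 1_{y\in J_i\setminus\mathcal V}+\sum_j\min\{g_{*j},\min_{i:\,O_j\in J_i}g_i(\pi_i^{-1}(O_j))\}\mathbf 1_{y=O_j}$; $J_t(x;y)=\int_t^TL(y(\tau),y'(\tau),\tau)\,d\tau+g(y(T))$ for $y\in\Gamma_t[x]$. *)

theory Defs
  imports "HOL-Analysis.Analysis"
begin

(* Segment j k joins the vertices number j and k; Half_line j e starts at vertex number j with
   direction e. *)
datatype 'a edge = Segment nat nat | Half_line nat 'a

(* Vertices are numbered 1..n and edges 1..N; values at other indices are irrelevant. *)
record 'a network =
  num_vertices :: nat
  num_edges :: nat
  vertex :: "nat \<Rightarrow> 'a"
  edge :: "nat \<Rightarrow> 'a edge"

abbreviation vidx :: "('a, 'b) network_scheme \<Rightarrow> nat set" where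
  "vidx G \<equiv> {1..num_vertices G}"

abbreviation eidx :: "('a, 'b) network_scheme \<Rightarrow> nat set" where
  "eidx G \<equiv> {1..num_edges G}"

definition vertices :: "'a network \<Rightarrow> 'a set" where
  "vertices G = vertex G ` vidx G"

definition edge_length :: "'a::euclidean_space network \<Rightarrow> nat \<Rightarrow> ereal" where
  "edge_length G i = (case edge G i of
      Segment j k \<Rightarrow> ereal (norm (vertex G k - vertex G j))
    | Half_line j e \<Rightarrow> \<infinity>)"

definition edge_dom :: "'a::euclidean_space network \<Rightarrow> nat \<Rightarrow> real set" where
  "edge_dom G i = {s. 0 \<le> s \<and> ereal s \<le> edge_length G i}"

definition edge_param :: "'a::euclidean_space network \<Rightarrow> nat \<Rightarrow> real \<Rightarrow> 'a" where
  "edge_param G i s = (case edge G i of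
      Segment j k \<Rightarrow>
        (let l = norm (vertex G k - vertex G j)
         in ((l - s) *\<^sub>R vertex G j + s *\<^sub>R vertex G k) /\<^sub>R l)
    | Half_line j e \<Rightarrow> vertex G j + s *\<^sub>R e)"

definition edge_dir :: "'a::euclidean_space network \<Rightarrow> nat \<Rightarrow> 'a" where
  "edge_dir G i = (case edge G i of
      Segment j k \<Rightarrow> (vertex G k - vertex G j) /\<^sub>R norm (vertex G k - vertex G j)
    | Half_line j e \<Rightarrow> e)"

definition edge_set :: "'a::euclidean_space network \<Rightarrow> nat \<Rightarrow> 'a set" where
  "edge_set G i = edge_param G i ` edge_dom G i"

definition edge_coord :: "'a::euclidean_space network \<Rightarrow> nat \<Rightarrow> 'a \<Rightarrow> real" where
  "edge_coord G i = inv_into (edge_dom G i) (edge_param G i)"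

definition network_set :: "'a::euclidean_space network \<Rightarrow> 'a set" where
  "network_set G = vertices G \<union> (\<Union>i\<in>eidx G. edge_set G i)"

definition is_network :: "'a::euclidean_space network \<Rightarrow> bool" where
  "is_network G \<longleftrightarrow>
     1 \<le> num_vertices G \<and>
     inj_on (vertex G) (vidx G) \<and>
     (\<forall>i\<in>eidx G. case edge G i of
         Segment j k \<Rightarrow> j \<in> vidx G \<and> k \<in> vidx G \<and> j < k
       | Half_line j e \<Rightarrow> j \<in> vidx G \<and> norm e = 1) \<and>
     (\<forall>i\<in>eidx G. \<forall>i'\<in>eidx G. i \<noteq> i' \<longrightarrow>
        edge_set G i \<inter> edge_set G i' = {} \<or>
        (\<exists>v\<in>vertices G. edge_set G i \<inter> edge_set G i' = {v})) \<and>
     connected (network_set G)"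


definition in_Lp :: "real \<Rightarrow> real \<Rightarrow> real \<Rightarrow> (real \<Rightarrow> 'a::euclidean_space) \<Rightarrow> bool" where
  "in_Lp p a b f \<longleftrightarrow>
     f \<in> borel_measurable (lebesgue_on {a<..<b}) \<and>
     integrable (lebesgue_on {a<..<b}) (\<lambda>s. norm (f s) powr p)"

(* Test functions of class C^1 with compact support in the open interval, as in Brezis' definition
   of Sobolev spaces in one dimension; smooth test functions yield the same weak derivatives. *)
definition test_function :: "real \<Rightarrow> real \<Rightarrow> (real \<Rightarrow> real) \<Rightarrow> bool" where
  "test_function a b \<phi> \<longleftrightarrow>
     \<phi> C1_differentiable_on UNIV \<and>
     compact (closure {s. \<phi> s \<noteq> 0}) \<and> closure {s. \<phi> s \<noteq> 0} \<subseteq> {a<..<b}"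

definition has_weak_deriv ::
    "real \<Rightarrow> real \<Rightarrow> (real \<Rightarrow> 'a::euclidean_space) \<Rightarrow> (real \<Rightarrow> 'a) \<Rightarrow> bool" where
  "has_weak_deriv a b y v \<longleftrightarrow>
     (\<forall>\<phi>. test_function a b \<phi> \<longrightarrow>
        (LINT s|lebesgue_on {a<..<b}. deriv \<phi> s *\<^sub>R y s) =
        - (LINT s|lebesgue_on {a<..<b}. \<phi> s *\<^sub>R v s))"

definition W1p :: "real \<Rightarrow> real \<Rightarrow> real \<Rightarrow> (real \<Rightarrow> 'a::euclidean_space) set" where
  "W1p p a b = {y. in_Lp p a b y \<and> (\<exists>v. in_Lp p a b v \<and> has_weak_deriv a b y v)}"

(* A representative of the weak derivative, which is unique up to null sets. *)
definition weak_deriv ::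
    "real \<Rightarrow> real \<Rightarrow> real \<Rightarrow> (real \<Rightarrow> 'a::euclidean_space) \<Rightarrow> real \<Rightarrow> 'a" where
  "weak_deriv p a b y = (SOME v. in_Lp p a b v \<and> has_weak_deriv a b y v)"

(* Trajectories are total functions of which only the restriction to [t,T] matters. *)
definition trajectories ::
    "'a::euclidean_space network \<Rightarrow> real \<Rightarrow> real \<Rightarrow> real \<Rightarrow> 'a \<Rightarrow> (real \<Rightarrow> 'a) set" where
  "trajectories G p T t x =
     {y. continuous_on {t..T} y \<and> y ` {t..T} \<subseteq> network_set G \<and> y \<in> W1p p t T \<and> y t = x}"


definition vertex_running_cost ::
    "'a::euclidean_space network \<Rightarrow> (nat \<Rightarrow> real \<Rightarrow> real \<Rightarrow> real \<Rightarrow> real) \<Rightarrow> (nat \<Rightarrow> real \<Rightarrow> real)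
       \<Rightarrow> nat \<Rightarrow> real \<Rightarrow> real" where
  "vertex_running_cost G ell ellv j \<tau> =
     Min (insert (ellv j \<tau>)
            ((\<lambda>i. ell i (edge_coord G i (vertex G j)) 0 \<tau>)
               ` {i \<in> eidx G. vertex G j \<in> edge_set G i}))"

definition running_cost ::
    "'a::euclidean_space network \<Rightarrow> (nat \<Rightarrow> real \<Rightarrow> real \<Rightarrow> real \<Rightarrow> real) \<Rightarrow> (nat \<Rightarrow> real \<Rightarrow> real)
       \<Rightarrow> 'a \<Rightarrow> 'a \<Rightarrow> real \<Rightarrow> real" where
  "running_cost G ell ellv y \<alpha> \<tau> =
     (\<Sum>i\<in>eidx G. ell i (edge_coord G i y) (\<alpha> \<bullet> edge_dir G i) \<tau>
                    * indicator (edge_set G i - vertices G) y)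
     + (\<Sum>j\<in>vidx G. vertex_running_cost G ell ellv j \<tau> * indicator {vertex G j} y)"

definition terminal_cost ::
    "'a::euclidean_space network \<Rightarrow> (nat \<Rightarrow> real \<Rightarrow> real) \<Rightarrow> (nat \<Rightarrow> real) \<Rightarrow> 'a \<Rightarrow> real" where
  "terminal_cost G g gv y =
     (\<Sum>i\<in>eidx G. g i (edge_coord G i y) * indicator (edge_set G i - vertices G) y)
     + (\<Sum>j\<in>vidx G.
          Min (insert (gv j)
                 ((\<lambda>i. g i (edge_coord G i (vertex G j)))
                    ` {i \<in> eidx G. vertex G j \<in> edge_set G i}))
          * indicator {vertex G j} y)"

(* The starting point x of y is y t. *)
definition total_cost ::
    "'a::euclidean_space network \<Rightarrow> (nat \<Rightarrow> real \<Rightarrow> real \<Rightarrow> real \<Rightarrow> real) \<Rightarrow> (nat \<Rightarrow> real \<Rightarrow> real)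
       \<Rightarrow> (nat \<Rightarrow> real \<Rightarrow> real) \<Rightarrow> (nat \<Rightarrow> real) \<Rightarrow> real \<Rightarrow> real \<Rightarrow> real \<Rightarrow> (real \<Rightarrow> 'a) \<Rightarrow> real" where
  "total_cost G ell ellv g gv p T t y =
     (LINT \<tau>|lebesgue_on {t<..<T}. running_cost G ell ellv (y \<tau>) (weak_deriv p t T y \<tau>) \<tau>)
     + terminal_cost G g gv (y T)"


definition modulus_of_continuity :: "(real \<Rightarrow> real) \<Rightarrow> bool" where
  "modulus_of_continuity \<omega> \<longleftrightarrow>
     \<omega> 0 = 0 \<and> mono_on {0..} \<omega> \<and> (\<omega> \<longlongrightarrow> 0) (at_right 0)"

definition strictly_convex :: "(real \<Rightarrow> real) \<Rightarrow> bool" where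
  "strictly_convex f \<longleftrightarrow>
     (\<forall>a b u. a \<noteq> b \<and> 0 < u \<and> u < 1 \<longrightarrow>
        f ((1 - u) * a + u * b) < (1 - u) * f a + u * f b)"

(* The derivative in the position is one-sided at the end points of the edge domain. *)
definition partial_y ::
    "'a::euclidean_space network \<Rightarrow> (nat \<Rightarrow> real \<Rightarrow> real \<Rightarrow> real \<Rightarrow> real)
       \<Rightarrow> nat \<Rightarrow> real \<Rightarrow> real \<Rightarrow> real \<Rightarrow> real" where
  "partial_y G ell i y a s = vector_derivative (\<lambda>z. ell i z a s) (at y within edge_dom G i)"

definition partial_a ::
    "(nat \<Rightarrow> real \<Rightarrow> real \<Rightarrow> real \<Rightarrow> real) \<Rightarrow> nat \<Rightarrow> real \<Rightarrow> real \<Rightarrow> real \<Rightarrow> real" where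
  "partial_a ell i y a s = deriv (\<lambda>b. ell i y b s) a"

end

(* The direct method. Only the components of the velocity along the edges enter the cost, and a trajectory
   has zero velocity almost everywhere on the set of times which it spends at the vertices, so that
   coercivity bounds these edge speeds in L^p along a minimising sequence. The trajectories are then
   equicontinuous and a subsequence converges uniformly; convex combinations of the tails of the edge
   speeds converge almost everywhere. On an edge, the limits are the edge speeds of the limit trajectory.
   At a vertex the limits vanish: for a function P of the coordinate on the edge with simple zeros exactly
   at the vertices, P of the coordinate, extended by 0, is absolutely continuous along trajectories.
   By (H3) the position may be frozen in the cost with a vanishing error, and lower semicontinuity follows
   from Fatou's lemma for the frozen cost, which is convex in the edge speeds. At a vertex the frozen cost
   is the vertex cost plus the excess of the costs on the adjacent edges over their value at rest. *)
theory Submission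
  imports Defs "HOL-Real_Asymp.Real_Asymp" "HOL-Complex_Analysis.Great_Picard"
begin

section \<open>Absolutely continuous functions\<close>

text \<open>The running cost is neither continuous nor convex across a vertex, and a minimising
  sequence may oscillate between several edges while its limit rests at a vertex. Convex
  combinations of the edge speeds then mix edges, and the vanishing velocity of the limit yields
  only sum a_i e_i = 0 for the limit speeds a_i. Edge directions may be linearly dependent (two
  collinear edges meeting at a vertex already are), so this does not give a_i = 0; and the costs
  need not be smallest at rest, so a nonzero family a_i could undercut the vertex cost. This forces
  a separate scalar test on every edge. The test function must vanish at the vertices, to stay
  continuous when extended by 0 over the network, while its derivative must not, to detect a_i
  there; hence simple zeros. A second difficulty is that the radius within which only cells through
  y(s) are met depends on s and need have no positive lower bound along y. The comparison with
  frozen costs is therefore made on sets of times that increase to the whole interval, and Fatou's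
  lemma is applied once along the sequence and once along these sets.\<close>

lemma measurable_ident_lebesgue_on [measurable]: "(\<lambda>s. s) \<in> borel_measurable (lebesgue_on S)"
  using id_borel_measurable_lebesgue_on[of S] by (simp add: id_def)

lemma finite_measure_lebesgue_on_Ioo: "finite_measure (lebesgue_on {a<..<b::real})"
  by (rule finite_measure_lebesgue_on) auto

section \<open>Integrals over half-open intervals\<close>

lemma integrable_indicator_scaleR:
  fixes f :: "'c \<Rightarrow> 'b::{banach, second_countable_topology}"
  assumes "integrable M f" "(indicator A :: 'c \<Rightarrow> real) \<in> borel_measurable M"
  shows "integrable M (\<lambda>s. indicator A s *\<^sub>R f s)"
proof (rule Bochner_Integration.integrable_bound[OF assms(1)])
  note [measurable] = borel_measurable_integrable[OF assms(1)] assms(2)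
  show "(\<lambda>s. indicator A s *\<^sub>R f s) \<in> borel_measurable M" by measurable
qed (auto simp: indicator_def)

lemma set_integrable_Ioc:
  fixes f :: "real \<Rightarrow> 'b::{banach, second_countable_topology}"
  assumes "integrable (lebesgue_on S) f"
  shows "set_integrable (lebesgue_on S) {a<..b} f"
  unfolding set_integrable_def by (rule integrable_indicator_scaleR[OF assms]) measurable

lemma set_integral_Ioc_combine:
  fixes f :: "real \<Rightarrow> 'b::{banach, second_countable_topology}"
  assumes "integrable (lebesgue_on S) f" "a \<le> b" "b \<le> c"
  shows "(LINT s:{a<..c}|lebesgue_on S. f s) =
    (LINT s:{a<..b}|lebesgue_on S. f s) + (LINT s:{b<..c}|lebesgue_on S. f s)"
proof -
  have "{a<..c} = {a<..b} \<union> {b<..c}" using assms by auto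
  then show ?thesis
    using set_integral_Un[of "{a<..b}" "{b<..c}" "lebesgue_on S" f] set_integrable_Ioc[OF assms(1)]
    by auto
qed

lemma set_integral_Ioc_norm_bound:
  fixes f :: "real \<Rightarrow> 'b::{banach, second_countable_topology}" and g :: "real \<Rightarrow> real"
  assumes "integrable (lebesgue_on S) f" "integrable (lebesgue_on S) g"
    and "\<And>s. s \<in> S \<Longrightarrow> s \<in> {a<..b} \<Longrightarrow> norm (f s) \<le> g s"
  shows "norm (LINT s:{a<..b}|lebesgue_on S. f s) \<le> (LINT s:{a<..b}|lebesgue_on S. g s)"
  unfolding set_lebesgue_integral_def
  using set_integrable_Ioc[OF assms(1), of a b] set_integrable_Ioc[OF assms(2), of a b]
  by (intro Bochner_Integration.integral_norm_bound_integral)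
     (auto simp: set_integrable_def indicator_def assms(3))

text \<open>Half-open intervals form an intersection-stable generator of the Borel sets, and the
  sets over which \<open>f\<close> integrates to 0 form a Dynkin system; a Lebesgue set differs from
  a Borel set by a null set. This is the source of uniqueness of derivatives.\<close>

lemma AE_eq_0_if_set_integral_Ioc_eq_0:
  fixes f :: "real \<Rightarrow> 'b::{banach, second_countable_topology}"
  assumes f: "integrable (lebesgue_on {t<..<T}) f"
    and 0: "\<And>a b. t \<le> a \<Longrightarrow> a \<le> b \<Longrightarrow> b \<le> T \<Longrightarrow> (LINT s:{a<..b}|lebesgue_on {t<..<T}. f s) = 0"
  shows "AE s in lebesgue_on {t<..<T}. f s = 0"
proof -
  let ?M = "lebesgue_on {t<..<T}"
  note [measurable] = borel_measurable_integrable[OF f]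
  \<comment> \<open>The generator contains intervals that stick out of \<open>{t..T}\<close> or are
    empty; as the measure lives on the open interval, they may be clipped.\<close>
  have Ioc: "(LINT s:{a<..b}|?M. f s) = 0" for a b
  proof -
    have "(LINT s:{a<..b}|?M. f s) = (LINT s:{max a t<..min b T}|?M. f s)"
      unfolding set_lebesgue_integral_def
      by (rule Bochner_Integration.integral_cong) (auto simp: indicator_def)
    moreover have "\<dots> = 0"
    proof (cases "max a t \<le> min b T")
      case True then show ?thesis by (intro 0) auto
    next
      case False
      then have "{max a t<..min b T} = {}" by auto
      then have "(LINT s:{max a t<..min b T}|?M. f s) = (LINT s:{}|?M. f s)" by (simp only:)
      then show ?thesis by (simp add: set_lebesgue_integral_def)
    qed
    ultimately show ?thesis by simp
  qed
  have ind: "(indicator A :: real \<Rightarrow> real) \<in> borel_measurable ?M" if "A \<in> sets borel" for A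
    using that by (intro measurable_compose[OF measurable_ident_lebesgue_on borel_measurable_indicator])
  have int: "set_integrable ?M A f" if "A \<in> sets borel" for A
    unfolding set_integrable_def by (intro integrable_indicator_scaleR[OF f] ind that)
  have meas: "(\<lambda>s. indicator A s *\<^sub>R f s) \<in> borel_measurable ?M" if "A \<in> sets borel" for A
    by (intro borel_measurable_scaleR ind that) measurable
  have all: "(LINT s:UNIV|?M. f s) = 0"
  proof -
    have "(LINT s:UNIV|?M. f s) = (LINT s:{t<..T}|?M. f s)"
      unfolding set_lebesgue_integral_def
      by (rule Bochner_Integration.integral_cong) (auto simp: indicator_def)
    with Ioc show ?thesis by simp
  qed
  have borel: "(LINT s:A|?M. f s) = 0" if "A \<in> sets borel" for A
  proof -
    let ?G = "range (\<lambda>(a, b). {a <.. b::real})"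
    have "Int_stable ?G"
      unfolding Int_stable_def by (auto simp: Int_greaterThanAtMost)
    moreover have sub: "?G \<subseteq> Pow UNIV" by simp
    moreover have "A \<in> sigma_sets UNIV ?G"
      using that by (simp add: borel_sigma_sets_Ioc)
    ultimately show ?thesis
    proof (induction rule: sigma_sets_induct_disjoint[consumes 3])
      case (basic A) then show ?case using Ioc by auto
    next
      case empty show ?case by (simp add: set_lebesgue_integral_def)
    next
      case (compl A)
      then have A: "A \<in> sets borel" by (simp add: borel_sigma_sets_Ioc)
      then have "(LINT s:A \<union> (UNIV - A)|?M. f s) = (LINT s:A|?M. f s) + (LINT s:UNIV - A|?M. f s)"
        by (intro set_integral_Un int) auto
      then show ?case using compl all by simp
    next
      case (union A)
      then have A: "A i \<in> sets borel" for i by (auto simp: borel_sigma_sets_Ioc)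
      have "(\<lambda>i. LINT s:A i|?M. f s) sums (LINT s:(\<Union>i. A i)|?M. f s)"
      proof -
        have "(\<lambda>n. LINT s:(\<Union>i<n. A i)|?M. f s) \<longlonglongrightarrow> (LINT s:(\<Union>i. A i)|?M. f s)"
          unfolding set_lebesgue_integral_def
        proof (rule integral_dominated_convergence[where w="\<lambda>s. norm (f s)"])
          show "AE x in ?M. (\<lambda>n. indicat_real (\<Union>i<n. A i) x *\<^sub>R f x) \<longlonglongrightarrow> indicat_real (\<Union>i. A i) x *\<^sub>R f x"
            by (intro AE_I2 tendsto_scaleR LIMSEQ_indicator_UN tendsto_const)
          show "AE s in ?M. norm (indicat_real (\<Union>i<n. A i) s *\<^sub>R f s) \<le> norm (f s)" for n
            by (intro AE_I2) (simp add: indicator_def)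
        qed (use A f in \<open>auto intro!: meas\<close>)
        moreover have "(LINT s:(\<Union>i<n. A i)|?M. f s) = (\<Sum>i<n. LINT s:A i|?M. f s)" for n
        proof (induction n)
          case 0 show ?case by (simp add: set_lebesgue_integral_def)
        next
          case (Suc n)
          have "A i \<inter> A n = {}" if "i < n" for i
            using union(1) that by (simp add: disjoint_family_on_def)
          then have "(\<Union>i<n. A i) \<inter> A n = {}" by blast
          then have "(LINT s:(\<Union>i<n. A i) \<union> A n|?M. f s) = (LINT s:(\<Union>i<n. A i)|?M. f s) + (LINT s:A n|?M. f s)"
            using A by (intro set_integral_Un int) auto
          moreover have "(\<Union>i<Suc n. A i) = (\<Union>i<n. A i) \<union> A n" by (auto simp: less_Suc_eq)
          ultimately show ?case using Suc by simp
        qed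
        ultimately show ?thesis by (simp add: sums_def)
      qed
      then have "(\<lambda>i::nat. 0::'b) sums (LINT s:(\<Union>i. A i)|?M. f s)" by (simp only: union)
      then show ?case by (rule sums_unique2) (rule sums_zero)
    qed
  qed
  interpret finite_measure ?M by (rule finite_measure_lebesgue_on_Ioo)
  show ?thesis
  proof (rule density_zero[OF f])
    fix A assume "A \<in> sets ?M"
    then have "A \<in> sets lebesgue" by (auto simp: sets_restrict_space)
    then obtain S N N' where A: "A = S \<union> N" "N \<subseteq> N'" "N' \<in> null_sets lborel" "S \<in> sets lborel"
      by (auto elim!: sets_completionE)
    have "N' \<in> null_sets lebesgue" using A(3) by (rule null_sets_completionI)
    then have ae: "AE s in lebesgue. s \<notin> N'" by (rule AE_not_in)
    then have "AE s in ?M. s \<notin> N'"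
      by (subst AE_restrict_space_iff) auto
    then have *: "AE s in ?M. indicator A s *\<^sub>R f s = indicator S s *\<^sub>R f s"
      by eventually_elim (use A(1,2) in \<open>auto simp: indicator_def\<close>)
    have "(LINT s:A|?M. f s) = (LINT s:S|?M. f s)"
      unfolding set_lebesgue_integral_def
    proof (rule integral_cong_AE)
      show "(\<lambda>s. indicator A s *\<^sub>R f s) \<in> borel_measurable ?M"
        using \<open>A \<in> sets ?M\<close> by (intro borel_measurable_scaleR borel_measurable_indicator) auto
      show "(\<lambda>s. indicator S s *\<^sub>R f s) \<in> borel_measurable ?M"
        using A(4) by (intro meas) simp
    qed (rule *)
    then show "(LINT s:A|?M. f s) = 0" using borel A(4) by simp
  qed
qed

text \<open>Absolute continuity encoded by the fundamental theorem of calculus for increments.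
  Half-open intervals make increments over adjacent intervals add exactly, on which the bisection in
  the chain rule relies.\<close>

definition has_ac_deriv :: "real \<Rightarrow> real \<Rightarrow> (real \<Rightarrow> 'b::euclidean_space) \<Rightarrow> (real \<Rightarrow> 'b) \<Rightarrow> bool" where
  "has_ac_deriv t T y v \<longleftrightarrow> integrable (lebesgue_on {t<..<T}) v \<and>
     (\<forall>a b. t \<le> a \<longrightarrow> a \<le> b \<longrightarrow> b \<le> T \<longrightarrow> y b - y a = (LINT s:{a<..b}|lebesgue_on {t<..<T}. v s))"

section \<open>Absolutely continuous curves: chain rule, zero sets, uniqueness of the
  derivative\<close>

lemma measurable_continuous_Ioo:
  fixes y :: "real \<Rightarrow> 'b::euclidean_space"
  assumes "continuous_on {t..T} y"
  shows "y \<in> borel_measurable (lebesgue_on {t<..<T})"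
proof (rule continuous_imp_measurable_on_sets_lebesgue)
  show "continuous_on {t<..<T} y" using assms by (rule continuous_on_subset) auto
qed auto

lemma integrable_const_Ioo [simp]: "integrable (lebesgue_on {a<..<b::real}) (\<lambda>_. c :: 'b::euclidean_space)"
  by (intro finite_measure.integrable_const finite_measure_lebesgue_on_Ioo)

lemma integrable_bounded_inner:
  fixes k v :: "real \<Rightarrow> 'b::euclidean_space"
  assumes "integrable (lebesgue_on {t<..<T}) v" "continuous_on {t..T} k"
  shows "integrable (lebesgue_on {t<..<T}) (\<lambda>s. k s \<bullet> v s)"
proof -
  have "bounded (k ` {t..T})"
    using assms(2) by (intro compact_imp_bounded compact_continuous_image) auto
  then obtain B where B: "\<And>s. s \<in> {t..T} \<Longrightarrow> norm (k s) \<le> B" by (meson bounded_iff imageI)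
  note [measurable] = measurable_continuous_Ioo[OF assms(2)] borel_measurable_integrable[OF assms(1)]
  show ?thesis
  proof (rule Bochner_Integration.integrable_bound[of _ "\<lambda>s. B * norm (v s)"])
    show "AE s in lebesgue_on {t<..<T}. norm (k s \<bullet> v s) \<le> norm (B * norm (v s))"
    proof (rule AE_I2)
      fix s assume "s \<in> space (lebesgue_on {t<..<T})"
      then have "norm (k s) \<le> B" using B by auto
      then have "norm (k s) * norm (v s) \<le> B * norm (v s)" by (intro mult_right_mono) auto
      then show "norm (k s \<bullet> v s) \<le> norm (B * norm (v s))"
        using Cauchy_Schwarz_ineq2[of "k s" "v s"] by auto
    qed
  qed (use assms(1) in auto)
qed

lemma has_ac_deriv_chain:
  fixes y v K :: "_ \<Rightarrow> 'b::euclidean_space" and h :: "'b \<Rightarrow> real"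
  assumes y: "has_ac_deriv t T y v" "continuous_on {t..T} y" "y ` {t..T} \<subseteq> N"
    and K: "continuous_on N K"
    and h: "\<And>x. x \<in> N \<Longrightarrow> (h has_derivative (\<lambda>w. K x \<bullet> w)) (at x within N)"
  shows "has_ac_deriv t T (\<lambda>s. h (y s)) (\<lambda>s. K (y s) \<bullet> v s)"
proof -
  let ?M = "lebesgue_on {t<..<T}"
  have v: "integrable ?M v"
    and yv: "\<And>a b. t \<le> a \<Longrightarrow> a \<le> b \<Longrightarrow> b \<le> T \<Longrightarrow> y b - y a = (LINT s:{a<..b}|?M. v s)"
    using y(1) by (auto simp: has_ac_deriv_def)
  have Ky: "continuous_on {t..T} (\<lambda>s. K (y s))"
    using K y(2,3) by (rule continuous_on_compose2)
  have Kv: "integrable ?M (\<lambda>s. K (y s) \<bullet> v s)"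
    using v Ky by (rule integrable_bounded_inner)
  have nv: "integrable ?M (\<lambda>s. norm (v s))" using v by simp
  have est: "\<bar>h (y b0) - h (y a0) - (LINT s:{a0<..b0}|?M. K (y s) \<bullet> v s)\<bar>
      \<le> (3 * e) * (LINT s:{a0<..b0}|?M. norm (v s))"
    if "0 < e" "t \<le> a0" "a0 \<le> b0" "b0 \<le> T" for e a0 b0
  proof -
    \<comment> \<open>Bisection hands over all short intervals around a point, also those that leave
      \<open>{t..T}\<close>; the premises inside \<open>P\<close> make it trivial for these. The
      factor 3 counts the errors at the two end points and the one from freezing
      \<open>K\<close>.\<close>
    define P where "P a b \<longleftrightarrow> (t \<le> a \<longrightarrow> b \<le> T \<longrightarrow>
      \<bar>h (y b) - h (y a) - (LINT s:{a<..b}|?M. K (y s) \<bullet> v s)\<bar> \<le> (3 * e) * (LINT s:{a<..b}|?M. norm (v s)))" for a b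
    have "P a0 b0"
      using \<open>a0 \<le> b0\<close>
    proof (induction rule: Bolzano)
      case (trans a b c)
      then show ?case
        using set_integral_Ioc_combine[OF Kv \<open>a \<le> b\<close> \<open>b \<le> c\<close>] set_integral_Ioc_combine[OF nv \<open>a \<le> b\<close> \<open>b \<le> c\<close>]
        unfolding P_def by (auto simp: algebra_simps)
    next
      case (local x)
      then have x: "x \<in> {t..T}" using that by auto
      then have yx: "y x \<in> N" using y(3) by auto
      obtain d1 where d1: "d1 > 0" "\<And>z. z \<in> N \<Longrightarrow> norm (z - y x) < d1 \<Longrightarrow>
          norm (h z - h (y x) - K (y x) \<bullet> (z - y x)) \<le> e * norm (z - y x)"
        using h[OF yx] \<open>0 < e\<close> unfolding has_derivative_within_alt by blast
      obtain d2 where d2: "d2 > 0" "\<And>z. z \<in> N \<Longrightarrow> norm (z - y x) < d2 \<Longrightarrow> norm (K z - K (y x)) \<le> e"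
        using K yx \<open>0 < e\<close> unfolding continuous_on_iff dist_norm by (meson less_imp_le)
      obtain d where d: "d > 0" "\<And>s. s \<in> {t..T} \<Longrightarrow> \<bar>s - x\<bar> < d \<Longrightarrow> norm (y s - y x) < min d1 d2"
        using y(2) x d1(1) d2(1) unfolding continuous_on_iff dist_norm
        by (metis min_less_iff_conj real_norm_def)
      have "P a b" if ab: "a \<le> x" "x \<le> b" "b - a < d" for a b
        unfolding P_def
      proof (intro impI)
        assume "t \<le> a" "b \<le> T"
        define I where "I = (LINT s:{a<..b}|?M. norm (v s))"
        have inc: "norm (y s' - y s) \<le> I" if "a \<le> s" "s \<le> s'" "s' \<le> b" for s s'
        proof -
          have "y s' - y s = (LINT s:{s<..s'}|?M. v s)"
            using that \<open>t \<le> a\<close> \<open>b \<le> T\<close> by (intro yv) auto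
          then have "norm (y s' - y s) \<le> (LINT s:{s<..s'}|?M. norm (v s))"
            using set_integral_Ioc_norm_bound[OF v nv] by auto
          also have "\<dots> \<le> I"
            unfolding I_def set_lebesgue_integral_def
            using that set_integrable_Ioc[OF nv] unfolding set_integrable_def
            by (intro integral_mono) (auto simp: indicator_def)
          finally show ?thesis .
        qed
        have close: "norm (h (y s) - h (y x) - K (y x) \<bullet> (y s - y x)) \<le> e * norm (y s - y x)"
          if "s \<in> {a..b}" for s
        proof -
          have "s \<in> {t..T}" "\<bar>s - x\<bar> < d" using that ab \<open>t \<le> a\<close> \<open>b \<le> T\<close> by auto
          then have "y s \<in> N" "norm (y s - y x) < d1" using d(2)[of s] y(3) by auto
          then show ?thesis by (rule d1(2))
        qed
        have 1: "\<bar>h (y b) - h (y x) - K (y x) \<bullet> (y b - y x)\<bar> \<le> e * I"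
        proof -
          have "e * norm (y b - y x) \<le> e * I"
            using inc[of x b] ab \<open>0 < e\<close> by (intro mult_left_mono) auto
          then show ?thesis using close[of b] ab by (simp add: abs_le_iff)
        qed
        have 2: "\<bar>h (y a) - h (y x) - K (y x) \<bullet> (y a - y x)\<bar> \<le> e * I"
        proof -
          have "e * norm (y a - y x) \<le> e * I"
            using inc[of a x] ab \<open>0 < e\<close> by (intro mult_left_mono) (auto simp: norm_minus_commute)
          then show ?thesis using close[of a] ab by (simp add: abs_le_iff)
        qed
        have 3: "\<bar>K (y x) \<bullet> (y b - y a) - (LINT s:{a<..b}|?M. K (y s) \<bullet> v s)\<bar> \<le> e * I"
        proof -
          have "K (y x) \<bullet> (y b - y a) = (LINT s:{a<..b}|?M. K (y x) \<bullet> v s)"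
            using yv[of a b] ab \<open>t \<le> a\<close> \<open>b \<le> T\<close> set_integrable_Ioc[OF v, of a b]
            unfolding set_lebesgue_integral_def set_integrable_def
            by (simp flip: integral_inner_right)
          then have "K (y x) \<bullet> (y b - y a) - (LINT s:{a<..b}|?M. K (y s) \<bullet> v s) =
            (LINT s:{a<..b}|?M. K (y x) \<bullet> v s - K (y s) \<bullet> v s)"
            using v Kv by (simp add: set_integral_diff set_integrable_Ioc)
          moreover have "norm (LINT s:{a<..b}|?M. K (y x) \<bullet> v s - K (y s) \<bullet> v s) \<le> (LINT s:{a<..b}|?M. e * norm (v s))"
          proof (rule set_integral_Ioc_norm_bound)
            fix s assume s: "s \<in> {t<..<T}" "s \<in> {a<..b}"
            then have "\<bar>s - x\<bar> < d" using ab by auto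
            with s have "y s \<in> N" "norm (y s - y x) < d2" using d(2)[of s] y(3) by auto
            then have "norm (K (y s) - K (y x)) \<le> e" by (rule d2(2))
            then have "norm (K (y x) - K (y s)) * norm (v s) \<le> e * norm (v s)"
              by (intro mult_right_mono) (auto simp: norm_minus_commute)
            then show "norm (K (y x) \<bullet> v s - K (y s) \<bullet> v s) \<le> e * norm (v s)"
              using Cauchy_Schwarz_ineq2[of "K (y x) - K (y s)" "v s"] by (simp add: inner_diff_left)
          qed (use v Kv nv in auto)
          ultimately show ?thesis by (simp add: I_def)
        qed
        have "K (y x) \<bullet> (y b - y a) = K (y x) \<bullet> (y b - y x) - K (y x) \<bullet> (y a - y x)"
          by (simp add: inner_diff_right)
        with 1 2 3 have "\<bar>h (y b) - h (y a) - (LINT s:{a<..b}|?M. K (y s) \<bullet> v s)\<bar> \<le> 3 * (e * I)"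
          by linarith
        then show "\<bar>h (y b) - h (y a) - (LINT s:{a<..b}|?M. K (y s) \<bullet> v s)\<bar> \<le> (3 * e) * (LINT s:{a<..b}|?M. norm (v s))"
          by (simp add: I_def mult.assoc)
      qed
      with \<open>d > 0\<close> show ?case by blast
    qed
    then show ?thesis using that by (simp add: P_def)
  qed
  have "h (y b) - h (y a) = (LINT s:{a<..b}|?M. K (y s) \<bullet> v s)" if ab: "t \<le> a" "a \<le> b" "b \<le> T" for a b
  proof -
    let ?I = "LINT s:{a<..b}|?M. norm (v s)"
    have I0: "0 \<le> ?I" unfolding set_lebesgue_integral_def by (intro integral_nonneg_AE) auto
    have "\<bar>h (y b) - h (y a) - (LINT s:{a<..b}|?M. K (y s) \<bullet> v s)\<bar> \<le> 0 + e" if "e > 0" for e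
    proof -
      \<comment> \<open>The tolerance is scaled so that three times its product with
        \<open>?I\<close> stays below \<open>e\<close>; the summand 1 covers
        \<open>?I = 0\<close>.\<close>
      have "\<bar>h (y b) - h (y a) - (LINT s:{a<..b}|?M. K (y s) \<bullet> v s)\<bar> \<le> (3 * (e / (3 * (?I + 1)))) * ?I"
        using I0 that by (intro est ab) (simp add: divide_simps)
      also have "\<dots> = e * (?I / (?I + 1))" using I0 by (simp add: field_simps)
      also have "\<dots> \<le> e * 1" using I0 that by (intro mult_left_mono) auto
      finally show ?thesis by simp
    qed
    then have "\<bar>h (y b) - h (y a) - (LINT s:{a<..b}|?M. K (y s) \<bullet> v s)\<bar> \<le> 0" by (rule field_le_epsilon)
    then show ?thesis by simp
  qed
  then show ?thesis using Kv by (simp add: has_ac_deriv_def)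
qed

text \<open>The function \<open>arctan (n u) / n\<close> tends to 0, whereas its derivative \<open>u' / (1 + (n u)\<^sup>2)\<close> tends to
  \<open>u'\<close> times the indicator of \<open>{u = 0}\<close>.\<close>

lemma has_ac_deriv_zero_set:
  fixes u w :: "real \<Rightarrow> real"
  assumes uw: "has_ac_deriv t T u w" and u: "continuous_on {t..T} u"
  shows "AE s in lebesgue_on {t<..<T}. u s = 0 \<longrightarrow> w s = 0"
proof -
  let ?M = "lebesgue_on {t<..<T}"
  have w: "integrable ?M w" using uw by (simp add: has_ac_deriv_def)
  note [measurable] = measurable_continuous_Ioo[OF u] borel_measurable_integrable[OF w]
  \<comment> \<open>\<open>D n\<close> is the derivative of
    \<open>arctan (real (Suc n) * x) / real (Suc n)\<close>; the successor avoids division by 0. Its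
    values lie in [0, 1], so |w| dominates.\<close>
  define D where "D n x = 1 / (1 + (real (Suc n) * x)\<^sup>2)" for n and x :: real
  have pos: "1 + (r * x)\<^sup>2 > 0" for r x :: real
    by (metis add_pos_nonneg zero_le_power2 zero_less_one)
  have "(LINT s:{a<..b}|?M. indicator {s. u s = 0} s * w s) = 0" if ab: "t \<le> a" "a \<le> b" "b \<le> T" for a b
  proof -
    have "(\<lambda>n. (LINT s:{a<..b}|?M. D n (u s) * w s)) \<longlonglongrightarrow> (LINT s:{a<..b}|?M. indicator {s. u s = 0} s * w s)"
      unfolding set_lebesgue_integral_def
    proof (rule integral_dominated_convergence[where w="\<lambda>s. \<bar>w s\<bar>"])
      show "AE s in ?M. (\<lambda>n. indicator {a<..b} s *\<^sub>R (D n (u s) * w s)) \<longlonglongrightarrow>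
              indicator {a<..b} s *\<^sub>R (indicator {s. u s = 0} s * w s)"
      proof (rule AE_I2)
        fix s
        have "(\<lambda>n. D n (u s)) \<longlonglongrightarrow> (indicator {s. u s = 0} s)"
        proof (cases "u s = 0")
          case True then show ?thesis by (simp add: D_def)
        next
          case False
          have "(\<lambda>n. 1 / (1 + (real (Suc n) * u s)\<^sup>2)) \<longlonglongrightarrow> 0"
            using False by real_asymp
          then show ?thesis using False by (simp add: D_def)
        qed
        then show "(\<lambda>n. indicator {a<..b} s *\<^sub>R (D n (u s) * w s)) \<longlonglongrightarrow>
              indicator {a<..b} s *\<^sub>R (indicator {s. u s = 0} s * w s)"
          by (intro tendsto_intros)
      qed
      show "AE s in ?M. norm (indicator {a<..b} s *\<^sub>R (D n (u s) * w s)) \<le> \<bar>w s\<bar>" for n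
      proof (rule AE_I2)
        fix s
        have "\<bar>D n (u s)\<bar> \<le> 1"
          using pos[of "real (Suc n)" "u s"] unfolding D_def
          by (subst abs_of_nonneg) (simp_all add: divide_le_eq del: of_nat_Suc)
        then show "norm (indicator {a<..b} s *\<^sub>R (D n (u s) * w s)) \<le> \<bar>w s\<bar>"
          by (auto simp: indicator_def abs_mult intro: mult_left_le_one_le)
      qed
      show "(\<lambda>s. indicator {a<..b} s *\<^sub>R (D n (u s) * w s)) \<in> borel_measurable ?M" for n
        unfolding D_def by measurable
      show "(\<lambda>s. indicator {a<..b} s *\<^sub>R (indicator {s. u s = 0} s * w s)) \<in> borel_measurable ?M"
        unfolding indicator_def by measurable
    qed (use w in auto)
    moreover have "(\<lambda>n. (LINT s:{a<..b}|?M. D n (u s) * w s)) \<longlonglongrightarrow> 0"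
    proof -
      have eq: "(LINT s:{a<..b}|?M. D n (u s) * w s) =
        arctan (real (Suc n) * u b) / real (Suc n) - arctan (real (Suc n) * u a) / real (Suc n)" for n
      proof -
        have "has_ac_deriv t T (\<lambda>s. arctan (real (Suc n) * u s) / real (Suc n)) (\<lambda>s. D n (u s) \<bullet> w s)"
        proof (rule has_ac_deriv_chain[OF uw u, of UNIV])
          show "continuous_on UNIV (D n)"
            unfolding D_def using pos by (intro continuous_intros ballI) (metis less_irrefl)
          show "((\<lambda>x. arctan (real (Suc n) * x) / real (Suc n)) has_derivative (\<bullet>) (D n x)) (at x)" for x
          proof -
            have "((\<lambda>x. arctan (real (Suc n) * x) / real (Suc n)) has_real_derivative
                (inverse (1 + (real (Suc n) * x)\<^sup>2) * real (Suc n)) / real (Suc n)) (at x)"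
              by (intro derivative_eq_intros refl) auto
            moreover have "(inverse (1 + (real (Suc n) * x)\<^sup>2) * real (Suc n)) / real (Suc n) = D n x"
              by (simp add: D_def inverse_eq_divide del: of_nat_Suc)
            ultimately have "((\<lambda>x. arctan (real (Suc n) * x) / real (Suc n)) has_real_derivative D n x) (at x)"
              by simp
            then show ?thesis unfolding has_field_derivative_def by (simp add: inner_real_def[abs_def])
          qed
        qed auto
        then show ?thesis using ab by (simp add: has_ac_deriv_def)
      qed
      have lim: "(\<lambda>n. arctan (real (Suc n) * c) / real (Suc n)) \<longlonglongrightarrow> 0" for c
      proof (rule tendsto_0_le[where K=1])
        show "(\<lambda>n. 2 / real (Suc n)) \<longlonglongrightarrow> 0" by real_asymp
        have "\<bar>arctan z\<bar> \<le> 2" for z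
          using arctan_bounded[of z] pi_less_4 by linarith
        then have "norm (arctan (real (Suc n) * c) / real (Suc n)) \<le> norm (2 / real (Suc n)) * 1" for n
          by (simp add: divide_right_mono)
        then show "\<forall>\<^sub>F n in sequentially. norm (arctan (real (Suc n) * c) / real (Suc n)) \<le> norm (2 / real (Suc n)) * 1"
          by simp
      qed
      show ?thesis unfolding eq using tendsto_diff[OF lim[of "u b"] lim[of "u a"]] by simp
    qed
    ultimately show ?thesis using LIMSEQ_unique by blast
  qed
  then have "AE s in ?M. indicator {s. u s = 0} s * w s = 0"
    by (intro AE_eq_0_if_set_integral_Ioc_eq_0 integrable_indicator_scaleR[of ?M w "{s. u s = 0}", simplified])
       (use w in \<open>auto simp: indicator_def[abs_def]\<close>)
  then show ?thesis by eventually_elim (auto simp: indicator_def)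
qed

text \<open>Supplies the scalar observables of a vector-valued curve to which the statement about
  zero sets applies: coordinates relative to a vertex, and components normal to an edge.\<close>

lemma has_ac_deriv_affine:
  fixes y v :: "real \<Rightarrow> 'b::euclidean_space"
  assumes "has_ac_deriv t T y v"
  shows "has_ac_deriv t T (\<lambda>s. (y s - c) \<bullet> w) (\<lambda>s. v s \<bullet> w)"
proof -
  have v: "integrable (lebesgue_on {t<..<T}) v" using assms by (simp add: has_ac_deriv_def)
  have "(y b - c) \<bullet> w - (y a - c) \<bullet> w = (LINT s:{a<..b}|lebesgue_on {t<..<T}. v s \<bullet> w)"
    if "t \<le> a" "a \<le> b" "b \<le> T" for a b
  proof -
    have "(y b - c) \<bullet> w - (y a - c) \<bullet> w = (y b - y a) \<bullet> w" by (simp add: algebra_simps)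
    also have "\<dots> = (LINT s:{a<..b}|lebesgue_on {t<..<T}. v s) \<bullet> w" using assms that by (simp add: has_ac_deriv_def)
    also have "\<dots> = (LINT s:{a<..b}|lebesgue_on {t<..<T}. v s \<bullet> w)"
      using set_integrable_Ioc[OF v, of a b] unfolding set_lebesgue_integral_def set_integrable_def
      by (simp flip: integral_inner_left)
    finally show ?thesis .
  qed
  then show ?thesis using v by (simp add: has_ac_deriv_def)
qed

lemma has_ac_deriv_unique:
  assumes "has_ac_deriv t T y v" "has_ac_deriv t T y w"
  shows "AE s in lebesgue_on {t<..<T}. v s = w s"
proof -
  have v: "integrable (lebesgue_on {t<..<T}) v" and w: "integrable (lebesgue_on {t<..<T}) w"
    using assms by (auto simp: has_ac_deriv_def)
  have "AE s in lebesgue_on {t<..<T}. v s - w s = 0"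
  proof (rule AE_eq_0_if_set_integral_Ioc_eq_0)
    show "(LINT s:{a<..b}|lebesgue_on {t<..<T}. v s - w s) = 0" if "t \<le> a" "a \<le> b" "b \<le> T" for a b
      using assms that set_integrable_Ioc[OF v, of a b] set_integrable_Ioc[OF w, of a b]
      by (simp add: set_integral_diff has_ac_deriv_def)
  qed (use v w in simp)
  then show ?thesis by simp
qed

lemma integrable_continuous_Ioo:
  fixes f :: "real \<Rightarrow> 'b::euclidean_space"
  assumes "continuous_on {a..b} f"
  shows "integrable (lebesgue_on {a<..<b}) f"
proof -
  have "f absolutely_integrable_on {a..b}"
    by (intro absolutely_integrable_continuous_real assms)
  then have "f absolutely_integrable_on {a<..<b}"
    by (rule absolutely_integrable_on_Icc_iff_Ioo[THEN iffD1])
  then show ?thesis by (simp add: integrable_restrict_space set_integrable_def)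
qed

lemma bounded_on_Icc:
  fixes f :: "real \<Rightarrow> 'b::real_normed_vector"
  assumes "continuous_on {a..b} f"
  obtains B where "B > 0" "\<And>s. s \<in> {a..b} \<Longrightarrow> norm (f s) \<le> B"
proof -
  have "bounded (f ` {a..b})"
    using assms by (intro compact_imp_bounded compact_continuous_image) auto
  then show ?thesis using that unfolding bounded_pos by blast
qed

text \<open>Only an upper bound, since \<open>{a<..b}\<close> may reach beyond
  \<open>{t<..<T}\<close>, where the measure has no mass.\<close>

lemma set_integral_const_Ioc_le:
  fixes a b t T K :: real
  assumes "a \<le> b" "0 \<le> K"
  shows "(LINT s:{a<..b}|lebesgue_on {t<..<T}. K) \<le> K * (b - a)"
proof -
  have "(LINT s|lebesgue_on {t<..<T}. indicat_real {a<..b} s) = measure (lebesgue_on {t<..<T}) ({a<..b} \<inter> {t<..<T})"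
    by simp
  also have "\<dots> = measure lebesgue ({a<..b} \<inter> {t<..<T})"
    by (rule measure_restrict_space) (auto intro!: sets_completionI_sets)
  also have "\<dots> \<le> measure lebesgue {a<..b}"
  proof (rule measure_mono_fmeasurable)
    have "bounded {a<..b}" by (rule bounded_subset[OF bounded_closed_interval[of a b]]) auto
    then show "{a<..b} \<in> lmeasurable"
      by (rule bounded_set_imp_lmeasurable) (auto intro!: sets_completionI_sets)
  qed (auto intro!: sets_completionI_sets)
  also have "\<dots> = b - a" using assms by simp
  finally have "(LINT s|lebesgue_on {t<..<T}. indicat_real {a<..b} s) * K \<le> (b - a) * K"
    using assms(2) by (rule mult_right_mono)
  then show ?thesis unfolding set_lebesgue_integral_def by (simp add: mult.commute)
qed

section \<open>Weak derivatives\<close>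

lemma in_Lp_integrable:
  fixes v :: "real \<Rightarrow> 'b::euclidean_space"
  assumes "in_Lp p a b v" "1 \<le> p"
  shows "integrable (lebesgue_on {a<..<b}) v"
proof (rule Bochner_Integration.integrable_bound)
  show "integrable (lebesgue_on {a<..<b}) (\<lambda>s. 1 + norm (v s) powr p)"
    using assms(1) integrable_const_Ioo[of a b "1::real"]
    by (intro Bochner_Integration.integrable_add) (auto simp: in_Lp_def)
  show "AE s in lebesgue_on {a<..<b}. norm (v s) \<le> norm (1 + norm (v s) powr p)"
  proof (rule AE_I2)
    fix s
    have "norm (v s) \<le> 1 + norm (v s) powr p"
    proof (cases "norm (v s) \<le> 1")
      case True then show ?thesis by (simp add: add_increasing2)
    next
      case False
      then have "norm (v s) powr 1 \<le> norm (v s) powr p" using assms(2) by (intro powr_mono) auto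
      then show ?thesis using False by simp
    qed
    then show "norm (v s) \<le> norm (1 + norm (v s) powr p)" by simp
  qed
qed (use assms(1) in \<open>auto simp: in_Lp_def\<close>)

text \<open>The test functions approximating an indicator are differences of the quadratic splines \<open>ramp\<close>,
  which rise from 0 at \<open>u = 0\<close> to 1 at \<open>u = 2 h\<close>.\<close>

definition pos2 :: "real \<Rightarrow> real" where "pos2 u = (max 0 u)\<^sup>2"

lemma pos2_deriv: "(pos2 has_real_derivative 2 * max 0 u) (at u)"
proof -
  consider "u < 0" | "u = 0" | "u > 0" by linarith
  then show ?thesis
  proof cases
    case 1
    have "((\<lambda>u. 0) has_real_derivative 0) (at u)" by simp
    then have "(pos2 has_real_derivative 0) (at u)"
      by (rule has_field_derivative_transform_within_open[of _ _ _ "{..<0}"])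
         (use 1 in \<open>auto simp: pos2_def\<close>)
    then show ?thesis using 1 by simp
  next
    case 2
    have "((\<lambda>h. (pos2 (0 + h) - pos2 0) / h) \<longlongrightarrow> 0) (at 0)"
    proof (rule tendsto_0_le[where K=1 and f="\<lambda>h. h"])
      have "norm ((pos2 (0 + h) - pos2 0) / h) \<le> norm h * 1" for h
        by (cases "h \<le> 0") (simp_all add: pos2_def max_absorb1 max_absorb2 power2_eq_square)
      then show "\<forall>\<^sub>F h in at 0. norm ((pos2 (0 + h) - pos2 0) / h) \<le> norm h * 1" by simp
    qed (rule tendsto_ident_at)
    then show ?thesis using 2 by (simp add: DERIV_def)
  next
    case 3
    have "((\<lambda>u. u\<^sup>2) has_real_derivative 2 * u) (at u)" by (auto intro!: derivative_eq_intros)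
    then have "(pos2 has_real_derivative 2 * u) (at u)"
      by (rule has_field_derivative_transform_within_open[of _ _ _ "{0<..}"])
         (use 3 in \<open>auto simp: pos2_def\<close>)
    then show ?thesis using 3 by simp
  qed
qed

definition ramp :: "real \<Rightarrow> real \<Rightarrow> real" where
  "ramp h u = (pos2 u - 2 * pos2 (u - h) + pos2 (u - 2 * h)) / (2 * h\<^sup>2)"

text \<open>The derivative of \<open>ramp h\<close>: for h > 0 a hat function on [0, 2h] with peak
  1/h and integral 1. Being supported to the right of 0, it averages a function over [a, a + 2h]
  only.\<close>

definition tent :: "real \<Rightarrow> real \<Rightarrow> real" where
  "tent h u = (max 0 u - 2 * max 0 (u - h) + max 0 (u - 2 * h)) / h\<^sup>2"

lemma ramp_deriv:
  assumes "h > 0"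
  shows "(ramp h has_real_derivative tent h u) (at u)"
proof -
  have d: "((\<lambda>u. pos2 (u - c)) has_real_derivative 2 * max 0 (u - c)) (at u)" for c
  proof -
    have "((\<lambda>u. u - c) has_real_derivative 1) (at u)"
      by (auto intro!: derivative_eq_intros)
    from DERIV_chain2[OF pos2_deriv this] show ?thesis by simp
  qed
  have "(ramp h has_real_derivative
      (2 * max 0 u - 2 * (2 * max 0 (u - h)) + 2 * max 0 (u - 2 * h)) / (2 * h\<^sup>2)) (at u)"
    unfolding ramp_def[abs_def]
    using DERIV_cdivide[OF DERIV_add[OF DERIV_diff[OF d[of 0] DERIV_cmult[OF d[of h], of 2]] d[of "2 * h"]], of "2 * h\<^sup>2"]
    by simp
  moreover have "(2 * max 0 u - 2 * (2 * max 0 (u - h)) + 2 * max 0 (u - 2 * h)) / (2 * h\<^sup>2) =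
      (2 * (max 0 u - 2 * max 0 (u - h) + max 0 (u - 2 * h))) / (2 * h\<^sup>2)"
    by (simp add: algebra_simps)
  ultimately show ?thesis unfolding tent_def by (simp only: mult_divide_mult_cancel_left_if) simp
qed

lemma tent_nonneg: "h > 0 \<Longrightarrow> 0 \<le> tent h u"
  unfolding tent_def by (intro divide_nonneg_nonneg) (auto simp: max_def)

lemma tent_support:
  assumes "h > 0" "u \<le> 0 \<or> 2 * h \<le> u"
  shows "tent h u = 0"
proof -
  have "max 0 u - 2 * max 0 (u - h) + max 0 (u - 2 * h) = 0"
    using assms(2)
  proof
    assume "u \<le> 0" then show ?thesis using assms(1) by (simp add: max_absorb1)
  next
    assume "2 * h \<le> u" then show ?thesis using assms(1) by (simp add: max_absorb2)
  qed
  then show ?thesis by (simp add: tent_def)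
qed

lemma ramp_low: "h > 0 \<Longrightarrow> u \<le> 0 \<Longrightarrow> ramp h u = 0"
  by (auto simp: ramp_def pos2_def)

text \<open>Beyond 2h no truncation is active, and the second difference of the square with step h
  is 2 h^2, the denominator of \<open>ramp\<close>.\<close>

lemma ramp_high:
  assumes "h > 0" "2 * h \<le> u"
  shows "ramp h u = 1"
proof -
  have "pos2 u - 2 * pos2 (u - h) + pos2 (u - 2 * h) = 2 * h\<^sup>2"
    using assms by (simp add: pos2_def max_absorb2) (simp add: power2_eq_square algebra_simps)
  then show ?thesis using assms(1) by (simp add: ramp_def)
qed

text \<open>The derivative \<open>tent h\<close> is nonnegative, so the values lie between those far
  to the left and those far to the right.\<close>

lemma ramp_range: "h > 0 \<Longrightarrow> 0 \<le> ramp h u \<and> ramp h u \<le> 1"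
proof -
  assume h: "h > 0"
  have mono: "ramp h a \<le> ramp h b" if "a \<le> b" for a b
    using that
  proof (rule DERIV_nonneg_imp_nondecreasing)
    fix x show "\<exists>y. (ramp h has_real_derivative y) (at x) \<and> 0 \<le> y"
      by (rule exI[of _ "tent h x"]) (simp add: ramp_deriv tent_nonneg h)
  qed
  show ?thesis
    using mono[of "min u 0" u] mono[of u "max u (2 * h)"] ramp_low[OF h, of "min u 0"] ramp_high[OF h, of "max u (2*h)"]
    by simp
qed

lemma continuous_tent: "continuous_on UNIV (tent h)"
  unfolding tent_def divide_inverse by (intro continuous_intros)

lemma integral_tent_Ioo:
  assumes "h > 0" "t \<le> a" "a + 2 * h \<le> T"
  shows "integrable (lebesgue_on {t<..<T}) (\<lambda>s. tent h (s - a))"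
    and "(LINT s|lebesgue_on {t<..<T}. tent h (s - a)) = 1"
proof -
  let ?f = "\<lambda>s. tent h (s - a)"
  have c: "continuous_on X ?f" for X
    by (rule continuous_on_compose2[OF continuous_tent]) (auto intro!: continuous_intros)
  have ai: "?f absolutely_integrable_on {t..T}"
    by (intro absolutely_integrable_continuous_real c)
  then have ai': "?f absolutely_integrable_on {t<..<T}"
    by (rule absolutely_integrable_on_Icc_iff_Ioo[THEN iffD1])
  then show i: "integrable (lebesgue_on {t<..<T}) ?f"
    by (simp add: integrable_restrict_space set_integrable_def)
  have "(?f has_integral (ramp h (T - a) - ramp h (t - a))) {t..T}"
  proof (rule fundamental_theorem_of_calculus)
    show "((\<lambda>s. ramp h (s - a)) has_vector_derivative ?f s) (at s within {t..T})" for s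
    proof -
      have "((\<lambda>s. ramp h (s - a)) has_real_derivative tent h (s - a) * 1) (at s)"
        by (rule DERIV_chain2[OF ramp_deriv[OF assms(1)]]) (auto intro!: derivative_eq_intros)
      then show ?thesis
        by (simp add: has_real_derivative_iff_has_vector_derivative has_vector_derivative_at_within)
    qed
  qed (use assms in auto)
  then have "(?f has_integral 1) {t..T}"
    using assms ramp_low[of h "t - a"] ramp_high[of h "T - a"] by simp
  then have "integral {t<..<T} ?f = 1"
    using integral_open_interval_real[of t T ?f] by (simp add: integral_unique)
  then show "(LINT s|lebesgue_on {t<..<T}. ?f s) = 1"
    using lebesgue_integral_eq_integral[OF i] by simp
qed

text \<open>The weight has mass 1 and vanishes off [a, a + 2h], so only the oscillation of
  \<open>y\<close> on that interval enters.\<close>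

lemma tent_average:
  fixes y :: "real \<Rightarrow> 'b::euclidean_space"
  assumes y: "continuous_on {t..T} y" and h: "h > 0" "t \<le> a" "a + 2 * h \<le> T"
    and e: "\<And>s. s \<in> {a..a + 2 * h} \<Longrightarrow> norm (y s - c) \<le> e"
  shows "integrable (lebesgue_on {t<..<T}) (\<lambda>s. tent h (s - a) *\<^sub>R y s)"
    and "norm ((LINT s|lebesgue_on {t<..<T}. tent h (s - a) *\<^sub>R y s) - c) \<le> e"
proof -
  let ?M = "lebesgue_on {t<..<T}"
  note tent = integral_tent_Ioo[OF h]
  have "bounded (y ` {t..T})"
    using y by (intro compact_imp_bounded compact_continuous_image) auto
  then obtain B where B: "\<And>s. s \<in> {t..T} \<Longrightarrow> norm (y s) \<le> B" by (meson bounded_iff imageI)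
  note [measurable] = measurable_continuous_Ioo[OF y] borel_measurable_integrable[OF tent(1)]
  show i: "integrable ?M (\<lambda>s. tent h (s - a) *\<^sub>R y s)"
  proof (rule Bochner_Integration.integrable_bound[of _ "\<lambda>s. B * tent h (s - a)"])
    show "AE s in ?M. norm (tent h (s - a) *\<^sub>R y s) \<le> norm (B * tent h (s - a))"
    proof (rule AE_I2)
      fix s assume "s \<in> space ?M"
      then have "norm (y s) \<le> B" using B by auto
      then have "tent h (s - a) * norm (y s) \<le> tent h (s - a) * B"
        using tent_nonneg[OF h(1)] by (intro mult_left_mono)
      then show "norm (tent h (s - a) *\<^sub>R y s) \<le> norm (B * tent h (s - a))"
        using tent_nonneg[OF h(1), of "s - a"] by (simp add: mult.commute)
    qed
  qed (use tent in auto)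
  have "(LINT s|?M. tent h (s - a) *\<^sub>R (y s - c)) = (LINT s|?M. tent h (s - a) *\<^sub>R y s) - c"
    using i tent by (simp add: scaleR_diff_right)
  moreover have "norm (LINT s|?M. tent h (s - a) *\<^sub>R (y s - c)) \<le> (LINT s|?M. tent h (s - a) * e)"
  proof (rule Bochner_Integration.integral_norm_bound_integral)
    show "integrable ?M (\<lambda>s. tent h (s - a) *\<^sub>R (y s - c))"
      using i tent by (simp add: scaleR_diff_right)
    fix s
    show "norm (tent h (s - a) *\<^sub>R (y s - c)) \<le> tent h (s - a) * e"
    proof (cases "s \<in> {a..a + 2 * h}")
      case True
      then show ?thesis using e[of s] tent_nonneg[OF h(1), of "s - a"] by (simp add: mult_left_mono)
    next
      case False
      then have "tent h (s - a) = 0" using tent_support[OF h(1), of "s - a"] by auto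
      then show ?thesis by simp
    qed
  qed (use tent in auto)
  ultimately show "norm ((LINT s|?M. tent h (s - a) *\<^sub>R y s) - c) \<le> e" using tent by simp
qed

lemma tent_average_tendsto:
  fixes y :: "real \<Rightarrow> 'b::euclidean_space"
  assumes y: "continuous_on {t..T} y" and c: "t \<le> c" and h: "\<And>n. h n > 0" "\<And>n. c + 2 * h n \<le> T" "h \<longlonglongrightarrow> 0"
  shows "(\<lambda>n. LINT s|lebesgue_on {t<..<T}. tent (h n) (s - c) *\<^sub>R y s) \<longlonglongrightarrow> y c"
proof (rule metric_LIMSEQ_I)
  fix e :: real assume e: "e > 0"
  have "c \<in> {t..T}" using c h(1,2)[of 0] by auto
  then obtain d where d: "d > 0" "\<And>s. s \<in> {t..T} \<Longrightarrow> dist s c < d \<Longrightarrow> dist (y s) (y c) < e / 2"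
    using y e unfolding continuous_on_iff by (meson half_gt_zero)
  have "\<forall>\<^sub>F n in sequentially. h n < d / 2"
    using order_tendstoD(2)[OF h(3), of "d / 2"] d(1) by simp
  then obtain k where k: "\<And>n. n \<ge> k \<Longrightarrow> h n < d / 2" unfolding eventually_sequentially by blast
  have "dist (LINT s|lebesgue_on {t<..<T}. tent (h n) (s - c) *\<^sub>R y s) (y c) < e" if "n \<ge> k" for n
  proof -
    have "norm ((LINT s|lebesgue_on {t<..<T}. tent (h n) (s - c) *\<^sub>R y s) - y c) \<le> e / 2"
    proof (rule tent_average(2)[OF y h(1) c h(2)])
      fix s assume s: "s \<in> {c..c + 2 * h n}"
      then have "s \<in> {t..T}" "dist s c < d" using h(2)[of n] c k[OF that] by (auto simp: dist_real_def)
      then show "norm (y s - y c) \<le> e / 2" using d(2)[of s] by (simp add: dist_norm)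
    qed
    then show ?thesis using e by (simp add: dist_norm)
  qed
  then show "\<exists>no. \<forall>n\<ge>no. dist (LINT s|lebesgue_on {t<..<T}. tent (h n) (s - c) *\<^sub>R y s) (y c) < e" by blast
qed

text \<open>For small \<open>h\<close> this is a smoothed trapezoid close to the indicator of
  \<open>{a<..b}\<close>. It rises after \<open>a\<close> and falls after \<open>b\<close>, so its
  support ends at \<open>b + 2 * h\<close>, which must stay below \<open>T\<close>.\<close>

lemma test_function_ramp_diff:
  assumes h: "h > 0" and "t < a" "a \<le> b" "b + 2 * h < T"
  shows "test_function t T (\<lambda>s. ramp h (s - a) - ramp h (s - b))"
    and "deriv (\<lambda>s. ramp h (s - a) - ramp h (s - b)) = (\<lambda>s. tent h (s - a) - tent h (s - b))"
proof -
  let ?\<phi> = "\<lambda>s. ramp h (s - a) - ramp h (s - b)"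
  have d: "(?\<phi> has_real_derivative (tent h (s - a) - tent h (s - b))) (at s)" for s
  proof -
    have *: "((\<lambda>s. ramp h (s - a)) has_real_derivative tent h (s - a) * 1) (at s)" for a s
      by (rule DERIV_chain2[OF ramp_deriv[OF assms(1)]]) (auto intro!: derivative_eq_intros)
    show ?thesis using DERIV_diff[OF *[of a s] *[of b s]] by simp
  qed
  show "deriv ?\<phi> = (\<lambda>s. tent h (s - a) - tent h (s - b))"
    using DERIV_imp_deriv[OF d] by (intro ext)
  have c: "continuous_on X (\<lambda>s. tent h (s - c))" for X c
    by (rule continuous_on_compose2[OF continuous_tent]) (auto intro!: continuous_intros)
  have C1: "?\<phi> C1_differentiable_on UNIV"
    unfolding C1_differentiable_on_def
  proof (intro exI conjI ballI)
    show "(?\<phi> has_vector_derivative tent h (s - a) - tent h (s - b)) (at s)" for s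
      using d[of s] by (simp add: has_real_derivative_iff_has_vector_derivative)
    show "continuous_on UNIV (\<lambda>s. tent h (s - a) - tent h (s - b))"
      by (intro continuous_on_diff c)
  qed
  have "?\<phi> s = 0" if s: "s \<notin> {a..b + 2 * h}" for s
  proof -
    consider "s < a" | "s > b + 2 * h" using s by (meson atLeastAtMost_iff not_le)
    then show ?thesis
    proof cases
      case 1
      then show ?thesis using assms ramp_low[OF h, of "s - a"] ramp_low[OF h, of "s - b"] by simp
    next
      case 2
      then show ?thesis using assms ramp_high[OF h, of "s - a"] ramp_high[OF h, of "s - b"] by simp
    qed
  qed
  then have "{s. ?\<phi> s \<noteq> 0} \<subseteq> {a..b + 2 * h}" by blast
  then have sub: "closure {s. ?\<phi> s \<noteq> 0} \<subseteq> {a..b + 2 * h}" by (rule closure_minimal) auto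
  have "bounded {s. ?\<phi> s \<noteq> 0}"
    using \<open>{s. ?\<phi> s \<noteq> 0} \<subseteq> {a..b + 2 * h}\<close> by (rule bounded_subset[OF bounded_closed_interval])
  then have "compact (closure {s. ?\<phi> s \<noteq> 0})" by (simp only: compact_closure)
  moreover have "closure {s. ?\<phi> s \<noteq> 0} \<subseteq> {t<..<T}" using sub assms by force
  ultimately show "test_function t T ?\<phi>"
    using C1 unfolding test_function_def by blast
qed

text \<open>With smoothed indicators of \<open>{a<..b}\<close> as test functions, one side of the
  weak formulation averages \<open>y\<close> just after \<open>a\<close> and just after
  \<open>b\<close>, and the other tends to the integral of \<open>v\<close> by dominated
  convergence.\<close>

lemma weak_deriv_interior_increment:
  fixes y v :: "real \<Rightarrow> 'b::euclidean_space"
  assumes y: "continuous_on {t..T} y" and v: "integrable (lebesgue_on {t<..<T}) v"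
    and w: "has_weak_deriv t T y v" and ab: "t < a" "a \<le> b" "b < T"
  shows "y b - y a = (LINT s:{a<..b}|lebesgue_on {t<..<T}. v s)"
proof -
  let ?M = "lebesgue_on {t<..<T}"
  note [measurable] = borel_measurable_integrable[OF v]
  \<comment> \<open>The factor 4 gives \<open>2 * h n < T - b\<close>, which keeps the support of
    the test functions inside the open interval.\<close>
  define h where "h n = (T - b) / (4 * real (Suc n))" for n
  have h0: "h n > 0" for n using ab by (simp add: h_def)
  have h1: "2 * h n < T - b" for n
  proof -
    have "2 * h n = (T - b) * (1 / (2 * real (Suc n)))" by (simp add: h_def field_simps del: of_nat_Suc)
    also have "\<dots> < (T - b) * 1" using ab by (intro mult_strict_left_mono) auto
    finally show ?thesis by simp
  qed
  have hlim: "h \<longlonglongrightarrow> 0" unfolding h_def by real_asymp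
  define \<phi> where "\<phi> n s = ramp (h n) (s - a) - ramp (h n) (s - b)" for n s
  have test: "test_function t T (\<phi> n)" and der: "deriv (\<phi> n) = (\<lambda>s. tent (h n) (s - a) - tent (h n) (s - b))" for n
    using test_function_ramp_diff[OF h0, of t a b n T] ab h1[of n] unfolding \<phi>_def[abs_def] by auto
  have \<phi>_meas [measurable]: "\<phi> n \<in> borel_measurable borel" for n
    unfolding \<phi>_def ramp_def pos2_def by measurable
  have "(\<lambda>n. LINT s|?M. deriv (\<phi> n) s *\<^sub>R y s) \<longlonglongrightarrow> y a - y b"
  proof -
    have "(LINT s|?M. deriv (\<phi> n) s *\<^sub>R y s) =
      (LINT s|?M. tent (h n) (s - a) *\<^sub>R y s) - (LINT s|?M. tent (h n) (s - b) *\<^sub>R y s)" for n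
    proof -
      have "bounded (y ` {t..T})"
        using y by (intro compact_imp_bounded compact_continuous_image) auto
      then obtain B where B: "\<And>s. s \<in> {t..T} \<Longrightarrow> norm (y s) \<le> B" by (meson bounded_iff imageI)
      have "integrable ?M (\<lambda>s. tent (h n) (s - c) *\<^sub>R y s)" if "c \<in> {a, b}" for c
        using that ab h1[of n] h0[of n] B by (intro tent_average(1)[OF y, where c=0 and e=B]) auto
      then show ?thesis unfolding der scaleR_diff_left
        by (intro Bochner_Integration.integral_diff) auto
    qed
    moreover have "a + 2 * h n \<le> T" "b + 2 * h n \<le> T" for n using h1[of n] ab by auto
    ultimately show ?thesis
      using tendsto_diff[OF tent_average_tendsto[OF y, of a h] tent_average_tendsto[OF y, of b h]] h0 hlim ab
      by simp
  qed
  moreover have "(\<lambda>n. - (LINT s|?M. \<phi> n s *\<^sub>R v s)) \<longlonglongrightarrow> - (LINT s:{a<..b}|?M. v s)"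
    unfolding set_lebesgue_integral_def
  proof (intro tendsto_minus integral_dominated_convergence[where w="\<lambda>s. norm (v s)"] AE_I2)
    show "norm (\<phi> n s *\<^sub>R v s) \<le> norm (v s)" for n s
    proof -
      have "\<bar>\<phi> n s\<bar> \<le> 1"
        using ramp_range[OF h0, of n "s - a"] ramp_range[OF h0, of n "s - b"] unfolding \<phi>_def by linarith
      then show ?thesis by (simp add: mult_left_le_one_le)
    qed
    fix s
    \<comment> \<open>At \<open>s = a\<close> both ramps are 0, and at \<open>s = b > a\<close> the
      second one alone is. The limit is thus the indicator of the interval open at \<open>a\<close>
      and closed at \<open>b\<close>, for every \<open>s\<close>.\<close>
    have "\<forall>\<^sub>F n in sequentially. \<phi> n s = indicator {a<..b} s"
    proof -
      consider "s \<le> a" | "a < s" "s \<le> b" | "b < s" by linarith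
      then show ?thesis
      proof cases
        case 1
        then show ?thesis using ramp_low[OF h0] ab by (simp add: \<phi>_def)
      next
        case 2
        have "\<forall>\<^sub>F n in sequentially. h n < (s - a) / 2"
          using order_tendstoD(2)[OF hlim, of "(s - a) / 2"] 2 by simp
        then show ?thesis
          by eventually_elim (use 2 ramp_low[OF h0] ramp_high[OF h0] in \<open>simp add: \<phi>_def\<close>)
      next
        case 3
        have "\<forall>\<^sub>F n in sequentially. h n < (s - b) / 2"
          using order_tendstoD(2)[OF hlim, of "(s - b) / 2"] 3 by simp
        then show ?thesis
          by eventually_elim (use 3 ab ramp_high[OF h0] in \<open>simp add: \<phi>_def\<close>)
      qed
    qed
    then have "(\<lambda>n. \<phi> n s) \<longlonglongrightarrow> indicator {a<..b} s" by (rule tendsto_eventually)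
    then show "(\<lambda>n. \<phi> n s *\<^sub>R v s) \<longlonglongrightarrow> indicator {a<..b} s *\<^sub>R v s" by (intro tendsto_intros)
  next
    show "(\<lambda>s. \<phi> n s *\<^sub>R v s) \<in> borel_measurable ?M" for n
      using measurable_compose[OF measurable_ident_lebesgue_on \<phi>_meas] by measurable
  qed (use v in auto)
  moreover have "(LINT s|?M. deriv (\<phi> n) s *\<^sub>R y s) = - (LINT s|?M. \<phi> n s *\<^sub>R v s)" for n
    using w test unfolding has_weak_deriv_def by blast
  ultimately have "y a - y b = - (LINT s:{a<..b}|?M. v s)"
    by (simp add: LIMSEQ_unique)
  then show ?thesis by (simp add: algebra_simps)
qed

text \<open>Test functions do not see the end points. Increments are therefore taken between points
  that approach \<open>a\<close> and \<open>b\<close> from inside \<open>{t<..<T}\<close>, and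
  continuity of \<open>y\<close> up to \<open>t\<close> and \<open>T\<close> gives the
  limit.\<close>

lemma weak_deriv_has_ac_deriv:
  fixes y v :: "real \<Rightarrow> 'b::euclidean_space"
  assumes y: "continuous_on {t..T} y" and v: "integrable (lebesgue_on {t<..<T}) v"
    and w: "has_weak_deriv t T y v"
  shows "has_ac_deriv t T y v"
proof -
  let ?M = "lebesgue_on {t<..<T}"
  note [measurable] = borel_measurable_integrable[OF v]
  have "y b - y a = (LINT s:{a<..b}|?M. v s)" if ab: "t \<le> a" "a < b" "b \<le> T" for a b
  proof -
    define \<delta> where "\<delta> n = (T - t) / real (n + 3)" for n
    have \<delta>0: "\<delta> n > 0" for n using ab by (simp add: \<delta>_def)
    have \<delta>lim: "\<delta> \<longlonglongrightarrow> 0" unfolding \<delta>_def by real_asymp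
    define a' where "a' n = max a (t + \<delta> n)" for n
    define b' where "b' n = min b (T - \<delta> n)" for n
    have a': "a' \<longlonglongrightarrow> a"
      using tendsto_max[OF tendsto_const tendsto_add[OF tendsto_const \<delta>lim], of a t] ab
      unfolding a'_def[abs_def] by simp
    have b': "b' \<longlonglongrightarrow> b"
      using tendsto_min[OF tendsto_const tendsto_diff[OF tendsto_const \<delta>lim], of b T] ab
      unfolding b'_def[abs_def] by (simp add: min_absorb1)
    have ev: "\<forall>\<^sub>F n in sequentially. a' n < b' n"
      using tendsto_diff[OF b' a', THEN order_tendstoD(1), of 0] ab by simp
    have inc: "\<forall>\<^sub>F n in sequentially. y (b' n) - y (a' n) = (LINT s:{a' n<..b' n}|?M. v s)"
      using ev
    proof eventually_elim
      case (elim n)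
      show ?case using elim \<delta>0[of n]
        by (intro weak_deriv_interior_increment[OF y v w]) (auto simp: a'_def b'_def)
    qed
    have lim: "(\<lambda>n. y (b' n) - y (a' n)) \<longlonglongrightarrow> y b - y a"
    proof (intro tendsto_diff)
      show "(\<lambda>n. y (b' n)) \<longlonglongrightarrow> y b"
      proof (rule continuous_on_tendsto_compose[OF y b'])
        show "\<forall>\<^sub>F n in sequentially. b' n \<in> {t..T}" using ev
        proof eventually_elim
          case (elim n) then show ?case using ab \<delta>0[of n] by (auto simp: a'_def b'_def)
        qed
      qed (use ab in auto)
      show "(\<lambda>n. y (a' n)) \<longlonglongrightarrow> y a"
      proof (rule continuous_on_tendsto_compose[OF y a'])
        show "\<forall>\<^sub>F n in sequentially. a' n \<in> {t..T}" using ev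
        proof eventually_elim
          case (elim n) then show ?case using ab \<delta>0[of n] by (auto simp: a'_def b'_def)
        qed
      qed (use ab in auto)
    qed
    have "(\<lambda>n. (LINT s:{a' n<..b' n}|?M. v s)) \<longlonglongrightarrow> (LINT s:{a<..b}|?M. v s)"
      unfolding set_lebesgue_integral_def
    proof (intro integral_dominated_convergence[where w="\<lambda>s. norm (v s)"] AE_I2)
      fix s assume "s \<in> space ?M"
      then have s: "t < s" "s < T" by auto
      have "\<forall>\<^sub>F n in sequentially. \<delta> n < min (s - t) (T - s)"
        using order_tendstoD(2)[OF \<delta>lim, of "min (s - t) (T - s)"] s by simp
      then have "\<forall>\<^sub>F n in sequentially. indicator {a' n<..b' n} s = (indicator {a<..b} s :: real)"
        by eventually_elim (auto simp: a'_def b'_def indicator_def)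
      then have "(\<lambda>n. indicator {a' n<..b' n} s :: real) \<longlonglongrightarrow> indicator {a<..b} s" by (rule tendsto_eventually)
      then show "(\<lambda>n. indicator {a' n<..b' n} s *\<^sub>R v s) \<longlonglongrightarrow> indicator {a<..b} s *\<^sub>R v s" by (intro tendsto_intros)
    qed (use v in \<open>auto simp: indicator_def\<close>)
    with Lim_transform_eventually[OF lim inc] show ?thesis by (rule LIMSEQ_unique)
  qed
  then have "y b - y a = (LINT s:{a<..b}|?M. v s)" if "t \<le> a" "a \<le> b" "b \<le> T" for a b
    using that by (cases "a = b") (simp_all add: set_lebesgue_integral_def)
  then show ?thesis
    using v unfolding has_ac_deriv_def by blast
qed

section \<open>Linear combinations in L^p\<close>

lemma in_Lp_scaleR_right:
  assumes "f \<in> borel_measurable (lebesgue_on {a<..<b})" "integrable (lebesgue_on {a<..<b}) (\<lambda>s. \<bar>f s\<bar> powr p)"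
  shows "in_Lp p a b (\<lambda>s. f s *\<^sub>R e)"
proof -
  note [measurable] = assms(1)
  have "(\<lambda>s. f s *\<^sub>R e) \<in> borel_measurable (lebesgue_on {a<..<b})" by measurable
  then show ?thesis using assms(2) by (simp add: in_Lp_def powr_mult)
qed

lemma in_Lp_add:
  fixes f g :: "real \<Rightarrow> 'b::euclidean_space"
  assumes "0 \<le> p" "in_Lp p a b f" "in_Lp p a b g"
  shows "in_Lp p a b (\<lambda>s. f s + g s)"
proof -
  have [measurable]: "f \<in> borel_measurable (lebesgue_on {a<..<b})" "g \<in> borel_measurable (lebesgue_on {a<..<b})"
    and int: "integrable (lebesgue_on {a<..<b}) (\<lambda>s. norm (f s) powr p)" "integrable (lebesgue_on {a<..<b}) (\<lambda>s. norm (g s) powr p)"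
    using assms by (auto simp: in_Lp_def)
  have "integrable (lebesgue_on {a<..<b}) (\<lambda>s. norm (f s + g s) powr p)"
  proof (rule Bochner_Integration.integrable_bound)
    show "integrable (lebesgue_on {a<..<b}) (\<lambda>s. 2 powr p * (norm (f s) powr p + norm (g s) powr p))"
      using int by auto
    show "AE s in lebesgue_on {a<..<b}. norm (norm (f s + g s) powr p) \<le> norm (2 powr p * (norm (f s) powr p + norm (g s) powr p))"
    proof (rule AE_I2)
      fix s
      \<comment> \<open>Passing through the maximum uses only monotonicity of the power, which
        admits every \<open>p\<close> that is at least 0.\<close>
      have "norm (f s + g s) \<le> 2 * max (norm (f s)) (norm (g s))"
        using norm_triangle_ineq[of "f s" "g s"] by linarith
      then have "norm (f s + g s) powr p \<le> (2 * max (norm (f s)) (norm (g s))) powr p"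
        using assms(1) by (intro powr_mono2) auto
      also have "\<dots> = 2 powr p * max (norm (f s)) (norm (g s)) powr p" by (simp add: powr_mult)
      also have "\<dots> \<le> 2 powr p * (norm (f s) powr p + norm (g s) powr p)"
        by (intro mult_left_mono) (auto simp: max_def)
      finally show "norm (norm (f s + g s) powr p) \<le> norm (2 powr p * (norm (f s) powr p + norm (g s) powr p))"
        by simp
    qed
  qed measurable
  then show ?thesis by (simp add: in_Lp_def)
qed

lemma in_Lp_zero: "0 < p \<Longrightarrow> in_Lp p a b (\<lambda>_. 0)"
  by (simp add: in_Lp_def)

lemma in_Lp_sum:
  fixes f :: "'i \<Rightarrow> real \<Rightarrow> 'b::euclidean_space"
  assumes "0 < p" "finite I" "\<And>i. i \<in> I \<Longrightarrow> in_Lp p a b (f i)"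
  shows "in_Lp p a b (\<lambda>s. \<Sum>i\<in>I. f i s)"
  using assms(2,3)
proof induction
  case (insert i I)
  then show ?case using in_Lp_add[of p a b "f i" "\<lambda>s. \<Sum>i\<in>I. f i s"] assms(1) by simp
qed (simp add: in_Lp_zero assms(1))

section \<open>Compactness of convex combinations\<close>

text \<open>Fatou's lemma with a uniform bound in place of the lower limit; it serves both for
  integrability of limits and for upper bounds on their integrals. A limit that exists only almost
  everywhere need not inherit measurability, so this is asked of \<open>f\<close>.\<close>

lemma integral_le_of_AE_tendsto:
  fixes u :: "nat \<Rightarrow> 'c \<Rightarrow> real"
  assumes u: "\<And>n. integrable M (u n)" "\<And>n. AE s in M. 0 \<le> u n s"
    and C: "\<And>n. (LINT s|M. u n s) \<le> C" and f: "f \<in> borel_measurable M"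
    and lim: "AE s in M. (\<lambda>n. u n s) \<longlonglongrightarrow> f s"
  shows "integrable M f" and "(LINT s|M. f s) \<le> C"
proof -
  have nn: "\<And>n. 0 \<le> (LINT s|M. u n s)" using u by (intro integral_nonneg_AE)
  have "AE s in M. \<forall>n. 0 \<le> u n s" using u(2) by (simp add: AE_all_countable)
  with lim have f0: "AE s in M. 0 \<le> f s"
  proof eventually_elim
    case (elim s) then show ?case by (intro LIMSEQ_le_const[of "\<lambda>n. u n s"]) auto
  qed
  have [measurable]: "\<And>n. u n \<in> borel_measurable M" using u(1) by auto
  have "(\<integral>\<^sup>+s. ennreal (f s) \<partial>M) = (\<integral>\<^sup>+s. liminf (\<lambda>n. ennreal (u n s)) \<partial>M)"
  proof (rule nn_integral_cong_AE)
    show "AE s in M. ennreal (f s) = liminf (\<lambda>n. ennreal (u n s))"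
      using lim
    proof eventually_elim
      case (elim s)
      then have "(\<lambda>n. ennreal (u n s)) \<longlonglongrightarrow> ennreal (f s)" by (rule tendsto_ennrealI)
      then show ?case by (simp add: lim_imp_Liminf)
    qed
  qed
  also have "\<dots> \<le> liminf (\<lambda>n. \<integral>\<^sup>+s. ennreal (u n s) \<partial>M)"
    by (rule nn_integral_liminf) measurable
  also have "\<dots> = liminf (\<lambda>n. ennreal (LINT s|M. u n s))"
    using u by (simp add: nn_integral_eq_integral)
  also have "\<dots> \<le> liminf (\<lambda>n::nat. ennreal C)"
    using C by (intro Liminf_mono always_eventually allI ennreal_leI)
  also have "\<dots> = ennreal C" by (simp add: Liminf_const)
  finally have le: "(\<integral>\<^sup>+s. ennreal (f s) \<partial>M) \<le> ennreal C" .
  show fi: "integrable M f"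
    using le f f0 by (intro integrableI_nonneg) (auto simp: order_le_less_trans[OF _ ennreal_less_top])
  have "ennreal (LINT s|M. f s) \<le> ennreal C" using le fi f0 by (simp add: nn_integral_eq_integral)
  moreover have "0 \<le> C" using nn[of 0] C[of 0] by linarith
  ultimately show "(LINT s|M. f s) \<le> C" by (simp add: ennreal_le_iff)
qed

lemma abs_midpoint_powr_le:
  assumes "1 \<le> p"
  shows "\<bar>(a + b) / 2\<bar> powr p \<le> (\<bar>a\<bar> powr p + \<bar>b\<bar> powr p) / (2::real)"
proof -
  have "\<bar>(a + b) / 2\<bar> powr p \<le> ((\<bar>a\<bar> + \<bar>b\<bar>) / 2) powr p"
    using assms by (intro powr_mono2) auto
  also have "\<dots> \<le> (\<bar>a\<bar> powr p + \<bar>b\<bar> powr p) / 2"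
  \<comment> \<open>Convexity of the power is applied to positive arguments; a vanishing argument
    reduces to 2 <= 2^p.\<close>
  proof (cases "a = 0 \<or> b = 0")
    case True
    have "2 powr p \<ge> 2 powr 1" using assms by (intro powr_mono) auto
    then have "z powr p / 2 powr p \<le> z powr p / 2" for z :: real by (intro divide_left_mono) auto
    then show ?thesis using True assms by (auto simp: powr_divide)
  next
    case False
    then show ?thesis
      using convex_onD[OF powr_convex[OF assms], of "1 / 2" "\<bar>a\<bar>" "\<bar>b\<bar>"] by (simp add: add_divide_distrib)
  qed
  finally show ?thesis .
qed

lemma abs_le_1_plus_powr:
  assumes "1 \<le> p" shows "\<bar>a\<bar> \<le> 1 + \<bar>a\<bar> powr (p::real)"
proof (cases "\<bar>a\<bar> \<le> 1")
  case True then show ?thesis by (simp add: add_increasing2)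
next
  case False
  then have "\<bar>a\<bar> powr 1 \<le> \<bar>a\<bar> powr p" using assms by (intro powr_mono) auto
  then show ?thesis using False by simp
qed

text \<open>The Euclidean length of the vector (1, u). Linear growth keeps its integral finite on
  L^1, and since its square is a polynomial, its convexity gap can be computed by hand.\<close>

definition jsqrt :: "real \<Rightarrow> real" where "jsqrt u = sqrt (1 + u\<^sup>2)"

lemma jsqrt_ge: "1 \<le> jsqrt u" "\<bar>u\<bar> \<le> jsqrt u" "jsqrt u \<le> 1 + \<bar>u\<bar>"
proof -
  show "1 \<le> jsqrt u" by (simp add: jsqrt_def)
  have "sqrt (u\<^sup>2) \<le> jsqrt u" unfolding jsqrt_def by (intro real_sqrt_le_mono) simp
  then show "\<bar>u\<bar> \<le> jsqrt u" by simp
  show "jsqrt u \<le> 1 + \<bar>u\<bar>" unfolding jsqrt_def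
    by (rule real_le_lsqrt) (auto simp: power2_sum)
qed

lemma jsqrt_sq: "(jsqrt u)\<^sup>2 = 1 + u\<^sup>2"
  by (simp add: jsqrt_def)

definition jgap :: "real \<Rightarrow> real \<Rightarrow> real" where
  "jgap u w = (jsqrt u + jsqrt w) / 2 - jsqrt ((u + w) / 2)"

text \<open>\<open>A\<close> and \<open>B\<close> are the lengths of (1, u) and (1, w), and
  \<open>2 * C\<close> is the length of their sum, so the gap is half the defect in the triangle
  inequality. Lagrange's identity, with (u - w)^2 as the squared determinant, and a factorisation of
  two differences of squares bound it from below.\<close>

lemma jgap_ge: "(u - w)\<^sup>2 \<le> 4 * jsqrt u * jsqrt w * (jsqrt u + jsqrt w) * jgap u w"
  and jgap_nonneg: "0 \<le> jgap u w"
proof -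
  define A B C where "A = jsqrt u" "B = jsqrt w" "C = jsqrt ((u + w) / 2)"
  have AB: "A \<ge> 1" "B \<ge> 1" "C \<ge> 1" using jsqrt_ge by (auto simp: A_B_C_def)
  have sq: "A\<^sup>2 = 1 + u\<^sup>2" "B\<^sup>2 = 1 + w\<^sup>2" "C\<^sup>2 = 1 + ((u + w) / 2)\<^sup>2"
    by (simp_all add: A_B_C_def jsqrt_sq)
  have prod: "(A * B)\<^sup>2 - (1 + u * w)\<^sup>2 = (u - w)\<^sup>2"
    unfolding power_mult_distrib sq by (simp add: power2_eq_square algebra_simps)
  have uw: "1 + u * w \<le> A * B"
  proof (rule power2_le_imp_le)
    have "0 \<le> (u - w)\<^sup>2" by simp
    then show "(1 + u * w)\<^sup>2 \<le> (A * B)\<^sup>2" using prod by linarith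
  qed (use AB in simp)
  have four: "4 * C\<^sup>2 = 4 + (u + w)\<^sup>2" unfolding sq by (simp add: power_divide)
  have diff: "(A + B)\<^sup>2 - (2 * C)\<^sup>2 = 2 * (A * B - (1 + u * w))"
    using four sq by (simp add: power2_sum power_mult_distrib algebra_simps)
  have CAB: "2 * C \<le> A + B"
  proof (rule power2_le_imp_le)
    have "0 \<le> 2 * (A * B - (1 + u * w))" using uw by simp
    then have "0 \<le> (A + B)\<^sup>2 - (2 * C)\<^sup>2" unfolding diff .
    then show "(2 * C)\<^sup>2 \<le> (A + B)\<^sup>2" by (simp only: diff_ge_0_iff_ge)
  qed (use AB in simp)
  then show "0 \<le> jgap u w" by (simp add: jgap_def A_B_C_def)
  have "(u - w)\<^sup>2 = (A * B - (1 + u * w)) * (A * B + (1 + u * w))"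
    using prod by (simp add: power2_eq_square algebra_simps)
  also have "\<dots> \<le> (A * B - (1 + u * w)) * (2 * (A * B))"
    using uw by (intro mult_left_mono) auto
  also have "\<dots> = (A * B) * ((A + B)\<^sup>2 - (2 * C)\<^sup>2)" unfolding diff by simp
  also have "\<dots> = (A * B) * ((A + B - 2 * C) * (A + B + 2 * C))"
    by (simp add: power2_eq_square algebra_simps)
  also have "\<dots> \<le> (A * B) * ((A + B - 2 * C) * (2 * (A + B)))"
    using AB CAB by (intro mult_left_mono) auto
  also have "A + B - 2 * C = 2 * jgap u w" unfolding jgap_def A_B_C_def by (simp add: right_diff_distrib)
  also have "A * B * (2 * jgap u w * (2 * (A + B))) = 4 * A * B * (A + B) * jgap u w"
    by (simp add: algebra_simps)
  finally show "(u - w)\<^sup>2 \<le> 4 * jsqrt u * jsqrt w * (jsqrt u + jsqrt w) * jgap u w"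
    by (simp add: A_B_C_def)
qed

text \<open>\<open>K\<close> separates bounded from large arguments, and \<open>\<kappa>\<close> is
  the size of a negligible difference. For bounded arguments the gap controls (u - w)^2, and |d| <=
  \<kappa> + d^2 / \<kappa>; for large ones the p-th powers control |u - w| with the small factor
  K^(1 - p).\<close>

lemma abs_diff_le_jgap:
  assumes p: "1 < p" and "1 \<le> K" "0 < \<kappa>"
  shows "\<bar>u - w\<bar> \<le> \<kappa> + 8 * K ^ 3 / \<kappa> * jgap u w +
    2 * K powr (1 - p) * 2 powr p * (2 + \<bar>u\<bar> powr p + \<bar>w\<bar> powr p)"
    (is "_ \<le> ?a + ?b + ?c")
proof -
  have b0: "0 \<le> ?b" using jgap_nonneg[of u w] assms by simp
  have c0: "0 \<le> ?c" by simp
  define R where "R = max (jsqrt u) (jsqrt w)"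
  have R1: "R \<ge> 1" using jsqrt_ge(1)[of u] by (simp add: R_def)
  show ?thesis
  proof (cases "R \<le> K")
    case True
    \<comment> \<open>All three factors are bounded through \<open>K\<close>: 4 K K (K + K) = 8
      K^3.\<close>
    have le: "4 * jsqrt u * jsqrt w * (jsqrt u + jsqrt w) \<le> 8 * K ^ 3"
    proof -
      have "jsqrt u * jsqrt w * (jsqrt u + jsqrt w) \<le> K * K * (K + K)"
        using True jsqrt_ge(1)[of u] jsqrt_ge(1)[of w]
        by (intro mult_mono add_mono) (auto simp: R_def)
      then show ?thesis by (simp add: power3_eq_cube)
    qed
    have "(u - w)\<^sup>2 \<le> 8 * K ^ 3 * jgap u w"
      using jgap_ge[of u w] mult_right_mono[OF le jgap_nonneg[of u w]] by linarith
    then have "(u - w)\<^sup>2 / \<kappa> \<le> ?b" using assms by (simp add: divide_right_mono)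
    moreover have "\<bar>u - w\<bar> \<le> \<kappa> + (u - w)\<^sup>2 / \<kappa>"
    proof (cases "\<bar>u - w\<bar> \<le> \<kappa>")
      case True then show ?thesis using assms by (simp add: add_increasing2)
    next
      case False
      then have "\<bar>u - w\<bar> * \<kappa> \<le> \<bar>u - w\<bar> * \<bar>u - w\<bar>" by (intro mult_left_mono) auto
      then have "\<bar>u - w\<bar> \<le> (u - w)\<^sup>2 / \<kappa>" using assms by (simp add: pos_le_divide_eq power2_eq_square)
      then show ?thesis using assms by linarith
    qed
    ultimately show ?thesis using c0 by linarith
  next
    case False
    have "\<bar>u - w\<bar> \<le> 2 * R" using jsqrt_ge(2)[of u] jsqrt_ge(2)[of w] unfolding R_def by linarith
    \<comment> \<open>Since p > 1, the factor R^(1 - p) decreases in \<open>R\<close>, and in this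
      case R > K.\<close>
    also have "R = R powr (1 - p) * R powr p" using R1 by (simp flip: powr_add)
    also have "\<dots> \<le> K powr (1 - p) * R powr p"
      using False assms by (intro mult_right_mono powr_mono2') auto
    finally have "\<bar>u - w\<bar> \<le> 2 * (K powr (1 - p) * R powr p)" by simp
    moreover have "R powr p \<le> 2 powr p * (2 + \<bar>u\<bar> powr p + \<bar>w\<bar> powr p)"
    proof -
      have "jsqrt z powr p \<le> 2 powr p * (1 + \<bar>z\<bar> powr p)" for z
      proof -
        have "jsqrt z powr p \<le> (2 * max 1 \<bar>z\<bar>) powr p"
          using jsqrt_ge[of z] p by (intro powr_mono2) auto
        also have "\<dots> = 2 powr p * max 1 \<bar>z\<bar> powr p" by (simp add: powr_mult)
        also have "max 1 \<bar>z\<bar> powr p \<le> 1 + \<bar>z\<bar> powr p" by (auto simp: max_def)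
        finally show ?thesis by simp
      qed
      from this[of u] this[of w] have "R powr p \<le> 2 powr p * (1 + \<bar>u\<bar> powr p) \<or> R powr p \<le> 2 powr p * (1 + \<bar>w\<bar> powr p)"
        unfolding R_def max_def by (auto split: if_splits)
      moreover have "2 powr p * (1 + z) \<le> 2 powr p * (2 + z + z')" "2 powr p * (1 + z') \<le> 2 powr p * (2 + z + z')"
        if "z \<ge> 0" "z' \<ge> 0" for z z' :: real
        using that by auto
      ultimately show ?thesis using powr_ge_zero order_trans by meson
    qed
    then have "2 * (K powr (1 - p) * R powr p) \<le> ?c"
      by (simp add: mult.assoc mult_left_mono)
    ultimately have "\<bar>u - w\<bar> \<le> ?c" by linarith
    moreover have "0 \<le> ?a" using assms by simp
    ultimately show ?thesis using b0 by linarith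
  qed
qed

text \<open>Midpoints already suffice for the compactness argument below, and properties of convex type are
  inherited by rule induction, without any bookkeeping of coefficients.\<close>

inductive_set midhull :: "(nat \<Rightarrow> 'i \<Rightarrow> 'c \<Rightarrow> real) \<Rightarrow> nat \<Rightarrow> ('i \<Rightarrow> 'c \<Rightarrow> real) set"
  for f :: "nat \<Rightarrow> 'i \<Rightarrow> 'c \<Rightarrow> real" and n :: nat where
  base: "n \<le> k \<Longrightarrow> f k \<in> midhull f n"
| mid: "g \<in> midhull f n \<Longrightarrow> h \<in> midhull f n \<Longrightarrow> (\<lambda>i s. (g i s + h i s) / 2) \<in> midhull f n"

lemma midhull_mono: "n \<le> m \<Longrightarrow> midhull f m \<subseteq> midhull f n"
proof
  fix g assume "g \<in> midhull f m" and "n \<le> m"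
  then show "g \<in> midhull f n"
    by (induction) (auto intro: midhull.intros)
qed

text \<open>The p-th power is convex, so a bound shared by all generators passes to midpoints by
  rule induction.\<close>

lemma midhull_Lp:
  assumes p: "1 \<le> p"
    and f: "\<And>k. n \<le> k \<Longrightarrow> f k i \<in> borel_measurable M"
      "\<And>k. n \<le> k \<Longrightarrow> integrable M (\<lambda>s. \<bar>f k i s\<bar> powr p)"
      "\<And>k. n \<le> k \<Longrightarrow> (LINT s|M. \<bar>f k i s\<bar> powr p) \<le> B"
    and g: "g \<in> midhull f n"
  shows "g i \<in> borel_measurable M \<and> integrable M (\<lambda>s. \<bar>g i s\<bar> powr p) \<and> (LINT s|M. \<bar>g i s\<bar> powr p) \<le> B"
  using g
proof induction
  case (base k) then show ?case using f by blast
next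
  case (mid g h)
  then have [measurable]: "g i \<in> borel_measurable M" "h i \<in> borel_measurable M"
    and int: "integrable M (\<lambda>s. \<bar>g i s\<bar> powr p)" "integrable M (\<lambda>s. \<bar>h i s\<bar> powr p)"
    and le: "(LINT s|M. \<bar>g i s\<bar> powr p) \<le> B" "(LINT s|M. \<bar>h i s\<bar> powr p) \<le> B" by auto
  have int': "integrable M (\<lambda>s. (\<bar>g i s\<bar> powr p + \<bar>h i s\<bar> powr p) / 2)" using int by auto
  have *: "\<bar>(g i s + h i s) / 2\<bar> powr p \<le> (\<bar>g i s\<bar> powr p + \<bar>h i s\<bar> powr p) / 2" for s
    using p by (rule abs_midpoint_powr_le)
  have 1: "integrable M (\<lambda>s. \<bar>(g i s + h i s) / 2\<bar> powr p)"
  proof (rule Bochner_Integration.integrable_bound[OF int'])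
    show "AE s in M. norm (\<bar>(g i s + h i s) / 2\<bar> powr p) \<le> norm ((\<bar>g i s\<bar> powr p + \<bar>h i s\<bar> powr p) / 2)"
      using * by (intro AE_I2) simp
  qed measurable
  have "(LINT s|M. \<bar>(g i s + h i s) / 2\<bar> powr p) \<le> (LINT s|M. (\<bar>g i s\<bar> powr p + \<bar>h i s\<bar> powr p) / 2)"
    using 1 int' * by (intro integral_mono) auto
  also have "\<dots> = ((LINT s|M. \<bar>g i s\<bar> powr p) + (LINT s|M. \<bar>h i s\<bar> powr p)) / 2" using int by simp
  also have "\<dots> \<le> B" using le by simp
  finally show ?case using 1 by auto
qed

text \<open>Subsequences are extracted successively, one index at a time; the Cauchy properties
  already obtained survive further extraction.\<close>

lemma AE_Cauchy_common_subseq: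
  fixes g :: "nat \<Rightarrow> 'i \<Rightarrow> 'c \<Rightarrow> real"
  assumes "finite I" and int: "\<And>n i. i \<in> I \<Longrightarrow> integrable M (g n i)"
    and cauchy: "\<And>i e. i \<in> I \<Longrightarrow> e > 0 \<Longrightarrow> \<exists>N. \<forall>m\<ge>N. \<forall>n\<ge>N. (LINT s|M. norm (g m i s - g n i s)) < e"
  shows "\<exists>r. strict_mono r \<and> (\<forall>i\<in>I. AE s in M. Cauchy (\<lambda>n. g (r n) i s))"
  using assms
proof (induction I)
  case empty then show ?case by (intro exI[of _ "\<lambda>n. n"]) (simp add: strict_mono_def)
next
  case (insert i I)
  then obtain r where r: "strict_mono r" "\<And>j. j \<in> I \<Longrightarrow> AE s in M. Cauchy (\<lambda>n. g (r n) j s)" by auto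
  have "\<exists>N. \<forall>m\<ge>N. \<forall>n\<ge>N. (LINT s|M. norm (g (r m) i s - g (r n) i s)) < e" if "e > 0" for e
    using insert.prems(2)[of i e] that seq_suble[OF r(1)] by (meson insertI1 order_trans)
  then obtain q where q: "strict_mono q" "AE s in M. Cauchy (\<lambda>n. g (r (q n)) i s)"
    using cauchy_L1_AE_cauchy_subseq[of M "\<lambda>n. g (r n) i"] insert.prems(1) by blast
  have "AE s in M. Cauchy (\<lambda>n. g (r (q n)) j s)" if "j \<in> I" for j
    using r(2)[OF that]
  proof eventually_elim
    case (elim s)
    from Cauchy_subseq_Cauchy[OF this q(1)] show ?case by (simp add: o_def)
  qed
  with q have "\<forall>j\<in>insert i I. AE s in M. Cauchy (\<lambda>n. g ((r \<circ> q) n) j s)" by auto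
  with strict_mono_o[OF r(1) q(1)] show ?case by blast
qed

text \<open>Near minimisers of the strictly convex functional \<open>\<integral> sqrt (1 + u\<^sup>2)\<close> over the hulls of the tails
  form a Cauchy sequence in \<open>L\<^sup>1\<close>: the convexity gap controls their differences where they are bounded,
  the bound in \<open>L\<^sup>p\<close> elsewhere.\<close>

lemma komlos_Lp:
  fixes f :: "nat \<Rightarrow> 'i \<Rightarrow> 'c \<Rightarrow> real"
  assumes M: "finite_measure M" and I: "finite I" and p: "1 < p"
    and f: "\<And>k i. i \<in> I \<Longrightarrow> f k i \<in> borel_measurable M"
      "\<And>k i. i \<in> I \<Longrightarrow> integrable M (\<lambda>s. \<bar>f k i s\<bar> powr p)"
      "\<And>k i. i \<in> I \<Longrightarrow> (LINT s|M. \<bar>f k i s\<bar> powr p) \<le> B"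
  obtains g \<alpha> where "\<And>n. g n \<in> midhull f n"
    "\<And>i. i \<in> I \<Longrightarrow> AE s in M. (\<lambda>n. g n i s) \<longlonglongrightarrow> \<alpha> i s"
    "\<And>i. i \<in> I \<Longrightarrow> \<alpha> i \<in> borel_measurable M"
    "\<And>i. i \<in> I \<Longrightarrow> integrable M (\<lambda>s. \<bar>\<alpha> i s\<bar> powr p)"
    "\<And>i. i \<in> I \<Longrightarrow> (\<lambda>n. LINT s|M. \<bar>g n i s - \<alpha> i s\<bar>) \<longlonglongrightarrow> 0"
proof -
  interpret finite_measure M by fact
  have hull: "h i \<in> borel_measurable M" "integrable M (\<lambda>s. \<bar>h i s\<bar> powr p)"
    "(LINT s|M. \<bar>h i s\<bar> powr p) \<le> B" if "h \<in> midhull f n" "i \<in> I" for h n i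
    using midhull_Lp[of p n f i M B h] that p f by auto
  have hull_int: "integrable M (h i)" if "h \<in> midhull f n" "i \<in> I" for h n i
  proof (rule Bochner_Integration.integrable_bound)
    show "integrable M (\<lambda>s. 1 + \<bar>h i s\<bar> powr p)" using hull[OF that] by auto
    show "AE s in M. norm (h i s) \<le> norm (1 + \<bar>h i s\<bar> powr p)"
      using abs_le_1_plus_powr[of p] p by (intro AE_I2) auto
  qed (rule hull[OF that])
  have j_int: "integrable M (\<lambda>s. jsqrt (h s))" if "integrable M h" for h
  proof (rule Bochner_Integration.integrable_bound)
    show "integrable M (\<lambda>s. 1 + \<bar>h s\<bar>)" using that by auto
    show "AE s in M. norm (jsqrt (h s)) \<le> norm (1 + \<bar>h s\<bar>)"
    proof (rule AE_I2)
      fix s show "norm (jsqrt (h s)) \<le> norm (1 + \<bar>h s\<bar>)"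
        using jsqrt_ge(1)[of "h s"] jsqrt_ge(3)[of "h s"] by simp
    qed
    show "(\<lambda>s. jsqrt (h s)) \<in> borel_measurable M" using that unfolding jsqrt_def by measurable
  qed
  \<comment> \<open>The hulls shrink with \<open>n\<close>, so the infima \<open>V n\<close>
    increase; they stay below \<open>C\<close> and hence converge. Summing over \<open>I\<close>
    lets one sequence of combinations serve all indices at once.\<close>
  define \<Psi> where "\<Psi> h = (\<Sum>i\<in>I. LINT s|M. jsqrt (h i s))" for h
  define V where "V n = Inf (\<Psi> ` midhull f n)" for n
  have \<Psi>0: "0 \<le> \<Psi> h" for h
    unfolding \<Psi>_def by (intro sum_nonneg integral_nonneg_AE AE_I2) (meson jsqrt_ge(1) order_trans zero_le_one)
  have bdd: "bdd_below (\<Psi> ` midhull f n)" for n by (rule bdd_belowI[of _ 0]) (auto simp: \<Psi>0)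
  have ne: "\<Psi> ` midhull f n \<noteq> {}" for n using midhull.base[of n n f] by blast
  have V_le: "V n \<le> \<Psi> h" if "h \<in> midhull f n" for n h
    unfolding V_def using that bdd by (intro cInf_lower) auto
  \<comment> \<open>The constant comes from jsqrt u <= 1 + |u| <= 2 + |u|^p.\<close>
  define C where "C = (\<Sum>i\<in>I. (LINT s|M. 2) + B)"
  have \<Psi>C: "\<Psi> h \<le> C" if "h \<in> midhull f n" for h n
    unfolding \<Psi>_def C_def
  proof (rule sum_mono)
    fix i assume i: "i \<in> I"
    have "(LINT s|M. jsqrt (h i s)) \<le> (LINT s|M. 2 + \<bar>h i s\<bar> powr p)"
    proof (rule integral_mono)
      show "jsqrt (h i s) \<le> 2 + \<bar>h i s\<bar> powr p" for s
        using jsqrt_ge(3)[of "h i s"] abs_le_1_plus_powr[of p "h i s"] p by linarith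
    qed (use j_int hull_int hull that i in auto)
    also have "\<dots> = (LINT s|M. 2) + (LINT s|M. \<bar>h i s\<bar> powr p)"
      using hull[OF that i] by (intro Bochner_Integration.integral_add) auto
    finally show "(LINT s|M. jsqrt (h i s)) \<le> (LINT s|M. 2) + B" using hull[OF that i] by linarith
  qed
  have V_mono: "V n \<le> V m" if "n \<le> m" for n m
    unfolding V_def by (intro cInf_superset_mono ne bdd image_mono midhull_mono that)
  have V_C: "V n \<le> C" for n using V_le \<Psi>C midhull.base[of n n f] by (meson order_refl order_trans)
  have "norm (V n) \<le> \<bar>C\<bar> + \<bar>V 0\<bar>" for n
    using V_C[of n] V_mono[of 0 n] unfolding real_norm_def by linarith
  then have "convergent V"
    by (intro Bseq_monoseq_convergent BseqI') (auto simp: monoseq_def V_mono)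
  then have V_Cauchy: "Cauchy V" by (rule convergent_Cauchy)
  have "\<exists>h\<in>midhull f n. \<Psi> h < V n + 1 / real (Suc n)" for n
    using cInf_lessD[OF ne, of n "V n + 1 / real (Suc n)"] unfolding V_def by auto
  then obtain g where g: "\<And>n. g n \<in> midhull f n" "\<And>n. \<Psi> (g n) < V n + 1 / real (Suc n)" by metis
  have g_int: "integrable M (g n i)" if "i \<in> I" for n i using hull_int g(1) that by blast
  have gap_int: "integrable M (\<lambda>s. jgap (g n i s) (g m i s))" if "i \<in> I" for n m i
  proof -
    have "integrable M (\<lambda>s. (g n i s + g m i s) / 2)" using g_int[OF that] by auto
    then show ?thesis unfolding jgap_def using g_int[OF that] j_int by auto
  qed
  \<comment> \<open>For n <= m both \<open>g n\<close> and \<open>g m\<close> lie in the hull of the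
    tail from \<open>n\<close>, hence so does their midpoint, where the functional is at least
    \<open>V n\<close>. All gaps are nonnegative, so each is at most their sum, which is the mean of
    two nearly minimal values minus the value at the midpoint.\<close>
  have gap_small: "(LINT s|M. jgap (g n i s) (g m i s)) \<le> (V m - V n) / 2 + 1 / real (Suc n)"
    if "n \<le> m" "i \<in> I" for n m i
  proof -
    let ?h = "\<lambda>i s. (g n i s + g m i s) / 2"
    have gm: "g m \<in> midhull f n" using g(1)[of m] midhull_mono[OF \<open>n \<le> m\<close>] by blast
    have hm: "?h \<in> midhull f n" by (rule midhull.mid[OF g(1) gm])
    have eq: "(LINT s|M. jgap (g n j s) (g m j s)) =
        ((LINT s|M. jsqrt (g n j s)) + (LINT s|M. jsqrt (g m j s))) / 2 - (LINT s|M. jsqrt (?h j s))"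
      if "j \<in> I" for j
      unfolding jgap_def using j_int g_int hull_int[OF hm] that by simp
    have "(LINT s|M. jgap (g n i s) (g m i s)) \<le> (\<Sum>j\<in>I. LINT s|M. jgap (g n j s) (g m j s))"
      using I that jgap_nonneg by (intro member_le_sum) (auto intro!: integral_nonneg_AE)
    also have "\<dots> = (\<Psi> (g n) + \<Psi> (g m)) / 2 - \<Psi> ?h"
      unfolding \<Psi>_def by (simp add: eq sum_subtractf sum.distrib flip: sum_divide_distrib)
    also have "\<dots> \<le> (V n + 1 / real (Suc n) + (V m + 1 / real (Suc n))) / 2 - V n"
    proof -
      have "1 / real (Suc m) \<le> 1 / real (Suc n)" using \<open>n \<le> m\<close> by (simp add: frac_le)
      then show ?thesis using g(2)[of n] g(2)[of m] V_le[OF hm] by argo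
    qed
    finally show ?thesis by argo
  qed
  define m0 where "m0 = measure M (space M)"
  have m0: "0 \<le> m0" by (simp add: m0_def)
  have cauchy: "\<exists>N. \<forall>m\<ge>N. \<forall>n\<ge>N. (LINT s|M. norm (g m i s - g n i s)) < e" if i: "i \<in> I" and e: "e > 0" for i e
  proof -
    have "0 \<le> (LINT s|M. \<bar>f 0 i s\<bar> powr p)" by (intro integral_nonneg_AE AE_I2) simp
    then have B0: "0 \<le> B" using f(3)[OF i, of 0] by linarith
    \<comment> \<open>\<open>D\<close> collects the factors of K^(1 - p) after integration, with
      both integrals of p-th powers replaced by \<open>B\<close>.\<close>
    define D where "D = 2 * 2 powr p * (2 * m0 + 2 * B)"
    have D0: "0 \<le> D" using m0 B0 by (simp add: D_def)
    obtain K where K: "K \<ge> 1" "K powr (1 - p) * D < e / 4"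
    proof -
      have "((\<lambda>K. K powr (1 - p) * D) \<longlongrightarrow> 0 * D) at_top"
        using p by (intro tendsto_intros tendsto_neg_powr filterlim_ident) auto
      then have "\<forall>\<^sub>F K in at_top. K powr (1 - p) * D < e / 4"
        using e by (intro order_tendstoD(2)) auto
      moreover have "\<forall>\<^sub>F K in at_top. (1::real) \<le> K" by (rule eventually_ge_at_top)
      ultimately have "\<exists>K. 1 \<le> K \<and> K powr (1 - p) * D < e / 4"
        using eventually_happens[OF eventually_conj] by fastforce
      then show ?thesis using that by blast
    qed
    \<comment> \<open>Error budget: at most e/4 from \<open>\<kappa>\<close>, at most e/4 + e/8 from
      the gap through \<open>N1\<close> and \<open>N2\<close>, and less than e/4 from the large
      values.\<close>
    define \<kappa> where "\<kappa> = e / (4 * (m0 + 1))"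
    have \<kappa>: "\<kappa> > 0" "\<kappa> * m0 \<le> e / 4"
      using e m0 by (auto simp: \<kappa>_def field_simps)
    define Q where "Q = 8 * K ^ 3 / \<kappa>"
    have Q0: "Q > 0" using K \<kappa> by (simp add: Q_def)
    obtain N1 where N1: "\<And>n m. n \<ge> N1 \<Longrightarrow> m \<ge> N1 \<Longrightarrow> \<bar>V m - V n\<bar> < e / (4 * Q)"
      using V_Cauchy[unfolded Cauchy_iff] e Q0
      by (metis divide_pos_pos mult_pos_pos real_norm_def zero_less_numeral)
    obtain N2 where N2: "1 / real (Suc N2) < e / (8 * Q)"
      using nat_approx_posE[of "e / (8 * Q)"] e Q0 by auto
    define N where "N = max N1 N2"
    have main: "(LINT s|M. \<bar>g n i s - g m i s\<bar>) < e" if nm: "N \<le> n" "n \<le> m" for n m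
    proof -
      let ?r = "\<lambda>s. \<kappa> + Q * jgap (g n i s) (g m i s) + 2 * K powr (1 - p) * 2 powr p * (2 + \<bar>g n i s\<bar> powr p + \<bar>g m i s\<bar> powr p)"
      note pn = hull[OF g(1)[of n] i] and pm = hull[OF g(1)[of m] i]
      have "(LINT s|M. \<bar>g n i s - g m i s\<bar>) \<le> (LINT s|M. ?r s)"
      proof (rule integral_mono)
        show "\<bar>g n i s - g m i s\<bar> \<le> ?r s" for s
          unfolding Q_def using abs_diff_le_jgap[OF p K(1) \<kappa>(1)] .
      qed (use g_int[OF i] gap_int[OF i] pn pm in auto)
      also have "\<dots> = \<kappa> * m0 + Q * (LINT s|M. jgap (g n i s) (g m i s)) + 2 * K powr (1 - p) * 2 powr p *
          (2 * m0 + (LINT s|M. \<bar>g n i s\<bar> powr p) + (LINT s|M. \<bar>g m i s\<bar> powr p))"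
        using gap_int[OF i] pn pm by (simp add: m0_def mult.commute)
      also have "\<dots> \<le> e / 4 + Q * (LINT s|M. jgap (g n i s) (g m i s)) + 2 * K powr (1 - p) * 2 powr p * (2 * m0 + B + B)"
        using pn(3) pm(3) \<kappa>(2) Q0 by (intro add_mono mult_left_mono) auto
      also have "2 * K powr (1 - p) * 2 powr p * (2 * m0 + B + B) = K powr (1 - p) * D"
        by (simp add: D_def)
      also have "Q * (LINT s|M. jgap (g n i s) (g m i s)) \<le> Q * ((V m - V n) / 2 + 1 / real (Suc n))"
        using Q0 by (intro mult_left_mono gap_small[OF nm(2) i]) auto
      also have "\<dots> \<le> Q * (e / (4 * Q) + e / (8 * Q))"
      proof (intro mult_left_mono add_mono)
        have "\<bar>V m - V n\<bar> < e / (4 * Q)" using nm by (intro N1) (auto simp: N_def)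
        moreover have "z / 2 \<le> z'" if "\<bar>z\<bar> < z'" for z z' :: real using that by linarith
        ultimately show "(V m - V n) / 2 \<le> e / (4 * Q)" by blast
        have "1 / real (Suc n) \<le> 1 / real (Suc N2)" using nm by (simp add: N_def frac_le)
        then show "1 / real (Suc n) \<le> e / (8 * Q)" using N2 by linarith
      qed (use Q0 in auto)
      also have "\<dots> = e / 4 + e / 8" using Q0 by (simp add: field_simps)
      finally show ?thesis using K(2) e by linarith
    qed
    have "(LINT s|M. norm (g m i s - g n i s)) < e" if "m \<ge> N" "n \<ge> N" for m n
      using main[of m n] main[of n m] that by (cases "m \<le> n") (auto simp: abs_minus_commute)
    then show ?thesis by blast
  qed
  have "\<exists>r. strict_mono r \<and> (\<forall>i\<in>I. AE s in M. Cauchy (\<lambda>n. g (r n) i s))"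
    by (rule AE_Cauchy_common_subseq[OF I]) (fact g_int cauchy)+
  then obtain r where r: "strict_mono r" "\<And>i. i \<in> I \<Longrightarrow> AE s in M. Cauchy (\<lambda>n. g (r n) i s)"
    by blast
  \<comment> \<open>\<open>lim\<close> yields a total function that is measurable as it stands; it
    is the genuine limit at almost every point.\<close>
  define \<alpha> where "\<alpha> i s = lim (\<lambda>n. g (r n) i s)" for i s
  have lim: "AE s in M. (\<lambda>n. g (r n) i s) \<longlonglongrightarrow> \<alpha> i s" if "i \<in> I" for i
    using r(2)[OF that]
    by eventually_elim (simp add: \<alpha>_def Cauchy_convergent_iff convergent_LIMSEQ_iff)
  have meas: "\<alpha> i \<in> borel_measurable M" if "i \<in> I" for i
    unfolding \<alpha>_def[abs_def] using g_int[OF that] by (intro borel_measurable_lim_metric) auto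
  \<comment> \<open>Since r n >= n, the n-th member of the subsequence still combines only functions
    of index at least n.\<close>
  have hullr: "g (r n) \<in> midhull f n" for n
    using g(1)[of "r n"] midhull_mono[OF seq_suble[OF r(1)]] by blast
  show ?thesis
  proof (rule that[of "\<lambda>n. g (r n)" \<alpha>])
    show "g (r n) \<in> midhull f n" for n by (rule hullr)
    fix i assume i: "i \<in> I"
    show "AE s in M. (\<lambda>n. g (r n) i s) \<longlonglongrightarrow> \<alpha> i s" by (rule lim[OF i])
    show "\<alpha> i \<in> borel_measurable M" by (rule meas[OF i])
    note [measurable] = meas[OF i]
    show "integrable M (\<lambda>s. \<bar>\<alpha> i s\<bar> powr p)"
    proof (rule integral_le_of_AE_tendsto(1)[of M "\<lambda>n s. \<bar>g (r n) i s\<bar> powr p"])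
      show "AE s in M. (\<lambda>n. \<bar>g (r n) i s\<bar> powr p) \<longlonglongrightarrow> \<bar>\<alpha> i s\<bar> powr p"
        using lim[OF i] by eventually_elim (use p in \<open>intro tendsto_powr' tendsto_intros, auto\<close>)
    qed (use hull[OF hullr i] in auto)
    show "(\<lambda>n. LINT s|M. \<bar>g (r n) i s - \<alpha> i s\<bar>) \<longlonglongrightarrow> 0"
    proof (rule metric_LIMSEQ_I)
      fix e :: real assume e: "e > 0"
      then obtain N where N: "\<And>m n. m \<ge> N \<Longrightarrow> n \<ge> N \<Longrightarrow> (LINT s|M. norm (g m i s - g n i s)) < e / 2"
        using cauchy[OF i, of "e / 2"] by auto
      have "dist (LINT s|M. \<bar>g (r n) i s - \<alpha> i s\<bar>) 0 < e" if n: "n \<ge> N" for n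
      proof -
        have "(LINT s|M. \<bar>g (r n) i s - \<alpha> i s\<bar>) \<le> e / 2"
        \<comment> \<open>Fatou's lemma in one of the two indices of the Cauchy estimate turns it
          into convergence to \<open>\<alpha>\<close> in L^1.\<close>
        proof (rule integral_le_of_AE_tendsto(2)[of M "\<lambda>k s. \<bar>g (r n) i s - g (r (N + k)) i s\<bar>"])
          show "AE s in M. (\<lambda>k. \<bar>g (r n) i s - g (r (N + k)) i s\<bar>) \<longlonglongrightarrow> \<bar>g (r n) i s - \<alpha> i s\<bar>"
            using lim[OF i]
          proof eventually_elim
            case (elim s)
            from LIMSEQ_ignore_initial_segment[OF this, of N] show ?case
              by (intro tendsto_intros) (simp add: add.commute)
          qed
          show "(LINT s|M. \<bar>g (r n) i s - g (r (N + k)) i s\<bar>) \<le> e / 2" for k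
          proof -
            have "N \<le> r n" "N \<le> r (N + k)"
              using seq_suble[OF r(1), of n] seq_suble[OF r(1), of "N + k"] n by auto
            then show ?thesis using N[of "r n" "r (N + k)"] by simp
          qed
        qed (use g_int[OF i] in auto)
        moreover have "0 \<le> (LINT s|M. \<bar>g (r n) i s - \<alpha> i s\<bar>)" by (intro integral_nonneg_AE) auto
        ultimately show ?thesis using e by (simp add: dist_real_def)
      qed
      then show "\<exists>no. \<forall>n\<ge>no. dist (LINT s|M. \<bar>g (r n) i s - \<alpha> i s\<bar>) 0 < e" by blast
    qed
  qed
qed

text \<open>Linear functionals that converge along the original sequence have the same limit along
  convex combinations of its tails, and L^1 convergence against bounded weights identifies it. This
  takes the place of weak compactness in L^p. The sum over \<open>J\<close> stays together because
  only the combination, not each summand, is assumed to converge.\<close>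

lemma weak_limit_midhull:
  fixes f g :: "nat \<Rightarrow> 'i \<Rightarrow> 'c \<Rightarrow> real"
  assumes J: "finite J"
    and c: "\<And>i. i \<in> J \<Longrightarrow> c i \<in> borel_measurable M" "\<And>i s. i \<in> J \<Longrightarrow> s \<in> space M \<Longrightarrow> \<bar>c i s\<bar> \<le> C"
    and f: "\<And>k i. i \<in> J \<Longrightarrow> integrable M (f k i)"
    and g: "\<And>n. g n \<in> midhull f n"
    and \<alpha>: "\<And>i. i \<in> J \<Longrightarrow> integrable M (\<alpha> i)"
    and L1: "\<And>i. i \<in> J \<Longrightarrow> (\<lambda>n. LINT s|M. \<bar>g n i s - \<alpha> i s\<bar>) \<longlonglongrightarrow> 0"
    and lim: "(\<lambda>n. \<Sum>i\<in>J. LINT s|M. c i s * f n i s) \<longlonglongrightarrow> q"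
  shows "(\<Sum>i\<in>J. LINT s|M. c i s * \<alpha> i s) = q"
proof -
  have hull_int: "integrable M (h i)" if "h \<in> midhull f n" "i \<in> J" for h n i
    using that by induction (auto intro: f)
  have cint: "integrable M (\<lambda>s. c i s * h s)" if "i \<in> J" "integrable M h" for i h
  proof (rule Bochner_Integration.integrable_bound)
    show "integrable M (\<lambda>s. C * \<bar>h s\<bar>)" using that by auto
    show "(\<lambda>s. c i s * h s) \<in> borel_measurable M" using that c(1) by measurable
    show "AE s in M. norm (c i s * h s) \<le> norm (C * \<bar>h s\<bar>)"
    proof (rule AE_I2)
      fix s assume "s \<in> space M"
      then have "\<bar>c i s\<bar> * \<bar>h s\<bar> \<le> C * \<bar>h s\<bar>" using c(2)[OF that(1)] by (intro mult_right_mono) auto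
      then have "\<bar>c i s * h s\<bar> \<le> \<bar>C * \<bar>h s\<bar>\<bar>"
        unfolding abs_mult[of "c i s"] by (rule order_trans[OF _ abs_ge_self])
      then show "norm (c i s * h s) \<le> norm (C * \<bar>h s\<bar>)" by (simp only: real_norm_def)
    qed
  qed
  define S where "S h = (\<Sum>i\<in>J. LINT s|M. c i s * h i s)" for h
  \<comment> \<open>A closed interval around \<open>q\<close> is convex, so membership passes to
    midpoints.\<close>
  have near: "\<bar>S h - q\<bar> \<le> e" if "h \<in> midhull f n" "\<And>k. n \<le> k \<Longrightarrow> \<bar>S (f k) - q\<bar> \<le> e" for h n e
    using that(1)
  proof induction
    case (base k) then show ?case by (rule that(2))
  next
    case (mid g h)
    have "S (\<lambda>i s. (g i s + h i s) / 2) = (\<Sum>i\<in>J. ((LINT s|M. c i s * g i s) + (LINT s|M. c i s * h i s)) / 2)"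
      unfolding S_def
    proof (rule sum.cong)
      fix i assume i: "i \<in> J"
      show "(LINT s|M. c i s * ((g i s + h i s) / 2)) = ((LINT s|M. c i s * g i s) + (LINT s|M. c i s * h i s)) / 2"
        using cint[OF i hull_int[OF mid(1) i]] cint[OF i hull_int[OF mid(2) i]]
        by (simp add: distrib_left)
    qed simp
    also have "\<dots> = (S g + S h) / 2" unfolding S_def by (simp add: sum.distrib flip: sum_divide_distrib)
    finally have "S (\<lambda>i s. (g i s + h i s) / 2) = (S g + S h) / 2" .
    then show ?case using mid(3,4) by (simp add: abs_le_iff field_simps)
  qed
  have "(\<lambda>n. S (g n)) \<longlonglongrightarrow> q"
  proof (rule LIMSEQ_I)
    fix e :: real assume "e > 0"
    then obtain N where N: "\<And>k. k \<ge> N \<Longrightarrow> \<bar>S (f k) - q\<bar> < e / 2"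
      using LIMSEQ_D[OF lim, of "e / 2"] unfolding S_def by auto
    have "norm (S (g n) - q) < e" if "n \<ge> N" for n
      using near[OF g[of n], of "e / 2"] N that \<open>e > 0\<close> by (force intro: less_imp_le)
    then show "\<exists>no. \<forall>n\<ge>no. norm (S (g n) - q) < e" by blast
  qed
  moreover have "(\<lambda>n. S (g n)) \<longlonglongrightarrow> S \<alpha>"
    unfolding S_def
  proof (rule tendsto_sum)
    fix i assume i: "i \<in> J"
    have bnd: "\<bar>(LINT s|M. c i s * g n i s) - (LINT s|M. c i s * \<alpha> i s)\<bar> \<le> C * (LINT s|M. \<bar>g n i s - \<alpha> i s\<bar>)" for n
    proof -
      have gi: "integrable M (g n i)" by (rule hull_int[OF g i])
      have d: "integrable M (\<lambda>s. g n i s - \<alpha> i s)" using gi \<alpha>[OF i] by simp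
      have "(LINT s|M. c i s * g n i s) - (LINT s|M. c i s * \<alpha> i s) = (LINT s|M. c i s * (g n i s - \<alpha> i s))"
        using cint[OF i gi] cint[OF i \<alpha>[OF i]] by (simp add: right_diff_distrib)
      also have "\<bar>\<dots>\<bar> \<le> (LINT s|M. C * \<bar>g n i s - \<alpha> i s\<bar>)"
      proof (rule order_trans[OF integral_abs_bound integral_mono])
        show "integrable M (\<lambda>s. \<bar>c i s * (g n i s - \<alpha> i s)\<bar>)" using cint[OF i d] by simp
        show "integrable M (\<lambda>s. C * \<bar>g n i s - \<alpha> i s\<bar>)" using d by simp
        fix s assume "s \<in> space M"
        then show "\<bar>c i s * (g n i s - \<alpha> i s)\<bar> \<le> C * \<bar>g n i s - \<alpha> i s\<bar>"
          using c(2)[OF i] by (simp add: abs_mult mult_right_mono)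
      qed
      finally show ?thesis by simp
    qed
    have null: "(\<lambda>n. C * (LINT s|M. \<bar>g n i s - \<alpha> i s\<bar>)) \<longlonglongrightarrow> 0"
      using tendsto_mult_right_zero[OF L1[OF i]] .
    have "(\<lambda>n. (LINT s|M. c i s * g n i s) - (LINT s|M. c i s * \<alpha> i s)) \<longlonglongrightarrow> 0"
    proof (rule Lim_null_comparison[OF _ null])
      show "\<forall>\<^sub>F n in sequentially. norm ((LINT s|M. c i s * g n i s) - (LINT s|M. c i s * \<alpha> i s)) \<le> C * (LINT s|M. \<bar>g n i s - \<alpha> i s\<bar>)"
        using bnd by (intro always_eventually allI) (simp only: real_norm_def)
    qed
    then show "(\<lambda>n. LINT s|M. c i s * g n i s) \<longlonglongrightarrow> (LINT s|M. c i s * \<alpha> i s)"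
      by (simp add: LIM_zero_iff)
  qed
  ultimately show ?thesis unfolding S_def using LIMSEQ_unique by blast
qed

section \<open>Functions on a network\<close>

definition edge_base :: "'a::euclidean_space network \<Rightarrow> nat \<Rightarrow> 'a" where
  "edge_base G i = (case edge G i of Segment j k \<Rightarrow> vertex G j | Half_line j e \<Rightarrow> vertex G j)"

text \<open>The parameter of the orthogonal projection onto the line that carries the edge.
  \<open>edge_coord\<close> is an inverse function with a meaning on the edge only; this one is
  affine on the whole space and agrees with it on the edge.\<close>

definition axis_coord :: "'a::euclidean_space network \<Rightarrow> nat \<Rightarrow> 'a \<Rightarrow> real" where
  "axis_coord G i y = (y - edge_base G i) \<bullet> edge_dir G i"

lemma continuous_axis_coord [continuous_intros]:
  "continuous_on S f \<Longrightarrow> continuous_on S (\<lambda>s. axis_coord G i (f s))"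
  unfolding axis_coord_def by (intro continuous_intros)

abbreviation edge_interior :: "'a::euclidean_space network \<Rightarrow> nat \<Rightarrow> 'a set" where
  "edge_interior G i \<equiv> edge_set G i - vertices G"

text \<open>The witness is the product of the factors z - c, built one factor at a time. At a new
  zero the derivative is the old product, at an old zero the old derivative times a nonzero
  factor.\<close>

lemma simple_zeros_exist:
  assumes "finite (C :: real set)"
  shows "\<exists>P P'. (\<forall>z. (P has_real_derivative P' z) (at z)) \<and> continuous_on UNIV P' \<and>
    (\<forall>z. P z = 0 \<longleftrightarrow> z \<in> C) \<and> (\<forall>z\<in>C. P' z \<noteq> 0)"
  using assms
proof induction
  case empty
  show ?case by (rule exI[of _ "\<lambda>_. 1"], rule exI[of _ "\<lambda>_. 0"]) simp
next
  case (insert c C)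
  then obtain P P' where P: "\<And>z. (P has_real_derivative P' z) (at z)" "continuous_on UNIV P'"
    "\<And>z. P z = 0 \<longleftrightarrow> z \<in> C" "\<And>z. z \<in> C \<Longrightarrow> P' z \<noteq> 0" by blast
  have contP: "continuous_on UNIV P" using P(1) by (meson DERIV_isCont continuous_at_imp_continuous_on)
  show ?case
  proof (intro exI conjI allI ballI)
    show "((\<lambda>z. P z * (z - c)) has_real_derivative (P' z * (z - c) + P z)) (at z)" for z
      by (auto intro!: derivative_eq_intros P(1))
    show "continuous_on UNIV (\<lambda>z. P' z * (z - c) + P z)"
      using P(2) contP by (intro continuous_intros)
    show "P z * (z - c) = 0 \<longleftrightarrow> z \<in> insert c C" for z using P(3) by auto
    show "P' z * (z - c) + P z \<noteq> 0" if "z \<in> insert c C" for z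
      using that P(3,4) insert(2) by (metis add_cancel_right_left add.right_neutral eq_iff_diff_eq_0 insertE mult_eq_0_iff mult_zero_right)
  qed
qed

section \<open>Geometry of the network\<close>

locale finite_network =
  fixes G :: "'a::euclidean_space network"
  assumes network: "is_network G"
begin

lemma segment_length_pos:
  assumes "i \<in> eidx G" "edge G i = Segment j k"
  shows "norm (vertex G k - vertex G j) > 0"
proof -
  have "inj_on (vertex G) (vidx G)" "j \<in> vidx G" "k \<in> vidx G" "j < k"
    using network assms unfolding is_network_def by (auto dest!: bspec[of _ _ i])
  then have "vertex G j \<noteq> vertex G k" by (metis inj_onD less_irrefl)
  then show ?thesis by simp
qed

lemma norm_edge_dir: assumes "i \<in> eidx G" shows "norm (edge_dir G i) = 1"
proof (cases "edge G i")
  case (Segment j k)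
  then show ?thesis using segment_length_pos[OF assms Segment] by (simp add: edge_dir_def)
next
  case (Half_line j e)
  then show ?thesis using network assms unfolding is_network_def
    by (auto dest!: bspec[of _ _ i] simp: edge_dir_def)
qed

lemma edge_param_eq:
  assumes "i \<in> eidx G"
  shows "edge_param G i s = edge_base G i + s *\<^sub>R edge_dir G i"
proof (cases "edge G i")
  case (Segment j k)
  define l where "l = norm (vertex G k - vertex G j)"
  have l: "l > 0" using segment_length_pos[OF assms Segment] by (simp add: l_def)
  have "((l - s) *\<^sub>R vertex G j + s *\<^sub>R vertex G k) = l *\<^sub>R vertex G j + s *\<^sub>R (vertex G k - vertex G j)"
    by (simp add: algebra_simps)
  then have "edge_param G i s = (l *\<^sub>R vertex G j + s *\<^sub>R (vertex G k - vertex G j)) /\<^sub>R l"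
    by (simp only: edge_param_def Segment Let_def edge.case flip: l_def)
  then show ?thesis using l Segment
    by (simp add: edge_base_def edge_dir_def scaleR_add_right mult.commute flip: l_def)
qed (simp add: edge_param_def edge_base_def edge_dir_def)

lemma edge_dom_cases:
  assumes "i \<in> eidx G"
  obtains l where "l > 0" "edge_dom G i = {0..l}" | "edge_dom G i = {0..}"
proof (cases "edge G i")
  case (Segment j k)
  then have "edge_dom G i = {0..norm (vertex G k - vertex G j)}"
    by (auto simp: edge_dom_def edge_length_def)
  then show ?thesis using segment_length_pos[OF assms Segment] that(1) by blast
next
  case (Half_line j e)
  then show ?thesis using that(2) by (auto simp: edge_dom_def edge_length_def)
qed

lemma edge_dom_facts:
  assumes "i \<in> eidx G"
  shows "closed (edge_dom G i)" "convex (edge_dom G i)" "0 \<in> edge_dom G i" "edge_dom G i \<subseteq> {0..}"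
  by (rule edge_dom_cases[OF assms]; simp)+

text \<open>Turns an image into a condition on the affine coordinate, from which closedness of the
  edge and injectivity of the coordinate on it can be read off.\<close>

lemma edge_set_iff:
  assumes "i \<in> eidx G"
  shows "y \<in> edge_set G i \<longleftrightarrow> axis_coord G i y \<in> edge_dom G i \<and>
    y = edge_base G i + axis_coord G i y *\<^sub>R edge_dir G i"
proof -
  have "axis_coord G i (edge_base G i + s *\<^sub>R edge_dir G i) = s" for s
    using norm_edge_dir[OF assms] by (simp add: axis_coord_def dot_square_norm)
  then show ?thesis
    unfolding edge_set_def edge_param_eq[OF assms] image_iff by metis
qed

lemma edge_coord_eq:
  assumes "i \<in> eidx G" "y \<in> edge_set G i"
  shows "edge_coord G i y = axis_coord G i y"
proof -
  have eq: "axis_coord G i (edge_param G i s) = s" for s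
    using norm_edge_dir[OF assms(1)] by (simp add: edge_param_eq[OF assms(1)] axis_coord_def dot_square_norm)
  have "edge_param G i (edge_coord G i y) = y"
    using assms(2) unfolding edge_coord_def edge_set_def by (rule f_inv_into_f)
  then show ?thesis using eq by metis
qed

lemma closed_edge_set:
  assumes "i \<in> eidx G" shows "closed (edge_set G i)"
proof -
  have "edge_set G i = (axis_coord G i -` edge_dom G i) \<inter>
      {y. y = edge_base G i + axis_coord G i y *\<^sub>R edge_dir G i}"
    using edge_set_iff[OF assms] by auto
  moreover have "closed (axis_coord G i -` edge_dom G i)"
    by (intro closed_vimage edge_dom_facts assms continuous_axis_coord continuous_on_id)
  moreover have "closed {y. y = edge_base G i + axis_coord G i y *\<^sub>R edge_dir G i}"
    by (intro closed_Collect_eq continuous_intros)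
  ultimately show ?thesis by (metis closed_Int)
qed

lemma finite_vertices: "finite (vertices G)"
  by (simp add: vertices_def)

lemma closed_network_set: "closed (network_set G)"
proof -
  have "\<forall>i\<in>eidx G. closed (edge_set G i)" using closed_edge_set by blast
  then have "closed (\<Union>i\<in>eidx G. edge_set G i)" by (intro closed_UN) simp_all
  then show ?thesis unfolding network_set_def
    by (rule closed_Un[OF finite_imp_closed[OF finite_vertices]])
qed

lemma abs_axis_coord_diff_le:
  assumes "i \<in> eidx G" shows "\<bar>axis_coord G i y - axis_coord G i z\<bar> \<le> norm (y - z)"
proof -
  have "axis_coord G i y - axis_coord G i z = (y - z) \<bullet> edge_dir G i"
    by (simp add: axis_coord_def inner_diff_left)
  then show ?thesis using Cauchy_Schwarz_ineq2[of "y - z" "edge_dir G i"] norm_edge_dir[OF assms] by simp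
qed

lemma edge_interior_unique:
  assumes "i \<in> eidx G" "k \<in> eidx G" "x \<in> edge_interior G i" "x \<in> edge_set G k"
  shows "k = i"
proof (rule ccontr)
  assume "k \<noteq> i"
  then have "edge_set G i \<inter> edge_set G k = {} \<or> (\<exists>v\<in>vertices G. edge_set G i \<inter> edge_set G k = {v})"
    using network[unfolded is_network_def, THEN conjunct2, THEN conjunct2, THEN conjunct2, THEN conjunct1,
        THEN bspec, OF assms(1), THEN bspec, OF assms(2)] by simp
  then show False using assms(3,4) by (metis DiffE IntI empty_iff singletonD)
qed

lemma network_set_cases:
  assumes "x \<in> network_set G"
  obtains "x \<in> vertices G" | i where "i \<in> eidx G" "x \<in> edge_interior G i"
  using assms unfolding network_set_def by blast

text \<open>The closed cells of the network are its vertices and its edges; every point has a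
  neighbourhood in which only cells through that point are met.\<close>

definition star :: "'a \<Rightarrow> 'a \<Rightarrow> bool" where
  "star x x' \<longleftrightarrow> (\<forall>i\<in>eidx G. x' \<in> edge_set G i \<longrightarrow> x \<in> edge_set G i) \<and> (x' \<in> vertices G \<longrightarrow> x = x')"

text \<open>There are finitely many cells, all closed, so the union of those that miss
  \<open>x\<close> is closed.\<close>

lemma eventually_star: "\<exists>d>0. \<forall>x'. dist x' x < d \<longrightarrow> star x x'"
proof -
  define \<C> where "\<C> = {C \<in> edge_set G ` eidx G \<union> (\<lambda>v. {v}) ` vertices G. x \<notin> C}"
  have "closed (\<Union>\<C>)"
    unfolding \<C>_def using finite_vertices
    by (intro closed_Union) (auto intro: closed_edge_set)
  moreover have "x \<in> - \<Union>\<C>" by (auto simp: \<C>_def)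
  ultimately obtain d where "d > 0" and d: "ball x d \<subseteq> - \<Union>\<C>"
    using open_contains_ball[of "- \<Union>\<C>"] by blast
  have "star x x'" if "dist x' x < d" for x'
  proof -
    have "x' \<notin> \<Union>\<C>" using d that by (auto simp: dist_commute)
    then have *: "x \<in> C" if "x' \<in> C" "C \<in> edge_set G ` eidx G \<union> (\<lambda>v. {v}) ` vertices G" for C
      using that unfolding \<C>_def by blast
    show ?thesis unfolding star_def
    proof (intro conjI ballI impI)
      show "x \<in> edge_set G i" if "i \<in> eidx G" "x' \<in> edge_set G i" for i
        using that by (intro *) auto
      show "x = x'" if "x' \<in> vertices G"
        using *[of "{x'}"] that by blast
    qed
  qed
  with \<open>d > 0\<close> show ?thesis by blast
qed

text \<open>Near an interior point of an edge the network is that edge: a vertex \<open>x'\<close>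
  would equal \<open>x\<close>, and another edge through \<open>x'\<close> would contain
  \<open>x\<close>.\<close>

lemma star_interior:
  assumes "star x x'" "i \<in> eidx G" "x \<in> edge_interior G i" "x' \<in> network_set G"
  shows "x' \<in> edge_interior G i"
  using assms(4)
proof (cases rule: network_set_cases)
  case 1 then show ?thesis using assms unfolding star_def by blast
next
  case (2 k)
  then show ?thesis using assms edge_interior_unique[of i k x] unfolding star_def by blast
qed

text \<open>Around an interior point the network is the edge, and around a point off the edge
  everything is 0. At a vertex the zero values on the other edges fit because both \<open>F\<close>
  and \<open>F'\<close> vanish there. \<open>K\<close> is the gradient, extended in the same
  way.\<close>

lemma edge_function_C1:
  fixes F F' :: "real \<Rightarrow> real"
  assumes i: "i \<in> eidx G"
    and F: "\<And>z. (F has_real_derivative F' z) (at z)" "continuous_on UNIV F'"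
    and vanish: "\<And>v. v \<in> vertices G \<inter> edge_set G i \<Longrightarrow> F (axis_coord G i v) = 0 \<and> F' (axis_coord G i v) = 0"
  defines "h \<equiv> \<lambda>x. if x \<in> edge_set G i then F (axis_coord G i x) else 0"
    and "K \<equiv> \<lambda>x. (if x \<in> edge_set G i then F' (axis_coord G i x) else 0) *\<^sub>R edge_dir G i"
  shows "x \<in> network_set G \<Longrightarrow> (h has_derivative (\<lambda>w. K x \<bullet> w)) (at x within network_set G)"
    and "continuous_on (network_set G) K"
proof -
  have der: "((\<lambda>x. F (axis_coord G i x)) has_derivative (\<lambda>w. F' (axis_coord G i x) * (edge_dir G i \<bullet> w))) (at x within network_set G)" for x
  proof -
    have "((\<lambda>x. axis_coord G i x) has_derivative (\<lambda>w. edge_dir G i \<bullet> w)) (at x within network_set G)"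
      unfolding axis_coord_def by (auto intro!: derivative_eq_intros simp: inner_commute)
    from has_derivative_compose[OF this F(1)[unfolded has_field_derivative_def]] show ?thesis by simp
  qed
  have contF': "continuous_on UNIV (\<lambda>x. F' (axis_coord G i x))"
    by (rule continuous_on_compose2[OF F(2)]) (auto intro!: continuous_intros)
  { fix x assume x: "x \<in> network_set G"
    obtain d where d: "d > 0" "\<And>x'. dist x' x < d \<Longrightarrow> star x x'" using eventually_star[of x] by blast
    consider (int) "x \<in> edge_interior G i" | (out) "x \<notin> edge_set G i" | (vert) "x \<in> vertices G \<inter> edge_set G i" by blast
    then have "(h has_derivative (\<lambda>w. K x \<bullet> w)) (at x within network_set G) \<and>
      (\<forall>e>0. \<exists>r>0. \<forall>x'\<in>network_set G. dist x' x < r \<longrightarrow> dist (K x') (K x) < e)"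
    proof cases
      case int
      have near: "x' \<in> edge_set G i" if "x' \<in> network_set G" "dist x' x < d" for x'
        using star_interior[OF d(2) i int] that by blast
      have "(h has_derivative (\<lambda>w. F' (axis_coord G i x) * (edge_dir G i \<bullet> w))) (at x within network_set G)"
        by (rule has_derivative_transform_within[OF der d(1) x]) (simp add: h_def near dist_commute)
      moreover have "\<exists>r>0. \<forall>x'\<in>network_set G. dist x' x < r \<longrightarrow> dist (K x') (K x) < e" if "e > 0" for e
      proof -
        obtain r where r: "r > 0" "\<And>x'. dist x' x < r \<Longrightarrow> dist (F' (axis_coord G i x')) (F' (axis_coord G i x)) < e"
          using contF'[unfolded continuous_on_iff, rule_format, of x e] \<open>e > 0\<close> by auto
        have "dist (K x') (K x) < e" if "x' \<in> network_set G" "dist x' x < min r d" for x'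
          using r(2)[of x'] near[of x'] that int norm_edge_dir[OF i]
          by (simp add: K_def dist_norm flip: scaleR_diff_left)
        then show ?thesis using r(1) d(1) by (intro exI[of _ "min r d"]) auto
      qed
      ultimately show ?thesis using int by (simp add: K_def)
    next
      case out
      have near: "x' \<notin> edge_set G i" if "dist x' x < d" for x'
        using d(2)[OF that] out i unfolding star_def by blast
      have "(h has_derivative (\<lambda>w. 0)) (at x within network_set G)"
        by (rule has_derivative_transform_within[OF has_derivative_const d(1) x, of 0]) (simp add: h_def near dist_commute)
      moreover have "\<exists>r>0. \<forall>x'\<in>network_set G. dist x' x < r \<longrightarrow> dist (K x') (K x) < e" if "e > 0" for e
        using d(1) that out near by (intro exI[of _ d]) (simp add: K_def)
      ultimately show ?thesis using out by (simp add: K_def)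
    next
      case vert
      then have 0: "F (axis_coord G i x) = 0" "F' (axis_coord G i x) = 0" using vanish by auto
      have K0: "K x = 0" using 0 by (simp add: K_def)
      have "(h has_derivative (\<lambda>w. 0)) (at x within network_set G)"
        unfolding has_derivative_within_alt
      proof (intro conjI allI impI)
        fix e :: real assume "e > 0"
        then obtain r where r: "r > 0" "\<And>y. y \<in> network_set G \<Longrightarrow> norm (y - x) < r \<Longrightarrow>
            norm (F (axis_coord G i y)) \<le> e * norm (y - x)"
          using der[of x] unfolding has_derivative_within_alt by (auto simp: 0)
        have "norm (h y - h x - 0) \<le> e * norm (y - x)" if "y \<in> network_set G" "norm (y - x) < r" for y
          using r(2)[OF that] \<open>e > 0\<close> by (simp add: h_def 0)
        then show "\<exists>d>0. \<forall>y\<in>network_set G. norm (y - x) < d \<longrightarrow> norm (h y - h x - 0) \<le> e * norm (y - x)"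
          using r(1) by blast
      qed (rule bounded_linear_zero)
      moreover have "\<exists>r>0. \<forall>x'\<in>network_set G. dist x' x < r \<longrightarrow> dist (K x') (K x) < e" if "e > 0" for e
      proof -
        obtain r where r: "r > 0" "\<And>x'. dist x' x < r \<Longrightarrow> dist (F' (axis_coord G i x')) (F' (axis_coord G i x)) < e"
          using contF'[unfolded continuous_on_iff, rule_format, of x e] \<open>e > 0\<close> by auto
        have "dist (K x') (K x) < e" if "dist x' x < r" for x'
          using r(2)[OF that] \<open>e > 0\<close> norm_edge_dir[OF i] unfolding K0 by (simp add: K_def 0)
        then show ?thesis using r(1) by blast
      qed
      ultimately show ?thesis using K0 by simp
    qed }
  then show "x \<in> network_set G \<Longrightarrow> (h has_derivative (\<lambda>w. K x \<bullet> w)) (at x within network_set G)"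
    and "continuous_on (network_set G) K"
    unfolding continuous_on_iff by blast+
qed

text \<open>One scalar function per edge instead of the velocity vector: convex combinations must
  keep apart the speeds on different edges, whose directions may be linearly dependent. The
  indicator of the interior makes all of them 0 at a vertex.\<close>

definition edge_speed :: "(real \<Rightarrow> 'a) \<Rightarrow> (real \<Rightarrow> 'a) \<Rightarrow> nat \<Rightarrow> real \<Rightarrow> real" where
  "edge_speed y v i s = indicator (edge_interior G i) (y s) * (v s \<bullet> edge_dir G i)"

section \<open>Velocities and edge speeds\<close>

lemma measurable_indicator_edge_interior:
  assumes "i \<in> eidx G"
  shows "(indicator (edge_interior G i) :: 'a \<Rightarrow> real) \<in> borel_measurable borel"
  using assms by (intro borel_measurable_indicator sets.Diff borel_closed closed_edge_set finite_imp_closed finite_vertices)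

lemma integrable_edge_speed:
  assumes y: "continuous_on {t..T} y" and v: "integrable (lebesgue_on {t<..<T}) v" and i: "i \<in> eidx G"
  shows "integrable (lebesgue_on {t<..<T}) (edge_speed y v i)"
proof (rule Bochner_Integration.integrable_bound)
  note [measurable] = borel_measurable_integrable[OF v]
    measurable_compose[OF measurable_continuous_Ioo[OF y] measurable_indicator_edge_interior[OF i]]
  show "edge_speed y v i \<in> borel_measurable (lebesgue_on {t<..<T})"
    unfolding edge_speed_def by measurable
  show "integrable (lebesgue_on {t<..<T}) (\<lambda>s. norm (v s))" using v by simp
  show "AE s in lebesgue_on {t<..<T}. norm (edge_speed y v i s) \<le> norm (norm (v s))"
  proof (rule AE_I2)
    fix s
    show "norm (edge_speed y v i s) \<le> norm (norm (v s))"
      using Cauchy_Schwarz_ineq2[of "v s" "edge_dir G i"] norm_edge_dir[OF i]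
      by (simp add: edge_speed_def indicator_def)
  qed
qed

text \<open>Where a scalar absolutely continuous function is 0, its derivative is 0 almost
  everywhere. The coordinates of \<open>y - c\<close> for a vertex \<open>c\<close> give velocity 0
  at vertices; the components normal to an edge show that the velocity is tangent to it.\<close>

lemma velocity_eq_sum_edge_speed:
  assumes y: "has_ac_deriv t T y v" "continuous_on {t..T} y" "y ` {t..T} \<subseteq> network_set G"
  shows "AE s in lebesgue_on {t<..<T}. v s = (\<Sum>i\<in>eidx G. edge_speed y v i s *\<^sub>R edge_dir G i)"
proof -
  let ?M = "lebesgue_on {t<..<T}"
  have zero: "AE s in ?M. (y s - c) \<bullet> w = 0 \<longrightarrow> v s \<bullet> w = 0" for c w
    using y(2) by (intro has_ac_deriv_zero_set[OF has_ac_deriv_affine[OF y(1)]] continuous_intros)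
  have "AE s in ?M. \<forall>c\<in>vertices G. \<forall>b\<in>Basis. (y s - c) \<bullet> b = 0 \<longrightarrow> v s \<bullet> b = 0"
    using finite_vertices by (intro AE_finite_allI zero) auto
  \<comment> \<open>The second factor is the part of \<open>b\<close> orthogonal to the edge; its
    inner product with \<open>y s - edge_base G i\<close> is 0 while \<open>y\<close> is on the
    edge.\<close>
  moreover have "AE s in ?M. \<forall>i\<in>eidx G. \<forall>b\<in>Basis.
      (y s - edge_base G i) \<bullet> (b - (edge_dir G i \<bullet> b) *\<^sub>R edge_dir G i) = 0 \<longrightarrow>
      v s \<bullet> (b - (edge_dir G i \<bullet> b) *\<^sub>R edge_dir G i) = 0"
    by (intro AE_finite_allI zero) auto
  moreover have "AE s in ?M. s \<in> {t<..<T}" by (rule AE_I2) simp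
  ultimately show ?thesis
  proof eventually_elim
    case (elim s)
    then have "y s \<in> network_set G" using y(3) by auto
    then show ?case
    proof (cases rule: network_set_cases)
      case 1
      then have "v s \<bullet> b = 0" if "b \<in> Basis" for b using elim(1) that by force
      then have "v s = 0" by (metis euclidean_all_zero_iff)
      then show ?thesis by (simp add: edge_speed_def)
    next
      case (2 i)
      let ?e = "edge_dir G i"
      have e1: "?e \<bullet> ?e = 1" using norm_edge_dir[OF 2(1)] by (simp add: dot_square_norm)
      have "y s = edge_base G i + axis_coord G i (y s) *\<^sub>R ?e"
        using 2 edge_set_iff[OF 2(1), of "y s"] by blast
      then have ys: "y s - edge_base G i = axis_coord G i (y s) *\<^sub>R ?e" by (metis add_diff_cancel_left')
      have "v s \<bullet> b = ((v s \<bullet> ?e) *\<^sub>R ?e) \<bullet> b" if "b \<in> Basis" for b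
      proof -
        have "(y s - edge_base G i) \<bullet> (b - (?e \<bullet> b) *\<^sub>R ?e) = 0"
          unfolding ys using e1 by (simp add: inner_diff_right)
        then have "v s \<bullet> (b - (?e \<bullet> b) *\<^sub>R ?e) = 0" using elim(2) 2(1) that by blast
        then show ?thesis by (simp add: inner_diff_right mult.commute)
      qed
      then have "v s = (v s \<bullet> ?e) *\<^sub>R ?e" by (rule euclidean_eqI)
      moreover have "(\<Sum>k\<in>eidx G. edge_speed y v k s *\<^sub>R edge_dir G k) =
          (\<Sum>k\<in>eidx G. if k = i then (v s \<bullet> ?e) *\<^sub>R ?e else 0)"
      proof (rule sum.cong)
        fix k assume k: "k \<in> eidx G"
        show "edge_speed y v k s *\<^sub>R edge_dir G k = (if k = i then (v s \<bullet> ?e) *\<^sub>R ?e else 0)"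
        proof (cases "k = i")
          case False
          then have "y s \<notin> edge_set G k" using edge_interior_unique[OF 2(1) k 2(2)] by blast
          then show ?thesis using False by (simp add: edge_speed_def)
        qed (use 2 in \<open>simp add: edge_speed_def\<close>)
      qed simp
      ultimately show ?thesis using 2(1) by simp
    qed
  qed
qed

text \<open>The function \<open>P - arctan (n P) / n\<close> has a vanishing derivative where \<open>P\<close> vanishes, so that its extension
  by 0 off the edge is \<open>C\<^sup>1\<close> on the network; the claim is the limit for large \<open>n\<close>.\<close>

lemma has_ac_deriv_edge_function:
  fixes P P' :: "real \<Rightarrow> real"
  assumes y: "has_ac_deriv t T y v" "continuous_on {t..T} y" "y ` {t..T} \<subseteq> network_set G"
    and i: "i \<in> eidx G"
    and P: "\<And>z. (P has_real_derivative P' z) (at z)" "continuous_on UNIV P'"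
    and P0: "\<And>x. x \<in> edge_set G i \<Longrightarrow> P (axis_coord G i x) = 0 \<longleftrightarrow> x \<in> vertices G"
  shows "has_ac_deriv t T (\<lambda>s. if y s \<in> edge_set G i then P (axis_coord G i (y s)) else 0)
    (\<lambda>s. P' (axis_coord G i (y s)) * edge_speed y v i s)"
proof -
  let ?M = "lebesgue_on {t<..<T}"
  define h where "h x = (if x \<in> edge_set G i then P (axis_coord G i x) else 0)" for x
  \<comment> \<open>\<open>P' * r n\<close> is the derivative of \<open>F n\<close>;
    \<open>r n\<close> lies in [0, 1], vanishes at the zeros of \<open>P\<close> and tends to 1
    elsewhere.\<close>
  define r where "r n z = 1 - 1 / (1 + (real (Suc n) * P z)\<^sup>2)" for n z
  define F where "F n z = P z - arctan (real (Suc n) * P z) / real (Suc n)" for n z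
  have pos: "1 + (c * x)\<^sup>2 > 0" for c x :: real
    by (metis add_pos_nonneg zero_le_power2 zero_less_one)
  have contP: "continuous_on UNIV P" using P(1) by (meson DERIV_isCont continuous_at_imp_continuous_on)
  have r_cont: "continuous_on UNIV (r n)" for n
    unfolding r_def using contP by (intro continuous_intros ballI) (simp_all only: pos[THEN less_imp_neq, THEN not_sym] not_False_eq_True)
  have r01: "0 \<le> r n z" "r n z \<le> 1" for n z
    unfolding r_def using pos[of "real (Suc n)" "P z"] by (simp_all add: divide_le_eq del: of_nat_Suc)
  have FD: "(F n has_real_derivative P' z * r n z) (at z)" for n z
  proof -
    have "(F n has_real_derivative P' z - (inverse (1 + (real (Suc n) * P z)\<^sup>2) * (real (Suc n) * P' z)) / real (Suc n)) (at z)"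
      unfolding F_def[abs_def] by (auto intro!: derivative_eq_intros P(1))
    moreover have "P' z - (inverse (1 + (real (Suc n) * P z)\<^sup>2) * (real (Suc n) * P' z)) / real (Suc n) = P' z * r n z"
      by (simp add: r_def inverse_eq_divide right_diff_distrib del: of_nat_Suc)
    ultimately show ?thesis by simp
  qed
  have v: "integrable ?M v" using y(1) by (simp add: has_ac_deriv_def)
  have sp: "integrable ?M (edge_speed y v i)" by (rule integrable_edge_speed[OF y(2) v i])
  have contP'y: "continuous_on {t..T} (\<lambda>s. P' (axis_coord G i (y s)))"
    by (rule continuous_on_compose2[OF P(2)]) (auto intro!: continuous_intros y(2))
  have Dint: "integrable ?M (\<lambda>s. P' (axis_coord G i (y s)) * edge_speed y v i s)"
    using integrable_bounded_inner[OF sp contP'y] by simp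
  define D where "D n s = (if y s \<in> edge_set G i then P' (axis_coord G i (y s)) * r n (axis_coord G i (y s)) else 0) * (edge_dir G i \<bullet> v s)" for n s
  \<comment> \<open>On the edge but outside its interior, that is at a vertex, \<open>r n\<close> is
    0, so the indicator inside \<open>edge_speed\<close> changes nothing.\<close>
  have D_eq: "D n s = r n (axis_coord G i (y s)) * (P' (axis_coord G i (y s)) * edge_speed y v i s)" for n s
  proof (cases "y s \<in> edge_set G i \<inter> vertices G")
    case True
    then have "P (axis_coord G i (y s)) = 0" using P0 by blast
    then have "r n (axis_coord G i (y s)) = 0" by (simp add: r_def)
    then show ?thesis by (simp add: D_def)
  next
    case False
    then show ?thesis by (auto simp: D_def edge_speed_def inner_commute)
  qed
  have step: "has_ac_deriv t T (\<lambda>s. if y s \<in> edge_set G i then F n (axis_coord G i (y s)) else 0) (D n)" for n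
  proof -
    have v0: "F n (axis_coord G i v) = 0 \<and> P' (axis_coord G i v) * r n (axis_coord G i v) = 0"
      if "v \<in> vertices G \<inter> edge_set G i" for v
    proof -
      have "P (axis_coord G i v) = 0" using P0 that by blast
      then show ?thesis by (simp add: F_def r_def)
    qed
    have "continuous_on UNIV (\<lambda>z. P' z * r n z)" using P(2) r_cont by (intro continuous_intros)
    note C1 = edge_function_C1[OF i FD this v0]
    from has_ac_deriv_chain[OF y C1(2) C1(1)] show ?thesis by (simp add: D_def[abs_def])
  qed
  have "h (y b) - h (y a) = (LINT s:{a<..b}|?M. P' (axis_coord G i (y s)) * edge_speed y v i s)"
    if ab: "t \<le> a" "a \<le> b" "b \<le> T" for a b
  proof -
    have lim: "(\<lambda>n. if x \<in> edge_set G i then F n (axis_coord G i x) else 0) \<longlonglongrightarrow> h x" for x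
    proof -
      have "(\<lambda>n. F n z) \<longlonglongrightarrow> P z" for z
      proof -
        have "(\<lambda>n. arctan (real (Suc n) * P z) / real (Suc n)) \<longlonglongrightarrow> 0"
        proof (rule tendsto_0_le[where K=1])
          show "(\<lambda>n. 2 / real (Suc n)) \<longlonglongrightarrow> 0" by real_asymp
          have "\<bar>arctan z\<bar> \<le> 2" for z using arctan_bounded[of z] pi_less_4 by linarith
          then show "\<forall>\<^sub>F n in sequentially. norm (arctan (real (Suc n) * P z) / real (Suc n)) \<le> norm (2 / real (Suc n)) * 1"
            by (simp add: divide_right_mono)
        qed
        from tendsto_diff[OF tendsto_const this, of "P z"] show ?thesis by (simp add: F_def[abs_def])
      qed
      then show ?thesis by (simp add: h_def)
    qed
    have "(\<lambda>n. (LINT s:{a<..b}|?M. D n s)) \<longlonglongrightarrow> h (y b) - h (y a)"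
      using tendsto_diff[OF lim[of "y b"] lim[of "y a"]] step ab by (simp add: has_ac_deriv_def)
    moreover have "(\<lambda>n. (LINT s:{a<..b}|?M. D n s)) \<longlonglongrightarrow> (LINT s:{a<..b}|?M. P' (axis_coord G i (y s)) * edge_speed y v i s)"
      unfolding set_lebesgue_integral_def
    proof (rule integral_dominated_convergence[where w="\<lambda>s. norm (P' (axis_coord G i (y s)) * edge_speed y v i s)"])
      show "AE s in ?M. (\<lambda>n. indicator {a<..b} s *\<^sub>R D n s) \<longlonglongrightarrow>
          indicator {a<..b} s *\<^sub>R (P' (axis_coord G i (y s)) * edge_speed y v i s)"
      proof (rule AE_I2)
        fix s
        have "(\<lambda>n. D n s) \<longlonglongrightarrow> P' (axis_coord G i (y s)) * edge_speed y v i s"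
        proof (cases "y s \<in> edge_interior G i")
          case True
          then have "P (axis_coord G i (y s)) \<noteq> 0" using P0 by blast
          then have "(\<lambda>n. r n (axis_coord G i (y s))) \<longlonglongrightarrow> 1" unfolding r_def by real_asymp
          from tendsto_mult_right[OF this, of "P' (axis_coord G i (y s)) * edge_speed y v i s"]
          show ?thesis unfolding D_eq by simp
        next
          case False then show ?thesis unfolding D_eq by (simp add: edge_speed_def)
        qed
        then show "(\<lambda>n. indicator {a<..b} s *\<^sub>R D n s) \<longlonglongrightarrow>
          indicator {a<..b} s *\<^sub>R (P' (axis_coord G i (y s)) * edge_speed y v i s)" by (intro tendsto_intros)
      qed
      show "AE s in ?M. norm (indicator {a<..b} s *\<^sub>R D n s) \<le> norm (P' (axis_coord G i (y s)) * edge_speed y v i s)" for n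
      proof (rule AE_I2)
        fix s
        have "\<bar>r n (axis_coord G i (y s))\<bar> \<le> 1" using r01 by (simp add: abs_le_iff order_trans[of _ 0])
        then show "norm (indicator {a<..b} s *\<^sub>R D n s) \<le> norm (P' (axis_coord G i (y s)) * edge_speed y v i s)"
          by (simp add: D_eq indicator_def abs_mult mult_left_le_one_le)
      qed
      show "(\<lambda>s. indicator {a<..b} s *\<^sub>R D n s) \<in> borel_measurable ?M" for n
      proof -
        have "integrable ?M (D n)" using step by (simp add: has_ac_deriv_def)
        from set_integrable_Ioc[OF this] show ?thesis
          unfolding set_integrable_def by (rule borel_measurable_integrable)
      qed
      show "(\<lambda>s. indicator {a<..b} s *\<^sub>R (P' (axis_coord G i (y s)) * edge_speed y v i s)) \<in> borel_measurable ?M"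
        using set_integrable_Ioc[OF Dint] unfolding set_integrable_def by (rule borel_measurable_integrable)
    qed (use Dint in auto)
    ultimately show ?thesis by (rule LIMSEQ_unique)
  qed
  then show ?thesis using Dint by (simp add: has_ac_deriv_def h_def)
qed

text \<open>A function with simple zeros at the vertices need not have a C^1 extension by 0, but the
  extension is continuous. That is what the passage to a uniform limit of trajectories
  requires.\<close>

lemma continuous_edge_function:
  fixes P :: "real \<Rightarrow> real"
  assumes i: "i \<in> eidx G" and P: "continuous_on UNIV P"
    and P0: "\<And>x. x \<in> vertices G \<inter> edge_set G i \<Longrightarrow> P (axis_coord G i x) = 0"
  shows "continuous_on (network_set G) (\<lambda>x. if x \<in> edge_set G i then P (axis_coord G i x) else 0)"
  unfolding continuous_on_iff
proof (intro ballI allI impI)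
  fix x and e :: real assume x: "x \<in> network_set G" and e: "e > 0"
  let ?m = "\<lambda>x. if x \<in> edge_set G i then P (axis_coord G i x) else 0"
  obtain d where d: "d > 0" "\<And>x'. dist x' x < d \<Longrightarrow> star x x'" using eventually_star[of x] by blast
  have "continuous_on UNIV (\<lambda>x. P (axis_coord G i x))"
    by (rule continuous_on_compose2[OF P]) (auto intro!: continuous_intros)
  then obtain r where r: "r > 0" "\<And>x'. dist x' x < r \<Longrightarrow> dist (P (axis_coord G i x')) (P (axis_coord G i x)) < e"
    using e unfolding continuous_on_iff by (metis UNIV_I)
  have "dist (?m x') (?m x) < e" if x': "x' \<in> network_set G" "dist x' x < min d r" for x'
  proof -
    have st: "star x x'" using d(2) that by simp
    consider "x \<in> edge_interior G i" | "x \<notin> edge_set G i" | "x \<in> vertices G \<inter> edge_set G i" by blast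
    then show ?thesis
    proof cases
      case 1
      then have "x' \<in> edge_set G i" using star_interior[OF st i _ x'(1)] by blast
      then show ?thesis using 1 r(2)[of x'] x' by simp
    next
      case 2
      then have "x' \<notin> edge_set G i" using st i unfolding star_def by blast
      then show ?thesis using 2 e by simp
    next
      case 3
      then have "P (axis_coord G i x) = 0" by (rule P0)
      then show ?thesis using 3 r(2)[of x'] x' e by simp
    qed
  qed
  then show "\<exists>d>0. \<forall>x'\<in>network_set G. dist x' x < d \<longrightarrow> dist (?m x') (?m x) < e"
    using d(1) r(1) by (intro exI[of _ "min d r"]) auto
qed

text \<open>The affine coordinate is injective on the edge, so simple zeros placed at the
  coordinates of the vertices occur at no other point of the edge.\<close>

lemma edge_polynomial:
  assumes i: "i \<in> eidx G"
  obtains P P' :: "real \<Rightarrow> real" where "\<And>z. (P has_real_derivative P' z) (at z)" "continuous_on UNIV P'" "continuous_on UNIV P"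
    "\<And>x. x \<in> edge_set G i \<Longrightarrow> P (axis_coord G i x) = 0 \<longleftrightarrow> x \<in> vertices G"
    "\<And>x. x \<in> edge_set G i \<inter> vertices G \<Longrightarrow> P' (axis_coord G i x) \<noteq> 0"
proof -
  let ?C = "axis_coord G i ` (edge_set G i \<inter> vertices G)"
  have "finite ?C" using finite_vertices by auto
  then obtain P P' where P: "\<And>z. (P has_real_derivative P' z) (at z)" "continuous_on UNIV P'"
    "\<And>z. P z = 0 \<longleftrightarrow> z \<in> ?C" "\<And>z. z \<in> ?C \<Longrightarrow> P' z \<noteq> 0"
    using simple_zeros_exist[of ?C] by metis
  have inj: "x = x'" if "x \<in> edge_set G i" "x' \<in> edge_set G i" "axis_coord G i x = axis_coord G i x'" for x x'
    using that edge_set_iff[OF i] by metis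
  show ?thesis
  proof (rule that[of P P'])
    show "continuous_on UNIV P" using P(1) by (meson DERIV_isCont continuous_at_imp_continuous_on)
    show "P (axis_coord G i x) = 0 \<longleftrightarrow> x \<in> vertices G" if "x \<in> edge_set G i" for x
      unfolding P(3) using inj that by blast
    show "P' (axis_coord G i x) \<noteq> 0" if "x \<in> edge_set G i \<inter> vertices G" for x
      using that by (intro P(4)) blast
  qed (use P in auto)
qed

end

section \<open>The cost functional\<close>

lemma continuous_on_Min_insert:
  fixes f :: "'i \<Rightarrow> 'c::topological_space \<Rightarrow> real"
  assumes "finite A" "continuous_on S h" "\<And>i. i \<in> A \<Longrightarrow> continuous_on S (f i)"
  shows "continuous_on S (\<lambda>s. Min (insert (h s) ((\<lambda>i. f i s) ` A)))"
  using assms(1,3)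
proof (induction A)
  case empty then show ?case using assms(2) by simp
next
  case (insert i A)
  have "Min (insert (h s) ((\<lambda>i. f i s) ` insert i A)) = min (f i s) (Min (insert (h s) ((\<lambda>i. f i s) ` A)))" for s
    using insert(1) by (simp add: insert_commute[of "h s" "f i s"] del: Min_insert)
      (subst Min_insert, auto)
  moreover have "continuous_on S (\<lambda>s. min (f i s) (Min (insert (h s) ((\<lambda>i. f i s) ` A))))"
    using insert by (intro continuous_on_min) auto
  ultimately show ?case by simp
qed

locale control_problem = finite_network G for G :: "'a::euclidean_space network" +
  fixes T p t :: real
    and ell :: "nat \<Rightarrow> real \<Rightarrow> real \<Rightarrow> real \<Rightarrow> real" and ellv :: "nat \<Rightarrow> real \<Rightarrow> real"
    and g :: "nat \<Rightarrow> real \<Rightarrow> real" and gv :: "nat \<Rightarrow> real"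
  assumes p: "1 < p"
    and g_cont: "\<And>i. i \<in> eidx G \<Longrightarrow> continuous_on (edge_dom G i) (g i)"
    and g_bounded: "\<And>i. i \<in> eidx G \<Longrightarrow> bounded (g i ` edge_dom G i)"
    and ellv_cont: "\<And>j. j \<in> vidx G \<Longrightarrow> continuous_on {0..T} (ellv j)"
    and ell_cont: "\<And>i. i \<in> eidx G \<Longrightarrow>
      continuous_on (edge_dom G i \<times> UNIV \<times> {0..T}) (\<lambda>(y, a, s). ell i y a s)"
    and ell_diff: "\<And>i s. i \<in> eidx G \<Longrightarrow> s \<in> {0..T} \<Longrightarrow>
      (\<lambda>(y, a). ell i y a s) differentiable_on (edge_dom G i \<times> UNIV)"
    and H1: "\<And>i j. i \<in> eidx G \<Longrightarrow> j \<in> vidx G \<Longrightarrow>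
      \<exists>C0>0. (\<forall>y\<in>edge_dom G i. \<forall>a. \<forall>s\<in>{0..T}. ell i y a s \<ge> C0 * (\<bar>a\<bar> powr p - 1)) \<and>
             (\<forall>s\<in>{0..T}. ellv j s \<ge> - C0)"
    and H3: "\<And>i r. i \<in> eidx G \<Longrightarrow> 0 < r \<Longrightarrow>
      \<exists>c\<ge>0. \<forall>y\<in>edge_dom G i \<inter> {0..r}. \<forall>a. \<forall>s\<in>{0..T}.
           \<bar>partial_y G ell i y a s\<bar> \<le> c * (\<bar>a\<bar> powr p + 1) \<and>
           \<bar>partial_a ell i y a s\<bar> \<le> c * (\<bar>a\<bar> powr (p - 1) + 1)"
    and H4: "\<And>i y s. i \<in> eidx G \<Longrightarrow> y \<in> edge_dom G i \<Longrightarrow> s \<in> {0..T} \<Longrightarrow>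
      strictly_convex (\<lambda>a. ell i y a s)"
    and t: "t \<in> {0..T}"
begin

abbreviation "L \<equiv> running_cost G ell ellv"
abbreviation "M \<equiv> lebesgue_on {t<..<T}"

section \<open>Values of the running cost\<close>

lemma finite_measure_M: "finite_measure M" by (rule finite_measure_lebesgue_on_Ioo)

lemma vertices_vertex: assumes "x \<in> vertices G" obtains j where "j \<in> vidx G" "x = vertex G j"
  using assms by (auto simp: vertices_def)

lemma vertex_eq_iff: "j \<in> vidx G \<Longrightarrow> k \<in> vidx G \<Longrightarrow> vertex G j = vertex G k \<longleftrightarrow> j = k"
  by (rule inj_on_eq_iff[OF network[unfolded is_network_def, THEN conjunct2, THEN conjunct1]])

lemma sum_edge_interior:
  fixes f :: "nat \<Rightarrow> real"
  assumes i: "i \<in> eidx G" and x: "x \<in> edge_interior G i"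
  shows "(\<Sum>k\<in>eidx G. f k * indicator (edge_interior G k) x) = f i"
proof -
  have "f k * indicator (edge_interior G k) x = (if k = i then f i else 0)" if k: "k \<in> eidx G" for k
  proof (cases "k = i")
    case True then show ?thesis using x by simp
  next
    case False
    then have "x \<notin> edge_set G k" using edge_interior_unique[OF i k x] by blast
    then show ?thesis using False by simp
  qed
  then have "(\<Sum>k\<in>eidx G. f k * indicator (edge_interior G k) x) = (\<Sum>k\<in>eidx G. if k = i then f i else 0)"
    by (rule sum.cong[OF refl])
  then show ?thesis using i by simp
qed

lemma sum_vertex_indicator:
  fixes f :: "nat \<Rightarrow> real"
  assumes j: "j \<in> vidx G"
  shows "(\<Sum>k\<in>vidx G. f k * indicator {vertex G k} (vertex G j)) = f j"
proof -
  have "f k * indicator {vertex G k} (vertex G j) = (if k = j then f j else 0)" if "k \<in> vidx G" for k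
    using vertex_eq_iff[OF j that] by auto
  then have "(\<Sum>k\<in>vidx G. f k * indicator {vertex G k} (vertex G j)) = (\<Sum>k\<in>vidx G. if k = j then f j else 0)"
    by (rule sum.cong[OF refl])
  then show ?thesis using j by simp
qed

lemma running_cost_interior:
  assumes i: "i \<in> eidx G" and x: "x \<in> edge_interior G i"
  shows "L x w s = ell i (axis_coord G i x) (w \<bullet> edge_dir G i) s"
proof -
  have "(\<Sum>k\<in>eidx G. ell k (edge_coord G k x) (w \<bullet> edge_dir G k) s * indicator (edge_interior G k) x) =
      ell i (axis_coord G i x) (w \<bullet> edge_dir G i) s"
    using sum_edge_interior[OF assms] edge_coord_eq[OF i] x by simp
  moreover have "(\<Sum>j\<in>vidx G. vertex_running_cost G ell ellv j s * indicator {vertex G j} x) = 0"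
    using x by (intro sum.neutral) (auto simp: vertices_def indicator_def)
  ultimately show ?thesis by (simp add: running_cost_def)
qed

lemma running_cost_vertex:
  assumes j: "j \<in> vidx G"
  shows "L (vertex G j) w s = vertex_running_cost G ell ellv j s"
proof -
  have V: "vertex G j \<in> vertices G" using j by (auto simp: vertices_def)
  then show ?thesis using sum_vertex_indicator[OF j] by (simp add: running_cost_def)
qed

text \<open>At a vertex the cost is a minimum that includes the cost at rest on every adjacent edge.
  This one-sided inequality is the source of lower semicontinuity when trajectories approach a
  vertex.\<close>

lemma running_cost_zero_le:
  assumes i: "i \<in> eidx G" and x: "x \<in> edge_set G i"
  shows "L x 0 s \<le> ell i (axis_coord G i x) 0 s"
proof (cases "x \<in> vertices G")
  case True
  then obtain j where j: "j \<in> vidx G" "x = vertex G j" by (rule vertices_vertex)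
  have "L x 0 s = vertex_running_cost G ell ellv j s" using running_cost_vertex j by simp
  also have "\<dots> \<le> ell i (edge_coord G i x) 0 s"
    unfolding vertex_running_cost_def using i x j(2) by (intro Min_le) auto
  finally show ?thesis using edge_coord_eq[OF i x] by simp
next
  case False
  then show ?thesis using running_cost_interior[OF i, of x 0 s] x by simp
qed

section \<open>The terminal cost\<close>

lemma terminal_cost_interior:
  assumes i: "i \<in> eidx G" and x: "x \<in> edge_interior G i"
  shows "terminal_cost G g gv x = g i (axis_coord G i x)"
proof -
  have "(\<Sum>k\<in>eidx G. g k (edge_coord G k x) * indicator (edge_interior G k) x) = g i (axis_coord G i x)"
    using sum_edge_interior[OF assms] edge_coord_eq[OF i] x by simp
  moreover have "x \<noteq> vertex G j" if "j \<in> vidx G" for j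
    using x that by (auto simp: vertices_def)
  ultimately show ?thesis by (simp add: terminal_cost_def)
qed

lemma terminal_cost_le:
  assumes i: "i \<in> eidx G" and x: "x \<in> edge_set G i"
  shows "terminal_cost G g gv x \<le> g i (axis_coord G i x)"
proof (cases "x \<in> vertices G")
  case True
  then obtain j where j: "j \<in> vidx G" "x = vertex G j" by (rule vertices_vertex)
  let ?m = "\<lambda>j. Min (insert (gv j) ((\<lambda>i. g i (edge_coord G i (vertex G j))) ` {i \<in> eidx G. vertex G j \<in> edge_set G i}))"
  have "terminal_cost G g gv x = ?m j"
    using True j(2) sum_vertex_indicator[OF j(1), of ?m] by (simp add: terminal_cost_def)
  also have "\<dots> \<le> g i (edge_coord G i x)"
    using i x j(2) by (intro Min_le) auto
  finally show ?thesis using edge_coord_eq[OF i x] by simp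
next
  case False
  then show ?thesis using terminal_cost_interior[OF i, of x] x by simp
qed

lemma terminal_cost_bounded_below: "\<exists>B. \<forall>x\<in>network_set G. B \<le> terminal_cost G g gv x"
proof -
  have "\<exists>B. \<forall>z\<in>edge_dom G i. B \<le> g i z" if "i \<in> eidx G" for i
    using bounded_imp_bdd_below[OF g_bounded[OF that]] unfolding bdd_below_def by auto
  then obtain b where b: "\<And>i z. i \<in> eidx G \<Longrightarrow> z \<in> edge_dom G i \<Longrightarrow> b i \<le> g i z" by metis
  define B where "B = Min (insert 0 (b ` eidx G \<union> terminal_cost G g gv ` vertices G))"
  have B: "B \<le> z" if "z \<in> b ` eidx G \<union> terminal_cost G g gv ` vertices G" for z
    unfolding B_def using that finite_vertices by (intro Min_le) auto
  show ?thesis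
  proof (intro exI ballI)
    fix x assume "x \<in> network_set G"
    then show "B \<le> terminal_cost G g gv x"
    proof (cases rule: network_set_cases)
      case 1 then show ?thesis by (intro B) auto
    next
      case (2 i)
      then have "axis_coord G i x \<in> edge_dom G i" using edge_set_iff[OF 2(1)] by blast
      then have "b i \<le> g i (axis_coord G i x)" by (rule b[OF 2(1)])
      moreover have "B \<le> b i" using 2(1) by (intro B) auto
      ultimately show ?thesis using terminal_cost_interior[OF 2] by simp
    qed
  qed
qed

text \<open>Points close to \<open>x\<close> lie on edges through \<open>x\<close>, where
  \<open>g i\<close> is continuous and its value at \<open>x\<close> is at least the terminal cost
  of \<open>x\<close>; a vertex close to \<open>x\<close> can only be \<open>x\<close>
  itself.\<close>

lemma terminal_cost_lsc:
  assumes x: "\<And>n. X n \<in> network_set G" "X \<longlonglongrightarrow> x" and e: "e > 0"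
  shows "\<forall>\<^sub>F n in sequentially. terminal_cost G g gv x - e \<le> terminal_cost G g gv (X n)"
proof -
  obtain d where d: "d > 0" "\<And>x'. dist x' x < d \<Longrightarrow> star x x'" using eventually_star[of x] by blast
  have near: "\<forall>\<^sub>F n in sequentially. dist (X n) x < d" using x(2) d(1) by (rule tendstoD)
  have "\<forall>\<^sub>F n in sequentially. X n \<in> edge_set G i \<longrightarrow> terminal_cost G g gv x - e \<le> g i (axis_coord G i (X n))"
    if i: "i \<in> eidx G" for i
  proof (cases "x \<in> edge_set G i")
    case False
    have "\<forall>\<^sub>F n in sequentially. X n \<notin> edge_set G i"
      using near by eventually_elim (use d(2) False i in \<open>auto simp: star_def\<close>)
    then show ?thesis by eventually_elim simp
  next
    case True
    then have xd: "axis_coord G i x \<in> edge_dom G i" using edge_set_iff[OF i] by blast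
    obtain r where r: "r > 0" "\<And>z. z \<in> edge_dom G i \<Longrightarrow> dist z (axis_coord G i x) < r \<Longrightarrow> dist (g i z) (g i (axis_coord G i x)) < e"
      using g_cont[OF i] xd e unfolding continuous_on_iff by blast
    have "\<forall>\<^sub>F n in sequentially. dist (X n) x < r" using x(2) r(1) by (rule tendstoD)
    then show ?thesis
    proof eventually_elim
      case (elim n)
      show ?case
      proof
        assume "X n \<in> edge_set G i"
        then have "axis_coord G i (X n) \<in> edge_dom G i" using edge_set_iff[OF i] by blast
        moreover have "dist (axis_coord G i (X n)) (axis_coord G i x) < r"
          using abs_axis_coord_diff_le[OF i, of "X n" x] elim by (simp add: dist_real_def dist_norm)
        ultimately have "dist (g i (axis_coord G i (X n))) (g i (axis_coord G i x)) < e" by (rule r(2))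
        then show "terminal_cost G g gv x - e \<le> g i (axis_coord G i (X n))"
          using terminal_cost_le[OF i True] by (simp add: dist_real_def abs_less_iff)
      qed
    qed
  qed
  then have "\<forall>\<^sub>F n in sequentially. \<forall>i\<in>eidx G. X n \<in> edge_set G i \<longrightarrow> terminal_cost G g gv x - e \<le> g i (axis_coord G i (X n))"
    by (intro eventually_ball_finite) auto
  then show ?thesis using near
  proof eventually_elim
    case (elim n)
    from x(1)[of n] show ?case
    proof (cases rule: network_set_cases)
      case 1
      then have "X n = x" using d(2)[OF elim(2)] by (simp add: star_def)
      then show ?thesis using e by simp
    next
      case (2 i)
      then show ?thesis using elim(1) terminal_cost_interior[OF 2] by auto
    qed
  qed
qed

section \<open>Coercivity, growth and integrability of the running cost\<close>

lemma one_vertex: "1 \<in> vidx G"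
  using network by (simp add: is_network_def)

lemma ell_coercive: "\<exists>c>0. \<exists>C\<ge>0. \<forall>i\<in>eidx G. \<forall>z\<in>edge_dom G i. \<forall>a. \<forall>s\<in>{0..T}. c * \<bar>a\<bar> powr p - C \<le> ell i z a s"
proof -
  \<comment> \<open>The assumption is indexed by pairs of an edge and a vertex, and vertex 1 exists
    in every network. The constants of the finitely many edges are then made uniform.\<close>
  have "\<exists>C0>0. \<forall>y\<in>edge_dom G i. \<forall>a. \<forall>s\<in>{0..T}. ell i y a s \<ge> C0 * (\<bar>a\<bar> powr p - 1)" if "i \<in> eidx G" for i
    using H1[OF that one_vertex] by blast
  then obtain k where k: "\<And>i. i \<in> eidx G \<Longrightarrow> k i > 0"
    "\<And>i y a s. i \<in> eidx G \<Longrightarrow> y \<in> edge_dom G i \<Longrightarrow> s \<in> {0..T} \<Longrightarrow> ell i y a s \<ge> k i * (\<bar>a\<bar> powr p - 1)" by metis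
  define c where "c = Min (insert 1 (k ` eidx G))"
  define C where "C = Max (insert 0 (k ` eidx G))"
  have "c > 0" unfolding c_def using k(1) by (subst Min_gr_iff) auto
  moreover have "C \<ge> 0" unfolding C_def by (intro Max_ge) auto
  moreover have "c * \<bar>a\<bar> powr p - C \<le> ell i z a s" if "i \<in> eidx G" "z \<in> edge_dom G i" "s \<in> {0..T}" for i z a s
  proof -
    have "c \<le> k i" unfolding c_def using that by (intro Min_le) auto
    then have "c * \<bar>a\<bar> powr p \<le> k i * \<bar>a\<bar> powr p" by (intro mult_right_mono) auto
    moreover have "k i \<le> C" unfolding C_def using that by (intro Max_ge) auto
    ultimately show ?thesis using k(2)[OF that, of a] by (simp add: right_diff_distrib)
  qed
  ultimately show ?thesis by blast
qed

lemma vertex_running_cost_continuous: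
  assumes j: "j \<in> vidx G"
  shows "continuous_on {0..T} (vertex_running_cost G ell ellv j)"
  unfolding vertex_running_cost_def[abs_def]
proof (rule continuous_on_Min_insert)
  show "continuous_on {0..T} (\<lambda>s. ell i (edge_coord G i (vertex G j)) 0 s)" if "i \<in> {i \<in> eidx G. vertex G j \<in> edge_set G i}" for i
  proof -
    have i: "i \<in> eidx G" "vertex G j \<in> edge_set G i" using that by auto
    then have z: "edge_coord G i (vertex G j) \<in> edge_dom G i"
      using edge_coord_eq edge_set_iff by metis
    have "continuous_on {0..T} (\<lambda>s. (\<lambda>(y, a, s). ell i y a s) (edge_coord G i (vertex G j), 0, s))"
      by (rule continuous_on_compose2[OF ell_cont[OF i(1)]]) (use z in \<open>auto intro!: continuous_intros\<close>)
    then show ?thesis by simp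
  qed
qed (use ellv_cont[OF j] in auto)

text \<open>Coercivity holds in the edge speeds only. At a vertex these are 0, and the bound reduces
  to the minimum of a continuous vertex cost on a compact interval.\<close>

lemma running_cost_coercive:
  "\<exists>c>0. \<exists>C\<ge>0. \<forall>x\<in>network_set G. \<forall>w. \<forall>s\<in>{0..T}.
     c * (\<Sum>i\<in>eidx G. \<bar>indicator (edge_interior G i) x * (w \<bullet> edge_dir G i)\<bar> powr p) - C \<le> L x w s"
proof -
  obtain c C where c: "c > 0" "C \<ge> 0"
    "\<And>i z a s. i \<in> eidx G \<Longrightarrow> z \<in> edge_dom G i \<Longrightarrow> s \<in> {0..T} \<Longrightarrow> c * \<bar>a\<bar> powr p - C \<le> ell i z a s"
    using ell_coercive by blast
  have "\<exists>B. \<forall>s\<in>{0..T}. B \<le> vertex_running_cost G ell ellv j s" if "j \<in> vidx G" for j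
  proof -
    have "compact (vertex_running_cost G ell ellv j ` {0..T})"
      using vertex_running_cost_continuous[OF that] by (intro compact_continuous_image) auto
    then have "bdd_below (vertex_running_cost G ell ellv j ` {0..T})"
      by (intro bounded_imp_bdd_below compact_imp_bounded)
    then show ?thesis unfolding bdd_below_def by simp
  qed
  then obtain b where b: "\<And>j s. j \<in> vidx G \<Longrightarrow> s \<in> {0..T} \<Longrightarrow> b j \<le> vertex_running_cost G ell ellv j s" by metis
  define B where "B = Max (insert C ((\<lambda>j. - b j) ` vidx G))"
  have B: "C \<le> B" "\<And>j. j \<in> vidx G \<Longrightarrow> - b j \<le> B" unfolding B_def by (rule Max_ge; simp)+
  show ?thesis
  proof (intro exI conjI ballI allI)
    show "c > 0" "B \<ge> 0" using c B by auto
    fix x w s assume x: "x \<in> network_set G" and s: "s \<in> {0..T}"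
    show "c * (\<Sum>i\<in>eidx G. \<bar>indicator (edge_interior G i) x * (w \<bullet> edge_dir G i)\<bar> powr p) - B \<le> L x w s"
      using x
    proof (cases rule: network_set_cases)
      case 1
      then obtain j where j: "j \<in> vidx G" "x = vertex G j" by (rule vertices_vertex)
      have "L x w s = vertex_running_cost G ell ellv j s" using running_cost_vertex j by simp
      then show ?thesis using 1 b[OF j(1) s] B(2)[OF j(1)] by simp
    next
      case (2 i)
      have "\<bar>indicator (edge_interior G k) x * z\<bar> powr p = \<bar>z\<bar> powr p * indicator (edge_interior G k) x" for k z
        by (simp add: indicator_def)
      then have "(\<Sum>k\<in>eidx G. \<bar>indicator (edge_interior G k) x * (w \<bullet> edge_dir G k)\<bar> powr p) = \<bar>w \<bullet> edge_dir G i\<bar> powr p"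
        using sum_edge_interior[OF 2] by simp
      moreover have "axis_coord G i x \<in> edge_dom G i" using 2 edge_set_iff[OF 2(1)] by blast
      ultimately show ?thesis
        using c(3)[OF 2(1) _ s, of "axis_coord G i x" "w \<bullet> edge_dir G i"] 2(1) B(1) running_cost_interior[OF 2]
        by simp
    qed
  qed
qed

text \<open>Both bounds are mean value estimates from the bounds on the partial derivatives: in the
  position for the Lipschitz bound, and in the speed, starting from rest, for the growth.\<close>

lemma ell_lipschitz_growth:
  assumes i: "i \<in> eidx G"
  shows "\<exists>c\<ge>0. (\<forall>z\<in>edge_dom G i \<inter> {0..r}. \<forall>a. \<forall>s\<in>{0..T}. \<bar>ell i z a s\<bar> \<le> c * (1 + \<bar>a\<bar> powr p)) \<and>
    (\<forall>z\<in>edge_dom G i \<inter> {0..r}. \<forall>z'\<in>edge_dom G i \<inter> {0..r}. \<forall>a. \<forall>s\<in>{0..T}.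
      \<bar>ell i z a s - ell i z' a s\<bar> \<le> c * (1 + \<bar>a\<bar> powr p) * \<bar>z - z'\<bar>)"
proof -
  \<comment> \<open>The assumption on the partial derivatives is about positive radii, whereas
    \<open>r\<close> is arbitrary.\<close>
  define r' where "r' = max 1 r"
  have r': "r' > 0" "{0..r} \<subseteq> {0..r'}" by (auto simp: r'_def)
  obtain c where c: "c \<ge> 0"
    "\<And>y a s. y \<in> edge_dom G i \<inter> {0..r'} \<Longrightarrow> s \<in> {0..T} \<Longrightarrow> \<bar>partial_y G ell i y a s\<bar> \<le> c * (\<bar>a\<bar> powr p + 1)"
    "\<And>y a s. y \<in> edge_dom G i \<inter> {0..r'} \<Longrightarrow> s \<in> {0..T} \<Longrightarrow> \<bar>partial_a ell i y a s\<bar> \<le> c * (\<bar>a\<bar> powr (p - 1) + 1)"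
    using H3[OF i r'(1)] by blast
  have diff: "((\<lambda>(y, a). ell i y a s) differentiable (at (y, a) within edge_dom G i \<times> UNIV))"
    if "s \<in> {0..T}" "y \<in> edge_dom G i" for s y a
    using ell_diff[OF i that(1)] that(2) unfolding differentiable_on_def by blast
  \<comment> \<open>Restricting joint differentiability to a line shows that the vector chosen by
    \<open>vector_derivative\<close> in \<open>partial_y\<close> really is a derivative within the
    edge domain, also at its end points.\<close>
  have dy: "((\<lambda>z. ell i z a s) has_vector_derivative partial_y G ell i y a s) (at y within edge_dom G i)"
    if sy: "s \<in> {0..T}" "y \<in> edge_dom G i" for s y a
  proof -
    obtain D where D: "((\<lambda>(y, a). ell i y a s) has_derivative D) (at (y, a) within edge_dom G i \<times> UNIV)"
      using diff[OF sy, of a] unfolding differentiable_def by blast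
    have "((\<lambda>z. (z, a)) has_derivative (\<lambda>z. (z, 0))) (at y within edge_dom G i)"
      by (auto intro!: derivative_eq_intros)
    moreover have "((\<lambda>(y, a). ell i y a s) has_derivative D) (at (y, a) within (\<lambda>z. (z, a)) ` edge_dom G i)"
      by (rule has_derivative_subset[OF D]) auto
    ultimately have "((\<lambda>z. (\<lambda>(y, a). ell i y a s) (z, a)) has_derivative (\<lambda>z. D (z, 0))) (at y within edge_dom G i)"
      by (rule has_derivative_in_compose)
    then have "(\<lambda>z. ell i z a s) differentiable (at y within edge_dom G i)"
      unfolding differentiable_def by auto
    then show ?thesis unfolding partial_y_def by (simp only: vector_derivative_works)
  qed
  have da: "((\<lambda>b. ell i y b s) has_real_derivative partial_a ell i y a s) (at a)"
    if sy: "s \<in> {0..T}" "y \<in> edge_dom G i" for s y a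
  proof -
    obtain D where D: "((\<lambda>(y, a). ell i y a s) has_derivative D) (at (y, a) within edge_dom G i \<times> UNIV)"
      using diff[OF sy, of a] unfolding differentiable_def by blast
    have "((\<lambda>b. (y, b)) has_derivative (\<lambda>b. (0, b))) (at a within UNIV)"
      by (auto intro!: derivative_eq_intros)
    moreover have "((\<lambda>(y, a). ell i y a s) has_derivative D) (at (y, a) within (\<lambda>b. (y, b)) ` UNIV)"
      by (rule has_derivative_subset[OF D]) (use sy in auto)
    ultimately have "((\<lambda>b. (\<lambda>(y, a). ell i y a s) (y, b)) has_derivative (\<lambda>b. D (0, b))) (at a within UNIV)"
      by (rule has_derivative_in_compose)
    then have "(\<lambda>b. ell i y b s) differentiable (at a)"
      unfolding differentiable_def by auto
    then have "(\<lambda>b. ell i y b s) field_differentiable (at a)"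
      by (simp add: real_differentiable_def field_differentiable_def)
    then show ?thesis unfolding partial_a_def by (simp only: field_differentiable_derivI)
  qed
  have lip: "\<bar>ell i z a s - ell i z' a s\<bar> \<le> c * (1 + \<bar>a\<bar> powr p) * \<bar>z - z'\<bar>"
    if z: "z \<in> edge_dom G i \<inter> {0..r'}" "z' \<in> edge_dom G i \<inter> {0..r'}" and s: "s \<in> {0..T}" for z z' a s
  proof -
    have "norm (ell i z a s - ell i z' a s) \<le> (c * (1 + \<bar>a\<bar> powr p)) * norm (z - z')"
    proof (rule differentiable_bound[of "edge_dom G i \<inter> {0..r'}" "\<lambda>z. ell i z a s" "\<lambda>y h. h *\<^sub>R partial_y G ell i y a s"])
      show "convex (edge_dom G i \<inter> {0..r'})" using edge_dom_facts(2)[OF i] by (intro convex_Int) auto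
      fix y assume y: "y \<in> edge_dom G i \<inter> {0..r'}"
      show "((\<lambda>z. ell i z a s) has_derivative (\<lambda>h. h *\<^sub>R partial_y G ell i y a s)) (at y within edge_dom G i \<inter> {0..r'})"
        using dy[OF s, of y a] y unfolding has_vector_derivative_def by (auto intro: has_derivative_subset)
      show "onorm (\<lambda>h. h *\<^sub>R partial_y G ell i y a s) \<le> c * (1 + \<bar>a\<bar> powr p)"
        using c(2)[OF y s, of a] by (intro onorm_le) (simp add: abs_mult mult.commute add.commute mult_left_mono)
    qed (use z in auto)
    then show ?thesis by simp
  qed
  have "compact (edge_dom G i \<inter> {0..r'})" using edge_dom_facts(1)[OF i] by (intro closed_Int_compact) auto
  then have "compact ((\<lambda>(z, s). ell i z 0 s) ` ((edge_dom G i \<inter> {0..r'}) \<times> {0..T}))"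
  proof (intro compact_continuous_image compact_Times)
    have "continuous_on ((edge_dom G i \<inter> {0..r'}) \<times> {0..T}) (\<lambda>x. (\<lambda>(y, a, s). ell i y a s) (fst x, 0, snd x))"
      by (rule continuous_on_compose2[OF ell_cont[OF i]]) (auto intro!: continuous_intros)
    then show "continuous_on ((edge_dom G i \<inter> {0..r'}) \<times> {0..T}) (\<lambda>(z, s). ell i z 0 s)"
      by (simp add: case_prod_unfold)
  qed auto
  then have "bounded ((\<lambda>(z, s). ell i z 0 s) ` ((edge_dom G i \<inter> {0..r'}) \<times> {0..T}))"
    by (rule compact_imp_bounded)
  then obtain B where "\<And>w. w \<in> (\<lambda>(z, s). ell i z 0 s) ` ((edge_dom G i \<inter> {0..r'}) \<times> {0..T}) \<Longrightarrow> norm w \<le> B"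
    unfolding bounded_iff by meson
  then have B: "\<bar>ell i z 0 s\<bar> \<le> B" if "z \<in> edge_dom G i \<inter> {0..r'}" "s \<in> {0..T}" for z s
    using that by (metis (no_types, lifting) SigmaI case_prod_conv image_eqI real_norm_def)
  have grow: "\<bar>ell i z a s\<bar> \<le> (\<bar>B\<bar> + 2 * c) * (1 + \<bar>a\<bar> powr p)"
    if z: "z \<in> edge_dom G i \<inter> {0..r'}" and s: "s \<in> {0..T}" for z a s
  proof -
    have "norm (ell i z a s - ell i z 0 s) \<le> (c * (\<bar>a\<bar> powr (p - 1) + 1)) * norm (a - 0)"
    \<comment> \<open>The symmetric interval contains 0 and \<open>a\<close> whatever the sign of
      \<open>a\<close>, and on it |b| <= |a| makes the bound on the derivative uniform.\<close>
    proof (rule field_differentiable_bound[of "{- \<bar>a\<bar>..\<bar>a\<bar>}" "\<lambda>b. ell i z b s" "\<lambda>b. partial_a ell i z b s"])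
      fix b assume b: "b \<in> {- \<bar>a\<bar>..\<bar>a\<bar>}"
      show "((\<lambda>b. ell i z b s) has_field_derivative partial_a ell i z b s) (at b within {- \<bar>a\<bar>..\<bar>a\<bar>})"
        using da[OF s, of z b] z by (auto intro: has_field_derivative_at_within)
      have "\<bar>b\<bar> powr (p - 1) \<le> \<bar>a\<bar> powr (p - 1)" using b p by (intro powr_mono2) auto
      then have "c * (\<bar>b\<bar> powr (p - 1) + 1) \<le> c * (\<bar>a\<bar> powr (p - 1) + 1)" using c(1) by (intro mult_left_mono) auto
      then show "norm (partial_a ell i z b s) \<le> c * (\<bar>a\<bar> powr (p - 1) + 1)" using c(3)[OF z s, of b] by simp
    qed auto
    also have "\<dots> = c * (\<bar>a\<bar> powr (p - 1) * \<bar>a\<bar> + \<bar>a\<bar>)" by (simp add: algebra_simps)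
    also have "\<bar>a\<bar> powr (p - 1) * \<bar>a\<bar> = \<bar>a\<bar> powr p"
      by (cases "a = 0") (auto simp: powr_diff)
    also have "c * (\<bar>a\<bar> powr p + \<bar>a\<bar>) \<le> c * (2 * (1 + \<bar>a\<bar> powr p))"
    proof (intro mult_left_mono)
      have "w + u \<le> 2 * (1 + w)" if "u \<le> 1 + w" "0 \<le> w" for u w :: real using that by simp
      from this[OF abs_le_1_plus_powr[OF less_imp_le[OF p], of a] powr_ge_zero]
      show "\<bar>a\<bar> powr p + \<bar>a\<bar> \<le> 2 * (1 + \<bar>a\<bar> powr p)" .
    qed (use c in auto)
    also have "\<dots> = 2 * c * (1 + \<bar>a\<bar> powr p)" by (simp add: algebra_simps)
    finally have 1: "\<bar>ell i z a s - ell i z 0 s\<bar> \<le> 2 * c * (1 + \<bar>a\<bar> powr p)" unfolding real_norm_def .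
    have "\<bar>ell i z 0 s\<bar> \<le> \<bar>B\<bar> * 1" using B[OF z s] by simp
    also have "\<dots> \<le> \<bar>B\<bar> * (1 + \<bar>a\<bar> powr p)" by (intro mult_left_mono) auto
    finally have "\<bar>ell i z 0 s\<bar> \<le> \<bar>B\<bar> * (1 + \<bar>a\<bar> powr p)" .
    with 1 have "\<bar>ell i z a s\<bar> \<le> \<bar>B\<bar> * (1 + \<bar>a\<bar> powr p) + 2 * c * (1 + \<bar>a\<bar> powr p)" by linarith
    then show ?thesis by (simp add: distrib_right)
  qed
  have lip': "\<bar>ell i z a s - ell i z' a s\<bar> \<le> (\<bar>B\<bar> + 2 * c) * (1 + \<bar>a\<bar> powr p) * \<bar>z - z'\<bar>"
    if "z \<in> edge_dom G i \<inter> {0..r'}" "z' \<in> edge_dom G i \<inter> {0..r'}" "s \<in> {0..T}" for z z' a s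
  proof -
    have "c * (1 + \<bar>a\<bar> powr p) * \<bar>z - z'\<bar> \<le> (\<bar>B\<bar> + 2 * c) * (1 + \<bar>a\<bar> powr p) * \<bar>z - z'\<bar>"
      using c(1) by (intro mult_right_mono) auto
    then show ?thesis using lip[OF that, of a] by linarith
  qed
  show ?thesis
  proof (intro exI[of _ "\<bar>B\<bar> + 2 * c"] conjI ballI allI)
    show "0 \<le> \<bar>B\<bar> + 2 * c" using c(1) by simp
    fix z a s assume z: "z \<in> edge_dom G i \<inter> {0..r}" and s: "s \<in> {0..T}"
    then show "\<bar>ell i z a s\<bar> \<le> (\<bar>B\<bar> + 2 * c) * (1 + \<bar>a\<bar> powr p)"
      using r'(2) by (intro grow) auto
  next
    fix z z' a s
    assume "z \<in> edge_dom G i \<inter> {0..r}" "z' \<in> edge_dom G i \<inter> {0..r}" "s \<in> {0..T}"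
    then show "\<bar>ell i z a s - ell i z' a s\<bar> \<le> (\<bar>B\<bar> + 2 * c) * (1 + \<bar>a\<bar> powr p) * \<bar>z - z'\<bar>"
      using r'(2) by (intro lip') auto
  qed
qed

lemma integrable_ell_along:
  assumes y: "continuous_on {t..T} y" "y ` {t..T} \<subseteq> network_set G" and i: "i \<in> eidx G"
    and b: "b \<in> borel_measurable M" "integrable M (\<lambda>s. \<bar>b s\<bar> powr p)"
    and S: "S \<in> sets borel" "S \<subseteq> edge_set G i"
  shows "integrable M (\<lambda>s. indicator S (y s) * ell i (axis_coord G i (y s)) (b s) s)"
proof -
  note [measurable] = measurable_continuous_Ioo[OF y(1)] b(1) measurable_ident_lebesgue_on
  have "continuous_on {t..T} (\<lambda>s. axis_coord G i (y s))" by (intro continuous_intros y)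
  then have "bounded ((\<lambda>s. axis_coord G i (y s)) ` {t..T})"
    by (intro compact_imp_bounded compact_continuous_image) auto
  then obtain r where r: "\<And>s. s \<in> {t..T} \<Longrightarrow> \<bar>axis_coord G i (y s)\<bar> \<le> r"
    unfolding bounded_iff by (metis image_eqI real_norm_def)
  obtain c where c: "c \<ge> 0"
    "\<And>z a s. z \<in> edge_dom G i \<inter> {0..r} \<Longrightarrow> s \<in> {0..T} \<Longrightarrow> \<bar>ell i z a s\<bar> \<le> c * (1 + \<bar>a\<bar> powr p)"
    using ell_lipschitz_growth[OF i, of r] by blast
  let ?X = "edge_dom G i \<times> (UNIV :: real set) \<times> {0..T}"
  \<comment> \<open>Extended by 0 from its closed domain, the continuous cost is Borel on the whole
    space and can be composed with measurable maps.\<close>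
  define f where "f = (\<lambda>x. indicator ?X x *\<^sub>R (\<lambda>(z, a, s). ell i z a s) x)"
  have "closed ?X" by (intro closed_Times edge_dom_facts i) auto
  then have [measurable]: "f \<in> borel_measurable borel"
    unfolding f_def using ell_cont[OF i] by (intro borel_measurable_continuous_on_indicator) auto
  have [measurable]: "(\<lambda>s. axis_coord G i (y s)) \<in> borel_measurable M"
    by (rule measurable_continuous_Ioo) (intro continuous_intros y)
  have [measurable]: "(\<lambda>s. indicator S (y s) :: real) \<in> borel_measurable M"
    by (rule measurable_compose[OF measurable_continuous_Ioo[OF y(1)] borel_measurable_indicator[OF S(1)]])
  have in_X: "(axis_coord G i (y s), b s, s) \<in> ?X" "axis_coord G i (y s) \<in> edge_dom G i \<inter> {0..r}"
    if "s \<in> {t<..<T}" "y s \<in> S" for s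
  proof -
    have *: "axis_coord G i (y s) \<in> edge_dom G i" using that S(2) edge_set_iff[OF i] by blast
    then show "(axis_coord G i (y s), b s, s) \<in> ?X" using that t by auto
    show "axis_coord G i (y s) \<in> edge_dom G i \<inter> {0..r}"
      using * edge_dom_facts(4)[OF i] r[of s] that(1) by auto
  qed
  show ?thesis
  proof (rule Bochner_Integration.integrable_bound)
    show "integrable M (\<lambda>s. c * (1 + \<bar>b s\<bar> powr p))"
      using b(2) by (intro integrable_mult_right Bochner_Integration.integrable_add) auto
    have "(\<lambda>s. indicator S (y s) * f (axis_coord G i (y s), b s, s)) \<in> borel_measurable M" by measurable
    moreover have "indicator S (y s) * f (axis_coord G i (y s), b s, s) = indicator S (y s) * ell i (axis_coord G i (y s)) (b s) s"
      if "s \<in> space M" for s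
    proof (cases "y s \<in> S")
      case True
      then show ?thesis using in_X(1)[of s] that by (simp add: f_def)
    qed simp
    ultimately show "(\<lambda>s. indicator S (y s) * ell i (axis_coord G i (y s)) (b s) s) \<in> borel_measurable M"
      by (subst measurable_cong) (auto simp only:)
    show "AE s in M. norm (indicator S (y s) * ell i (axis_coord G i (y s)) (b s) s) \<le> norm (c * (1 + \<bar>b s\<bar> powr p))"
    proof (rule AE_I2)
      fix s assume "s \<in> space M"
      then have s: "s \<in> {t<..<T}" "s \<in> {0..T}" using t by auto
      show "norm (indicator S (y s) * ell i (axis_coord G i (y s)) (b s) s) \<le> norm (c * (1 + \<bar>b s\<bar> powr p))"
        using c(2)[OF in_X(2)[OF s(1)] s(2), of "b s"] c(1) by (auto simp: indicator_def)
    qed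
  qed
qed

lemma running_cost_edge_speed:
  assumes "y s \<in> network_set G"
  shows "L (y s) (v s) s =
    (\<Sum>i\<in>eidx G. indicator (edge_interior G i) (y s) * ell i (axis_coord G i (y s)) (edge_speed y v i s) s) +
    (\<Sum>j\<in>vidx G. vertex_running_cost G ell ellv j s * indicator {vertex G j} (y s))"
proof -
  have "(\<Sum>i\<in>eidx G. ell i (edge_coord G i (y s)) (v s \<bullet> edge_dir G i) s * indicator (edge_interior G i) (y s)) =
    (\<Sum>i\<in>eidx G. indicator (edge_interior G i) (y s) * ell i (axis_coord G i (y s)) (edge_speed y v i s) s)"
    by (intro sum.cong refl) (auto simp: indicator_def edge_speed_def edge_coord_eq)
  then show ?thesis by (simp add: running_cost_def)
qed

lemma borel_edge_sets:
  assumes "i \<in> eidx G"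
  shows "edge_set G i \<in> sets borel" "edge_interior G i \<in> sets borel"
  using borel_closed[OF closed_edge_set[OF assms]] borel_closed[OF finite_imp_closed[OF finite_vertices]]
  by (simp_all add: sets.Diff)

lemma integrable_running_cost:
  assumes y: "continuous_on {t..T} y" "y ` {t..T} \<subseteq> network_set G"
    and a: "\<And>i. i \<in> eidx G \<Longrightarrow> edge_speed y v i \<in> borel_measurable M"
      "\<And>i. i \<in> eidx G \<Longrightarrow> integrable M (\<lambda>s. \<bar>edge_speed y v i s\<bar> powr p)"
  shows "integrable M (\<lambda>s. L (y s) (v s) s)"
proof -
  have 1: "integrable M (\<lambda>s. vertex_running_cost G ell ellv j s * indicator {vertex G j} (y s))" if j: "j \<in> vidx G" for j
  proof -
    have c: "continuous_on {t..T} (vertex_running_cost G ell ellv j)"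
      by (rule continuous_on_subset[OF vertex_running_cost_continuous[OF j]]) (use t in auto)
    then have "integrable M (\<lambda>s. vertex_running_cost G ell ellv j s \<bullet> 1)"
      by (intro integrable_bounded_inner) auto
    then have "integrable M (\<lambda>s. indicator (y -` {vertex G j}) s *\<^sub>R vertex_running_cost G ell ellv j s)"
    proof (intro integrable_indicator_scaleR)
      have "(\<lambda>s. indicator {vertex G j} (y s) :: real) \<in> borel_measurable M"
        by (rule measurable_compose[OF measurable_continuous_Ioo[OF y(1)] borel_measurable_indicator]) auto
      then show "(indicator (y -` {vertex G j}) :: real \<Rightarrow> real) \<in> borel_measurable M"
        by (simp add: indicator_def[abs_def])
    qed simp
    then show ?thesis by (simp add: indicator_def mult.commute cong: if_cong)
  qed
  have "integrable M (\<lambda>s. (\<Sum>i\<in>eidx G. indicator (edge_interior G i) (y s) * ell i (axis_coord G i (y s)) (edge_speed y v i s) s) +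
    (\<Sum>j\<in>vidx G. vertex_running_cost G ell ellv j s * indicator {vertex G j} (y s)))"
    using a 1 y borel_edge_sets(2)
    by (intro Bochner_Integration.integrable_add Bochner_Integration.integrable_sum integrable_ell_along) auto
  moreover have "y s \<in> network_set G" if "s \<in> space M" for s using y(2) that by auto
  ultimately show ?thesis
    by (subst Bochner_Integration.integrable_cong[OF refl running_cost_edge_speed]) auto
qed

lemma trajectoryD:
  assumes "y \<in> trajectories G p T t x"
  shows "continuous_on {t..T} y" "y ` {t..T} \<subseteq> network_set G" "y t = x"
    "in_Lp p t T (weak_deriv p t T y)" "has_weak_deriv t T y (weak_deriv p t T y)"
    "integrable M (weak_deriv p t T y)" "has_ac_deriv t T y (weak_deriv p t T y)"
proof -
  show c: "continuous_on {t..T} y" and "y ` {t..T} \<subseteq> network_set G" "y t = x"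
    using assms by (auto simp: trajectories_def)
  have "\<exists>v. in_Lp p t T v \<and> has_weak_deriv t T y v"
    using assms by (auto simp: trajectories_def W1p_def)
  then have *: "in_Lp p t T (weak_deriv p t T y) \<and> has_weak_deriv t T y (weak_deriv p t T y)"
    unfolding weak_deriv_def by (rule someI_ex)
  then show "in_Lp p t T (weak_deriv p t T y)" "has_weak_deriv t T y (weak_deriv p t T y)" by auto
  show i: "integrable M (weak_deriv p t T y)" using * p by (intro in_Lp_integrable) auto
  show "has_ac_deriv t T y (weak_deriv p t T y)" using c i * by (intro weak_deriv_has_ac_deriv) auto
qed

lemma edge_speed_Lp:
  assumes y: "continuous_on {t..T} y" and v: "in_Lp p t T v" and i: "i \<in> eidx G"
  shows "edge_speed y v i \<in> borel_measurable M" "integrable M (\<lambda>s. \<bar>edge_speed y v i s\<bar> powr p)"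
proof -
  have vi: "integrable M v" using v p by (intro in_Lp_integrable) auto
  have int: "integrable M (edge_speed y v i)" by (rule integrable_edge_speed[OF y vi i])
  then show [measurable]: "edge_speed y v i \<in> borel_measurable M" by auto
  show "integrable M (\<lambda>s. \<bar>edge_speed y v i s\<bar> powr p)"
  proof (rule Bochner_Integration.integrable_bound)
    show "integrable M (\<lambda>s. norm (v s) powr p)" using v by (simp add: in_Lp_def)
    show "AE s in M. norm (\<bar>edge_speed y v i s\<bar> powr p) \<le> norm (norm (v s) powr p)"
    proof (rule AE_I2)
      fix s
      have "\<bar>edge_speed y v i s\<bar> \<le> norm (v s)"
        using Cauchy_Schwarz_ineq2[of "v s" "edge_dir G i"] norm_edge_dir[OF i]
        by (simp add: edge_speed_def indicator_def)
      then show "norm (\<bar>edge_speed y v i s\<bar> powr p) \<le> norm (norm (v s) powr p)"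
        using p by (simp add: powr_mono2)
    qed
  qed measurable
qed

text \<open>The position is frozen and the speeds \<open>a\<close> on the edges are decoupled. This cost is convex in \<open>a\<close>, and at a
  vertex it bounds from below the running cost along any edge that issues from it.\<close>

definition relaxed_cost :: "(real \<Rightarrow> 'a) \<Rightarrow> (nat \<Rightarrow> real \<Rightarrow> real) \<Rightarrow> real \<Rightarrow> real" where
  "relaxed_cost y a s = L (y s) 0 s + (\<Sum>i\<in>eidx G. indicator (edge_set G i) (y s) *
     (ell i (axis_coord G i (y s)) (a i s) s - ell i (axis_coord G i (y s)) 0 s))"

text \<open>At a vertex all speeds are 0 and no excess remains. In the interior of an edge a single
  excess remains, and the two costs at rest cancel.\<close>

lemma relaxed_cost_eq:
  assumes "y s \<in> network_set G"
  shows "relaxed_cost y (edge_speed y v) s = L (y s) (v s) s"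
  using assms
proof (cases rule: network_set_cases)
  case 1
  then obtain j where j: "j \<in> vidx G" "y s = vertex G j" by (rule vertices_vertex)
  have "edge_speed y v i s = 0" for i using 1 by (simp add: edge_speed_def)
  then have "relaxed_cost y (edge_speed y v) s = L (y s) 0 s" by (simp add: relaxed_cost_def)
  then show ?thesis using running_cost_vertex[OF j(1)] j(2) by simp
next
  case (2 i)
  let ?u = "axis_coord G i (y s)"
  have "indicator (edge_set G k) (y s) = (indicator (edge_interior G k) (y s) :: real)" for k
    using 2(2) by (simp add: indicator_def)
  then have "(\<Sum>k\<in>eidx G. indicator (edge_set G k) (y s) *
     (ell k (axis_coord G k (y s)) (edge_speed y v k s) s - ell k (axis_coord G k (y s)) 0 s)) =
     ell i ?u (edge_speed y v i s) s - ell i ?u 0 s"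
    using sum_edge_interior[OF 2, of "\<lambda>k. ell k (axis_coord G k (y s)) (edge_speed y v k s) s - ell k (axis_coord G k (y s)) 0 s"]
    by (simp add: mult.commute)
  then show ?thesis
    using running_cost_interior[OF 2, of 0 s] running_cost_interior[OF 2, of "v s" s] 2(2)
    by (simp add: relaxed_cost_def edge_speed_def)
qed

text \<open>The cost at rest does not depend on the speeds, and each excess is convex in its own
  speed.\<close>

lemma relaxed_cost_midpoint:
  assumes s: "s \<in> {0..T}"
  shows "relaxed_cost y (\<lambda>i s. (a i s + b i s) / 2) s \<le> (relaxed_cost y a s + relaxed_cost y b s) / 2"
proof -
  define D where "D a i = indicator (edge_set G i) (y s) *
     (ell i (axis_coord G i (y s)) (a i s) s - ell i (axis_coord G i (y s)) 0 s)" for a :: "nat \<Rightarrow> real \<Rightarrow> real" and i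
  have "D (\<lambda>i s. (a i s + b i s) / 2) i \<le> (D a i + D b i) / 2" if i: "i \<in> eidx G" for i
  proof (cases "y s \<in> edge_set G i")
    case True
    then have z: "axis_coord G i (y s) \<in> edge_dom G i" using edge_set_iff[OF i] by blast
    have "ell i (axis_coord G i (y s)) ((a i s + b i s) / 2) s \<le>
        (ell i (axis_coord G i (y s)) (a i s) s + ell i (axis_coord G i (y s)) (b i s) s) / 2"
    \<comment> \<open>Strict convexity speaks of distinct points only.\<close>
    proof (cases "a i s = b i s")
      case False
      have "(1 - 1 / 2) * a i s + 1 / 2 * b i s = (a i s + b i s) / 2" by (simp add: add_divide_distrib)
      moreover have "ell i (axis_coord G i (y s)) ((1 - 1 / 2) * a i s + 1 / 2 * b i s) s <
          (1 - 1 / 2) * ell i (axis_coord G i (y s)) (a i s) s + 1 / 2 * ell i (axis_coord G i (y s)) (b i s) s"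
        by (rule H4[OF i z s, unfolded strictly_convex_def, rule_format]) (use False in auto)
      moreover have "m \<le> (m1 + m2) / 2" if "m < (1 - 1 / 2) * m1 + 1 / 2 * m2" for m m1 m2 :: real
        using that by simp
      ultimately show ?thesis by metis
    qed simp
    moreover have "m - k \<le> ((m1 - k) + (m2 - k)) / 2" if "m \<le> (m1 + m2) / 2" for m k m1 m2 :: real
      using that by (simp add: field_simps)
    ultimately show ?thesis using True by (simp add: D_def)
  qed (simp add: D_def)
  then have "(\<Sum>i\<in>eidx G. D (\<lambda>i s. (a i s + b i s) / 2) i) \<le> (\<Sum>i\<in>eidx G. (D a i + D b i) / 2)"
    by (rule sum_mono)
  also have "\<dots> = ((\<Sum>i\<in>eidx G. D a i) + (\<Sum>i\<in>eidx G. D b i)) / 2"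
    by (simp only: sum.distrib sum_divide_distrib[symmetric])
  finally have "k + (\<Sum>i\<in>eidx G. D (\<lambda>i s. (a i s + b i s) / 2) i) \<le>
      ((k + (\<Sum>i\<in>eidx G. D a i)) + (k + (\<Sum>i\<in>eidx G. D b i))) / 2" for k by (simp add: field_simps)
  then show ?thesis unfolding relaxed_cost_def D_def .
qed

lemma integrable_relaxed_cost:
  assumes y: "continuous_on {t..T} y" "y ` {t..T} \<subseteq> network_set G"
    and a: "\<And>i. i \<in> eidx G \<Longrightarrow> a i \<in> borel_measurable M"
      "\<And>i. i \<in> eidx G \<Longrightarrow> integrable M (\<lambda>s. \<bar>a i s\<bar> powr p)"
  shows "integrable M (relaxed_cost y a)"
proof -
  have "edge_speed y (\<lambda>_. 0) i = (\<lambda>_. 0)" for i by (simp add: edge_speed_def fun_eq_iff)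
  then have 1: "integrable M (\<lambda>s. L (y s) 0 s)"
    using p by (intro integrable_running_cost y) auto
  have 2: "integrable M (\<lambda>s. indicator (edge_set G i) (y s) *
     (ell i (axis_coord G i (y s)) (a i s) s - ell i (axis_coord G i (y s)) 0 s))" if i: "i \<in> eidx G" for i
  proof -
    have "integrable M (\<lambda>s. indicator (edge_set G i) (y s) * ell i (axis_coord G i (y s)) (a i s) s)"
      by (intro integrable_ell_along[OF y i a(1)[OF i] a(2)[OF i]] borel_edge_sets i) simp
    moreover have "integrable M (\<lambda>s. indicator (edge_set G i) (y s) * ell i (axis_coord G i (y s)) 0 s)"
      using p by (intro integrable_ell_along[OF y i, of "\<lambda>_. 0"] borel_edge_sets i) auto
    ultimately show ?thesis by (simp add: right_diff_distrib)
  qed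
  show ?thesis unfolding relaxed_cost_def[abs_def]
    using 1 2 by (intro Bochner_Integration.integrable_add Bochner_Integration.integrable_sum) auto
qed

text \<open>One radius serves all points within distance 1 of the curve, so that the local bounds on
  the costs hold uniformly along a uniformly convergent sequence.\<close>

lemma axis_coord_range:
  assumes y: "continuous_on {t..T} y" and i: "i \<in> eidx G"
  obtains r where "r > 0" "\<And>s x'. s \<in> {t..T} \<Longrightarrow> norm (x' - y s) \<le> 1 \<Longrightarrow> x' \<in> edge_set G i \<Longrightarrow> axis_coord G i x' \<in> edge_dom G i \<inter> {0..r}"
proof -
  have "continuous_on {t..T} (\<lambda>s. axis_coord G i (y s))" by (intro continuous_intros y)
  then obtain B where B: "B > 0" "\<And>s. s \<in> {t..T} \<Longrightarrow> norm (axis_coord G i (y s)) \<le> B"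
    by (rule bounded_on_Icc) blast
  have "axis_coord G i x' \<in> edge_dom G i \<inter> {0..B + 1}"
    if "s \<in> {t..T}" "norm (x' - y s) \<le> 1" "x' \<in> edge_set G i" for s x'
  proof -
    have z: "axis_coord G i x' \<in> edge_dom G i" using that edge_set_iff[OF i] by blast
    moreover have "axis_coord G i x' \<le> B + 1"
      using abs_axis_coord_diff_le[OF i, of x' "y s"] that(2) B(2)[OF that(1)] by (simp add: abs_le_iff)
    ultimately show ?thesis using edge_dom_facts(4)[OF i] by auto
  qed
  then show ?thesis using that[of "B + 1"] B(1) by auto
qed

text \<open>The bound is uniform in the speeds: coercivity bounds the cost of each edge from below,
  and the subtracted cost at rest is bounded along the curve. A shift by a constant then admits
  Fatou's lemma.\<close>

lemma relaxed_cost_bounded_below: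
  assumes y: "continuous_on {t..T} y" "y ` {t..T} \<subseteq> network_set G"
  shows "\<exists>C\<ge>0. \<forall>s\<in>{t..T}. \<forall>a. - C \<le> relaxed_cost y a s"
proof -
  obtain c0 C0 where c0: "c0 > 0" "C0 \<ge> 0" "\<And>x w s. x \<in> network_set G \<Longrightarrow> s \<in> {0..T} \<Longrightarrow>
     c0 * (\<Sum>i\<in>eidx G. \<bar>indicator (edge_interior G i) x * (w \<bullet> edge_dir G i)\<bar> powr p) - C0 \<le> L x w s"
    using running_cost_coercive by blast
  have L_ge: "- C0 \<le> L x w s" if "x \<in> network_set G" "s \<in> {0..T}" for x w s
  proof -
    have "0 \<le> c0 * (\<Sum>i\<in>eidx G. \<bar>indicator (edge_interior G i) x * (w \<bullet> edge_dir G i)\<bar> powr p)"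
      using c0(1) by (intro mult_nonneg_nonneg sum_nonneg) auto
    then show ?thesis using c0(3)[OF that, of w] by linarith
  qed
  obtain c1 C1 where c1: "c1 > 0" "C1 \<ge> 0"
    "\<And>i z a s. i \<in> eidx G \<Longrightarrow> z \<in> edge_dom G i \<Longrightarrow> s \<in> {0..T} \<Longrightarrow> c1 * \<bar>a\<bar> powr p - C1 \<le> ell i z a s"
    using ell_coercive by blast
  have "\<exists>k\<ge>0. \<forall>s\<in>{t..T}. \<forall>a. - k \<le> indicator (edge_set G i) (y s) *
      (ell i (axis_coord G i (y s)) a s - ell i (axis_coord G i (y s)) 0 s)" if i: "i \<in> eidx G" for i
  proof -
    obtain r where r: "\<And>s x'. s \<in> {t..T} \<Longrightarrow> norm (x' - y s) \<le> 1 \<Longrightarrow> x' \<in> edge_set G i \<Longrightarrow> axis_coord G i x' \<in> edge_dom G i \<inter> {0..r}"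
      using axis_coord_range[OF y(1) i] by metis
    obtain c where c: "c \<ge> 0"
      "\<And>z a s. z \<in> edge_dom G i \<inter> {0..r} \<Longrightarrow> s \<in> {0..T} \<Longrightarrow> \<bar>ell i z a s\<bar> \<le> c * (1 + \<bar>a\<bar> powr p)"
      using ell_lipschitz_growth[OF i, of r] by blast
    have "- (C1 + c) \<le> indicator (edge_set G i) (y s) *
      (ell i (axis_coord G i (y s)) a s - ell i (axis_coord G i (y s)) 0 s)" if s: "s \<in> {t..T}" for s a
    proof (cases "y s \<in> edge_set G i")
      case True
      have sT: "s \<in> {0..T}" using s t by auto
      have z: "axis_coord G i (y s) \<in> edge_dom G i \<inter> {0..r}" using r[OF s, of "y s"] True by simp
      then have "c1 * \<bar>a\<bar> powr p - C1 \<le> ell i (axis_coord G i (y s)) a s" using c1(3)[OF i _ sT] by blast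
      moreover have "0 \<le> c1 * \<bar>a\<bar> powr p" using c1(1) by simp
      moreover have "ell i (axis_coord G i (y s)) 0 s \<le> c" using c(2)[OF z sT, of 0] p by simp
      ultimately show ?thesis using True by simp
    qed (use c1 c in simp)
    then show ?thesis using c1(2) c(1) by (intro exI[of _ "C1 + c"]) auto
  qed
  then obtain k where k: "\<And>i. i \<in> eidx G \<Longrightarrow> 0 \<le> k i"
    "\<And>i s a. i \<in> eidx G \<Longrightarrow> s \<in> {t..T} \<Longrightarrow> - k i \<le> indicator (edge_set G i) (y s) *
      (ell i (axis_coord G i (y s)) a s - ell i (axis_coord G i (y s)) 0 s)" by metis
  have "- (C0 + (\<Sum>i\<in>eidx G. k i)) \<le> relaxed_cost y a s" if s: "s \<in> {t..T}" for s a
  proof -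
    have "(\<Sum>i\<in>eidx G. - k i) \<le> (\<Sum>i\<in>eidx G. indicator (edge_set G i) (y s) *
      (ell i (axis_coord G i (y s)) (a i s) s - ell i (axis_coord G i (y s)) 0 s))"
      by (rule sum_mono) (rule k(2)[OF _ s])
    moreover have "- C0 \<le> L (y s) 0 s" using s t y(2) by (intro L_ge) auto
    ultimately show ?thesis unfolding relaxed_cost_def by (simp add: sum_negf)
  qed
  moreover have "0 \<le> C0 + (\<Sum>i\<in>eidx G. k i)" using c0(2) k(1) by (intro add_nonneg_nonneg sum_nonneg) auto
  ultimately show ?thesis by blast
qed

lemma tendsto_relaxed_cost:
  assumes s: "s \<in> {0..T}" and a: "\<And>i. i \<in> eidx G \<Longrightarrow> (\<lambda>n. a n i s) \<longlonglongrightarrow> \<alpha> i s"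
  shows "(\<lambda>n. relaxed_cost y (a n) s) \<longlonglongrightarrow> relaxed_cost y \<alpha> s"
proof -
  have "(\<lambda>n. indicator (edge_set G i) (y s) * (ell i (axis_coord G i (y s)) (a n i s) s - ell i (axis_coord G i (y s)) 0 s))
    \<longlonglongrightarrow> indicator (edge_set G i) (y s) * (ell i (axis_coord G i (y s)) (\<alpha> i s) s - ell i (axis_coord G i (y s)) 0 s)"
    if i: "i \<in> eidx G" for i
  proof (cases "y s \<in> edge_set G i")
    case True
    then have z: "axis_coord G i (y s) \<in> edge_dom G i" using edge_set_iff[OF i] by blast
    have "continuous_on UNIV (\<lambda>b. (\<lambda>(y, a, s). ell i y a s) (axis_coord G i (y s), b, s))"
      by (rule continuous_on_compose2[OF ell_cont[OF i]]) (use z s in \<open>auto intro!: continuous_intros\<close>)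
    then have "continuous_on UNIV (\<lambda>b. ell i (axis_coord G i (y s)) b s)" by simp
    then have "(\<lambda>n. ell i (axis_coord G i (y s)) (a n i s) s) \<longlonglongrightarrow> ell i (axis_coord G i (y s)) (\<alpha> i s) s"
      by (rule continuous_on_tendsto_compose[OF _ a[OF i]]) auto
    then show ?thesis by (intro tendsto_intros)
  qed simp
  then show ?thesis unfolding relaxed_cost_def
    by (rule tendsto_add[OF tendsto_const tendsto_sum])
qed

lemma relaxed_cost_compare:
  assumes y: "continuous_on {t..T} y" "y ` {t..T} \<subseteq> network_set G"
  shows "\<exists>c\<ge>0. \<forall>s\<in>{t..T}. \<forall>x'\<in>network_set G. \<forall>w a. star (y s) x' \<longrightarrow> norm (x' - y s) \<le> 1 \<longrightarrow>
    (\<forall>i\<in>eidx G. a i s = indicator (edge_interior G i) x' * (w \<bullet> edge_dir G i)) \<longrightarrow>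
    relaxed_cost y a s \<le> L x' w s + c * norm (x' - y s) * (1 + (\<Sum>i\<in>eidx G. \<bar>a i s\<bar> powr p))"
proof -
  have "\<exists>k\<ge>0. \<forall>s\<in>{t..T}. \<forall>x'. \<forall>b. x' \<in> edge_set G i \<longrightarrow> y s \<in> edge_set G i \<longrightarrow> norm (x' - y s) \<le> 1 \<longrightarrow>
    \<bar>ell i (axis_coord G i (y s)) b s - ell i (axis_coord G i x') b s\<bar> \<le> k * norm (x' - y s) * (1 + \<bar>b\<bar> powr p)"
    if i: "i \<in> eidx G" for i
  proof -
    obtain r where r: "\<And>s x'. s \<in> {t..T} \<Longrightarrow> norm (x' - y s) \<le> 1 \<Longrightarrow> x' \<in> edge_set G i \<Longrightarrow> axis_coord G i x' \<in> edge_dom G i \<inter> {0..r}"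
      using axis_coord_range[OF y(1) i] by metis
    obtain c where c: "c \<ge> 0"
      "\<And>z z' a s. z \<in> edge_dom G i \<inter> {0..r} \<Longrightarrow> z' \<in> edge_dom G i \<inter> {0..r} \<Longrightarrow> s \<in> {0..T} \<Longrightarrow>
        \<bar>ell i z a s - ell i z' a s\<bar> \<le> c * (1 + \<bar>a\<bar> powr p) * \<bar>z - z'\<bar>"
      using ell_lipschitz_growth[OF i, of r] by blast
    have "\<bar>ell i (axis_coord G i (y s)) b s - ell i (axis_coord G i x') b s\<bar> \<le> c * norm (x' - y s) * (1 + \<bar>b\<bar> powr p)"
      if s: "s \<in> {t..T}" and x': "x' \<in> edge_set G i" "y s \<in> edge_set G i" "norm (x' - y s) \<le> 1" for s x' b
    proof -
      have "\<bar>ell i (axis_coord G i (y s)) b s - ell i (axis_coord G i x') b s\<bar> \<le>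
          c * (1 + \<bar>b\<bar> powr p) * \<bar>axis_coord G i (y s) - axis_coord G i x'\<bar>"
        using r[OF s, of "y s"] r[OF s, of x'] x' s t by (intro c(2)) auto
      also have "\<dots> \<le> c * (1 + \<bar>b\<bar> powr p) * norm (x' - y s)"
        using abs_axis_coord_diff_le[OF i, of "y s" x'] c(1) by (intro mult_left_mono) (auto simp: norm_minus_commute)
      finally show ?thesis by (simp add: mult_ac)
    qed
    then show ?thesis using c(1) by blast
  qed
  then obtain k where k: "\<And>i. i \<in> eidx G \<Longrightarrow> 0 \<le> k i"
    "\<And>i s x' b. i \<in> eidx G \<Longrightarrow> s \<in> {t..T} \<Longrightarrow> x' \<in> edge_set G i \<Longrightarrow> y s \<in> edge_set G i \<Longrightarrow> norm (x' - y s) \<le> 1 \<Longrightarrow>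
    \<bar>ell i (axis_coord G i (y s)) b s - ell i (axis_coord G i x') b s\<bar> \<le> k i * norm (x' - y s) * (1 + \<bar>b\<bar> powr p)"
    by metis
  define c where "c = (\<Sum>i\<in>eidx G. k i)"
  have c0: "0 \<le> c" unfolding c_def using k(1) by (rule sum_nonneg)
  have kc: "k i \<le> c" if "i \<in> eidx G" for i unfolding c_def using that k(1) by (intro member_le_sum) auto
  have "relaxed_cost y a s \<le> L x' w s + c * norm (x' - y s) * (1 + (\<Sum>i\<in>eidx G. \<bar>a i s\<bar> powr p))"
    if s: "s \<in> {t..T}" and x': "x' \<in> network_set G" and st: "star (y s) x'" and n1: "norm (x' - y s) \<le> 1"
      and a: "\<And>i. i \<in> eidx G \<Longrightarrow> a i s = indicator (edge_interior G i) x' * (w \<bullet> edge_dir G i)" for s x' w a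
    using x'
  proof (cases rule: network_set_cases)
    case 1
    then have eq: "y s = x'" using st by (simp add: star_def)
    obtain j where j: "j \<in> vidx G" "x' = vertex G j" using 1 by (rule vertices_vertex)
    have "(\<Sum>i\<in>eidx G. indicator (edge_set G i) (y s) *
       (ell i (axis_coord G i (y s)) (a i s) s - ell i (axis_coord G i (y s)) 0 s)) = 0"
    proof (rule sum.neutral, rule ballI)
      fix i assume "i \<in> eidx G"
      from a[OF this] have "a i s = 0" using 1 by simp
      then show "indicator (edge_set G i) (y s) *
       (ell i (axis_coord G i (y s)) (a i s) s - ell i (axis_coord G i (y s)) 0 s) = 0" by simp
    qed
    then have "relaxed_cost y a s = L x' 0 s" unfolding relaxed_cost_def using eq by simp
    also have "\<dots> = L x' w s" using running_cost_vertex[OF j(1)] j(2) by simp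
    finally show ?thesis using eq by simp
  next
    case (2 i)
    have yi: "y s \<in> edge_set G i" using st 2 by (auto simp: star_def)
    have a0: "a k s = 0" if "k \<in> eidx G" "k \<noteq> i" for k
    proof -
      have "x' \<notin> edge_set G k" using edge_interior_unique[OF 2(1) that(1) 2(2)] that(2) by blast
      then show ?thesis using a[OF that(1)] by simp
    qed
    have ai: "a i s = w \<bullet> edge_dir G i" using a[OF 2(1)] 2(2) by simp
    have "(\<Sum>k\<in>eidx G. indicator (edge_set G k) (y s) *
       (ell k (axis_coord G k (y s)) (a k s) s - ell k (axis_coord G k (y s)) 0 s)) =
       (\<Sum>k\<in>eidx G. if k = i then ell i (axis_coord G i (y s)) (a i s) s - ell i (axis_coord G i (y s)) 0 s else 0)"
      by (rule sum.cong) (use a0 yi in auto)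
    then have "relaxed_cost y a s = L (y s) 0 s + (ell i (axis_coord G i (y s)) (a i s) s - ell i (axis_coord G i (y s)) 0 s)"
      using 2(1) by (simp add: relaxed_cost_def)
    \<comment> \<open>Equality holds unless \<open>y s\<close> is a vertex, where the minimum in the
      vertex cost may be strictly smaller.\<close>
    also have "\<dots> \<le> ell i (axis_coord G i (y s)) (a i s) s"
      using running_cost_zero_le[OF 2(1) yi, of s] by simp
    also have "\<dots> \<le> ell i (axis_coord G i x') (a i s) s + k i * norm (x' - y s) * (1 + \<bar>a i s\<bar> powr p)"
      using k(2)[OF 2(1) s _ yi n1, of "a i s"] 2(2) by (simp add: abs_le_iff)
    also have "ell i (axis_coord G i x') (a i s) s = L x' w s" using running_cost_interior[OF 2] ai by simp
    also have "k i * norm (x' - y s) * (1 + \<bar>a i s\<bar> powr p) \<le> c * norm (x' - y s) * (1 + (\<Sum>i\<in>eidx G. \<bar>a i s\<bar> powr p))"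
    proof (intro mult_mono kc 2 add_left_mono)
      show "\<bar>a i s\<bar> powr p \<le> (\<Sum>i\<in>eidx G. \<bar>a i s\<bar> powr p)" using 2(1) by (intro member_le_sum) auto
    qed (use c0 in auto)
    finally show ?thesis by simp
  qed
  with c0 show ?thesis by blast
qed

end

section \<open>Lower semicontinuity\<close>

locale trajectory_limit = control_problem G T p t ell ellv g gv
  for G :: "'a::euclidean_space network" and T p t ell ellv g gv +
  fixes Y :: "nat \<Rightarrow> real \<Rightarrow> 'a" and y :: "real \<Rightarrow> 'a" and x :: 'a and B :: real
  assumes Y: "\<And>n. Y n \<in> trajectories G p T t x"
    and bound: "\<And>n i. i \<in> eidx G \<Longrightarrow>
      (LINT s|M. \<bar>edge_speed (Y n) (weak_deriv p t T (Y n)) i s\<bar> powr p) \<le> B"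
    and y_cont: "continuous_on {t..T} y"
    and unif: "\<And>e. e > 0 \<Longrightarrow> \<exists>N. \<forall>n\<ge>N. \<forall>s\<in>{t..T}. norm (Y n s - y s) < e"
begin

abbreviation "V n \<equiv> weak_deriv p t T (Y n)"
abbreviation "f n i \<equiv> edge_speed (Y n) (V n) i"

lemmas YD = trajectoryD[OF Y]

section \<open>Passage to the limit in integrals along the sequence\<close>

lemma tendsto_Y: assumes "s \<in> {t..T}" shows "(\<lambda>n. Y n s) \<longlonglongrightarrow> y s"
proof (rule LIMSEQ_I)
  fix e :: real assume "e > 0"
  from unif[OF this] assms show "\<exists>no. \<forall>n\<ge>no. norm (Y n s - y s) < e" by blast
qed

lemma y_network: "y ` {t..T} \<subseteq> network_set G"
proof (rule image_subsetI)
  fix s assume s: "s \<in> {t..T}"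
  show "y s \<in> network_set G"
    by (rule closed_sequentially[OF closed_network_set _ tendsto_Y[OF s]]) (use YD(2) s in blast)
qed

lemma f_Lp:
  assumes "i \<in> eidx G"
  shows "f n i \<in> borel_measurable M" "integrable M (\<lambda>s. \<bar>f n i s\<bar> powr p)" "integrable M (f n i)"
  using edge_speed_Lp[OF YD(1,4) assms] integrable_edge_speed[OF YD(1,6) assms] by auto

lemma B_nonneg: assumes "i \<in> eidx G" shows "0 \<le> B"
proof -
  have "0 \<le> (LINT s|M. \<bar>f 0 i s\<bar> powr p)" by (intro integral_nonneg_AE AE_I2) simp
  then show ?thesis using bound[OF assms, of 0] by linarith
qed

lemma f_L1_bound:
  assumes i: "i \<in> eidx G"
  shows "(LINT s|M. \<bar>f n i s\<bar>) \<le> measure M (space M) + B"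
proof -
  interpret finite_measure M by (rule finite_measure_M)
  have "(LINT s|M. \<bar>f n i s\<bar>) \<le> (LINT s|M. 1 + \<bar>f n i s\<bar> powr p)"
  proof (rule integral_mono)
    show "\<bar>f n i s\<bar> \<le> 1 + \<bar>f n i s\<bar> powr p" for s
      by (rule abs_le_1_plus_powr[OF less_imp_le[OF p]])
  qed (use f_Lp[OF i] in auto)
  also have "\<dots> = measure M (space M) + (LINT s|M. \<bar>f n i s\<bar> powr p)" using f_Lp[OF i] by simp
  finally show ?thesis using bound[OF i, of n] by linarith
qed

lemma tendsto_integral_scaleR_Y:
  assumes c: "continuous_on {t..T} c"
  shows "(\<lambda>n. LINT s|M. c s *\<^sub>R Y n s) \<longlonglongrightarrow> (LINT s|M. c s *\<^sub>R y s)"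
proof (rule LIMSEQ_I)
  fix e :: real assume e: "e > 0"
  obtain K where K: "K > 0" "\<And>s. s \<in> {t..T} \<Longrightarrow> norm (c s) \<le> K" by (rule bounded_on_Icc[OF c]) blast
  define \<mu> where "\<mu> = measure M (space M)"
  have \<mu>: "0 \<le> \<mu>" by (simp add: \<mu>_def)
  define d where "d = e / (K * (\<mu> + 1))"
  have "K * d = e / (\<mu> + 1)" using K(1) by (simp add: d_def)
  then have "K * d * \<mu> = e / (\<mu> + 1) * \<mu>" by simp
  also have "\<dots> < e" using e \<mu> by (simp add: field_simps)
  finally have d: "K * d * \<mu> < e" .
  have d0: "d > 0" unfolding d_def using e K(1) \<mu> by (intro divide_pos_pos mult_pos_pos) auto
  obtain N where N: "\<And>n s. n \<ge> N \<Longrightarrow> s \<in> {t..T} \<Longrightarrow> norm (Y n s - y s) < d" using unif[OF d0] by blast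
  have "norm ((LINT s|M. c s *\<^sub>R Y n s) - (LINT s|M. c s *\<^sub>R y s)) < e" if n: "n \<ge> N" for n
  proof -
    interpret finite_measure M by (rule finite_measure_M)
    have i1: "integrable M (\<lambda>s. c s *\<^sub>R Y n s)" and i2: "integrable M (\<lambda>s. c s *\<^sub>R y s)"
      using c YD(1) y_cont by (auto intro!: integrable_continuous_Ioo continuous_intros)
    have eq: "(LINT s|M. c s *\<^sub>R Y n s) - (LINT s|M. c s *\<^sub>R y s) = (LINT s|M. c s *\<^sub>R (Y n s - y s))"
      using i1 i2 by (simp add: scaleR_diff_right)
    have "norm ((LINT s|M. c s *\<^sub>R Y n s) - (LINT s|M. c s *\<^sub>R y s)) \<le> (LINT s|M. K * d)"
      unfolding eq
    proof (rule order_trans[OF integral_norm_bound integral_mono])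
      show "integrable M (\<lambda>s. norm (c s *\<^sub>R (Y n s - y s)))" using i1 i2 by (simp only: scaleR_diff_right) simp
      fix s assume "s \<in> space M"
      then have s: "s \<in> {t..T}" by auto
      have "norm (c s) * norm (Y n s - y s) \<le> K * d"
        using K N[OF n s] s by (intro mult_mono) (auto intro: less_imp_le)
      then show "norm (c s *\<^sub>R (Y n s - y s)) \<le> K * d" by simp
    qed simp
    also have "\<dots> = K * d * \<mu>" by (simp add: \<mu>_def mult.commute)
    finally show ?thesis using d by simp
  qed
  then show "\<exists>no. \<forall>n\<ge>no. norm ((LINT s|M. c s *\<^sub>R Y n s) - (LINT s|M. c s *\<^sub>R y s)) < e" by blast
qed

text \<open>The weights in \<open>weak_limit_midhull\<close> must not depend on \<open>n\<close>.
  Here they converge uniformly while the speeds are bounded in L^1, so exchanging them costs nothing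
  in the limit.\<close>

lemma frozen_weight_limit:
  fixes P' :: "real \<Rightarrow> real"
  assumes i: "i \<in> eidx G" and P': "continuous_on UNIV P'"
    and lim: "(\<lambda>n. LINT s:{a<..b}|M. P' (axis_coord G i (Y n s)) * f n i s) \<longlonglongrightarrow> q"
  shows "(\<lambda>n. LINT s:{a<..b}|M. P' (axis_coord G i (y s)) * f n i s) \<longlonglongrightarrow> q"
proof -
  have int: "integrable M (\<lambda>s. P' (axis_coord G i (z s)) * f n i s)" if "continuous_on {t..T} z" for z n
  proof -
    have "continuous_on {t..T} (\<lambda>s. P' (axis_coord G i (z s)))"
      by (rule continuous_on_compose2[OF P']) (auto intro!: continuous_intros that)
    from integrable_bounded_inner[OF f_Lp(3)[OF i] this] show ?thesis by simp
  qed
  have "(\<lambda>n. (LINT s:{a<..b}|M. P' (axis_coord G i (y s)) * f n i s) -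
      (LINT s:{a<..b}|M. P' (axis_coord G i (Y n s)) * f n i s)) \<longlonglongrightarrow> 0"
  proof (rule LIMSEQ_I)
    fix e :: real assume e: "e > 0"
    define \<mu> where "\<mu> = measure M (space M) + B"
    have \<mu>: "0 \<le> \<mu>" using B_nonneg[OF i] by (simp add: \<mu>_def)
    define d where "d = e / (\<mu> + 1)"
    have d: "d > 0" "d * \<mu> < e" using e \<mu> by (auto simp: d_def field_simps)
    have "continuous_on {t..T} (\<lambda>s. axis_coord G i (y s))" by (intro continuous_intros y_cont)
    then obtain R where R: "R > 0" "\<And>s. s \<in> {t..T} \<Longrightarrow> norm (axis_coord G i (y s)) \<le> R" by (rule bounded_on_Icc) blast
    \<comment> \<open>The margin 1 accommodates the coordinates of \<open>Y n\<close>, which differ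
      from those of \<open>y\<close> by less than 1.\<close>
    have "uniformly_continuous_on {- (R + 1)..R + 1} P'"
      using P' by (intro compact_uniformly_continuous continuous_on_subset[OF P']) auto
    then obtain r where r: "r > 0" "\<And>z z'. z \<in> {- (R + 1)..R + 1} \<Longrightarrow> z' \<in> {- (R + 1)..R + 1} \<Longrightarrow> dist z' z < r \<Longrightarrow> dist (P' z') (P' z) < d"
      using d(1) unfolding uniformly_continuous_on_def by blast
    obtain N where N: "\<And>n s. n \<ge> N \<Longrightarrow> s \<in> {t..T} \<Longrightarrow> norm (Y n s - y s) < min r 1"
      using unif[of "min r 1", OF min_less_iff_conj[THEN iffD2, OF conjI[OF r(1) zero_less_one]]] by blast
    have "norm ((LINT s:{a<..b}|M. P' (axis_coord G i (y s)) * f n i s) -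
      (LINT s:{a<..b}|M. P' (axis_coord G i (Y n s)) * f n i s) - 0) < e" if n: "n \<ge> N" for n
    proof -
      note iy = int[OF y_cont, of n] and iY = int[OF YD(1), of n n]
      let ?d = "(LINT s:{a<..b}|M. P' (axis_coord G i (y s)) * f n i s) -
        (LINT s:{a<..b}|M. P' (axis_coord G i (Y n s)) * f n i s)"
      have eq: "?d = (LINT s:{a<..b}|M. P' (axis_coord G i (y s)) * f n i s - P' (axis_coord G i (Y n s)) * f n i s)"
        by (intro set_integral_diff(2)[symmetric] set_integrable_Ioc iy iY)
      have "norm ?d \<le> (LINT s:{a<..b}|M. d * \<bar>f n i s\<bar>)"
        unfolding eq
      proof (rule set_integral_Ioc_norm_bound)
        fix s assume "s \<in> {t<..<T}"
        then have s: "s \<in> {t..T}" by auto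
        have dz: "\<bar>axis_coord G i (Y n s) - axis_coord G i (y s)\<bar> < min r 1"
          using abs_axis_coord_diff_le[OF i, of "Y n s" "y s"] N[OF n s] by linarith
        have "dist (P' (axis_coord G i (y s))) (P' (axis_coord G i (Y n s))) < d"
          using dz R(2)[OF s] by (intro r(2)) (auto simp: dist_real_def abs_minus_commute)
        then have "\<bar>P' (axis_coord G i (y s)) - P' (axis_coord G i (Y n s))\<bar> * \<bar>f n i s\<bar> \<le> d * \<bar>f n i s\<bar>"
          by (intro mult_right_mono) (auto simp: dist_real_def)
        then show "norm (P' (axis_coord G i (y s)) * f n i s - P' (axis_coord G i (Y n s)) * f n i s) \<le> d * \<bar>f n i s\<bar>"
          by (simp only: real_norm_def abs_mult[symmetric] left_diff_distrib)
      qed (use iy iY f_Lp[OF i] in auto)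
      also have "\<dots> \<le> (LINT s|M. d * \<bar>f n i s\<bar>)"
        unfolding set_lebesgue_integral_def
      proof (rule integral_mono)
        have "integrable M (\<lambda>s. d * \<bar>f n i s\<bar>)" using f_Lp[OF i] by auto
        from set_integrable_Ioc[OF this] show "integrable M (\<lambda>s. indicator {a<..b} s *\<^sub>R (d * \<bar>f n i s\<bar>))"
          by (simp add: set_integrable_def)
        show "integrable M (\<lambda>s. d * \<bar>f n i s\<bar>)" using f_Lp[OF i] by auto
        show "indicator {a<..b} s *\<^sub>R (d * \<bar>f n i s\<bar>) \<le> d * \<bar>f n i s\<bar>" for s
          using d(1) by (simp add: indicator_def)
      qed
      also have "\<dots> = d * (LINT s|M. \<bar>f n i s\<bar>)" by simp
      also have "\<dots> \<le> d * \<mu>" unfolding \<mu>_def using d(1) by (intro mult_left_mono f_L1_bound i) auto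
      finally show ?thesis using d(2) by simp
    qed
    then show "\<exists>no. \<forall>n\<ge>no. norm ((LINT s:{a<..b}|M. P' (axis_coord G i (y s)) * f n i s) -
      (LINT s:{a<..b}|M. P' (axis_coord G i (Y n s)) * f n i s) - 0) < e" by blast
  qed
  from tendsto_add[OF this lim] show ?thesis by simp
qed

text \<open>A candidate velocity \<open>W\<close> is assembled from the limits of the combined edge
  speeds, and passing to the limit in the weak formulation makes it the weak derivative of
  \<open>y\<close>. The limits are then matched with the edge speeds of \<open>y\<close> at a
  vertex, off the edge and inside it, each for a different reason.\<close>

lemma limit_trajectory:
  obtains h where "y \<in> trajectories G p T t x" "\<And>n. h n \<in> midhull f n"
    "\<And>i. i \<in> eidx G \<Longrightarrow> AE s in M. (\<lambda>n. h n i s) \<longlonglongrightarrow> edge_speed y (weak_deriv p t T y) i s"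
proof (cases "t \<le> T")
  case tT: True
  have "\<exists>h \<alpha>. (\<forall>n. h n \<in> midhull f n) \<and> (\<forall>i\<in>eidx G. (AE s in M. (\<lambda>n. h n i s) \<longlonglongrightarrow> \<alpha> i s) \<and>
      \<alpha> i \<in> borel_measurable M \<and> integrable M (\<lambda>s. \<bar>\<alpha> i s\<bar> powr p) \<and>
      (\<lambda>n. LINT s|M. \<bar>h n i s - \<alpha> i s\<bar>) \<longlonglongrightarrow> 0)"
  proof (rule komlos_Lp[where f=f, OF finite_measure_M finite_atLeastAtMost p f_Lp(1,2) bound])
    fix h \<alpha>
    assume *: "\<And>n. h n \<in> midhull f n"
      "\<And>i. i \<in> eidx G \<Longrightarrow> AE s in M. (\<lambda>n. h n i s) \<longlonglongrightarrow> \<alpha> i s"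
      "\<And>i. i \<in> eidx G \<Longrightarrow> \<alpha> i \<in> borel_measurable M"
      "\<And>i. i \<in> eidx G \<Longrightarrow> integrable M (\<lambda>s. \<bar>\<alpha> i s\<bar> powr p)"
      "\<And>i. i \<in> eidx G \<Longrightarrow> (\<lambda>n. LINT s|M. \<bar>h n i s - \<alpha> i s\<bar>) \<longlonglongrightarrow> 0"
    show ?thesis
      by (rule exI[of _ h], rule exI[of _ \<alpha>], intro conjI allI ballI) (fact *)+
  qed
  then obtain h \<alpha> where h: "\<And>n. h n \<in> midhull f n"
    and conv: "\<And>i. i \<in> eidx G \<Longrightarrow> AE s in M. (\<lambda>n. h n i s) \<longlonglongrightarrow> \<alpha> i s"
    and meas: "\<And>i. i \<in> eidx G \<Longrightarrow> \<alpha> i \<in> borel_measurable M"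
    and Lp: "\<And>i. i \<in> eidx G \<Longrightarrow> integrable M (\<lambda>s. \<bar>\<alpha> i s\<bar> powr p)"
    and L1: "\<And>i. i \<in> eidx G \<Longrightarrow> (\<lambda>n. LINT s|M. \<bar>h n i s - \<alpha> i s\<bar>) \<longlonglongrightarrow> 0"
    by blast
  have \<alpha>int: "integrable M (\<alpha> i)" if i: "i \<in> eidx G" for i
  proof -
    have "in_Lp p t T (\<alpha> i)" using meas[OF i] Lp[OF i] by (simp add: in_Lp_def)
    then show ?thesis using p by (intro in_Lp_integrable) auto
  qed
  define W where "W s = (\<Sum>i\<in>eidx G. \<alpha> i s *\<^sub>R edge_dir G i)" for s
  have W_Lp: "in_Lp p t T W"
    unfolding W_def[abs_def] using p meas Lp by (intro in_Lp_sum in_Lp_scaleR_right) auto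
  have W_int: "integrable M W" using W_Lp p by (intro in_Lp_integrable) auto
  have weak: "has_weak_deriv t T y W"
    unfolding has_weak_deriv_def
  proof (intro allI impI)
    fix \<phi> assume \<phi>: "test_function t T \<phi>"
    then obtain D where D: "\<And>s. (\<phi> has_vector_derivative D s) (at s)" "continuous_on UNIV D"
      unfolding test_function_def C1_differentiable_on_def by auto
    have "deriv \<phi> = D"
      using D(1) by (intro ext DERIV_imp_deriv) (simp add: has_real_derivative_iff_has_vector_derivative)
    then have dc: "continuous_on {t..T} (deriv \<phi>)" using D(2) continuous_on_subset by blast
    have \<phi>c: "continuous_on {t..T} \<phi>"
      using D(1) by (intro continuous_at_imp_continuous_on ballI has_vector_derivative_continuous)
    obtain K where K: "K > 0" "\<And>s. s \<in> {t..T} \<Longrightarrow> norm (\<phi> s) \<le> K" by (rule bounded_on_Icc[OF \<phi>c]) blast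
    have \<phi>v: "integrable M (\<lambda>s. \<phi> s *\<^sub>R w s)" if "integrable M w" for w :: "real \<Rightarrow> 'a"
    proof (rule Bochner_Integration.integrable_bound)
      note [measurable] = measurable_continuous_Ioo[OF \<phi>c] borel_measurable_integrable[OF that]
      show "integrable M (\<lambda>s. K * norm (w s))" using that by auto
      show "(\<lambda>s. \<phi> s *\<^sub>R w s) \<in> borel_measurable M" by measurable
      show "AE s in M. norm (\<phi> s *\<^sub>R w s) \<le> norm (K * norm (w s))"
      proof (rule AE_I2)
        fix s assume "s \<in> space M"
        then have "norm (\<phi> s) * norm (w s) \<le> K * norm (w s)" using K by (intro mult_right_mono) auto
        then show "norm (\<phi> s *\<^sub>R w s) \<le> norm (K * norm (w s))" using K(1) by simp
      qed
    qed
    have comp: "(LINT s|M. \<phi> s *\<^sub>R (\<Sum>i\<in>eidx G. a i s *\<^sub>R edge_dir G i)) \<bullet> b =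
        (\<Sum>i\<in>eidx G. LINT s|M. (\<phi> s * (edge_dir G i \<bullet> b)) * a i s)"
      if a: "\<And>i. i \<in> eidx G \<Longrightarrow> integrable M (a i)" for a b
    proof -
      have i1: "integrable M (\<lambda>s. \<phi> s *\<^sub>R (\<Sum>i\<in>eidx G. a i s *\<^sub>R edge_dir G i))"
        using a by (intro \<phi>v Bochner_Integration.integrable_sum integrable_scaleR_left) auto
      have i2: "integrable M (\<lambda>s. (\<phi> s * (edge_dir G i \<bullet> b)) * a i s)" if "i \<in> eidx G" for i
      proof -
        have "continuous_on {t..T} (\<lambda>s. \<phi> s * (edge_dir G i \<bullet> b))" by (intro continuous_intros \<phi>c)
        from integrable_bounded_inner[OF a[OF that] this] show ?thesis by simp
      qed
      have "(LINT s|M. \<phi> s *\<^sub>R (\<Sum>i\<in>eidx G. a i s *\<^sub>R edge_dir G i)) \<bullet> b =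
        (LINT s|M. (\<phi> s *\<^sub>R (\<Sum>i\<in>eidx G. a i s *\<^sub>R edge_dir G i)) \<bullet> b)"
        using i1 by (intro integral_inner_left[symmetric])
      also have "\<dots> = (LINT s|M. (\<Sum>i\<in>eidx G. (\<phi> s * (edge_dir G i \<bullet> b)) * a i s))"
        by (simp add: inner_sum_left sum_distrib_left mult_ac)
      also have "\<dots> = (\<Sum>i\<in>eidx G. LINT s|M. (\<phi> s * (edge_dir G i \<bullet> b)) * a i s)"
        by (rule Bochner_Integration.integral_sum) (rule i2)
      finally show ?thesis .
    qed
    \<comment> \<open>The identification of weak limits is scalar, so the equation is tested against
      an arbitrary vector \<open>b\<close>. The edges stay summed because the weak formulation for
      \<open>Y n\<close> concerns only the sum.\<close>
    have cmp: "(LINT s|M. \<phi> s *\<^sub>R W s) \<bullet> b = (- (LINT s|M. deriv \<phi> s *\<^sub>R y s)) \<bullet> b" for b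
    proof -
      have "(\<Sum>i\<in>eidx G. LINT s|M. (\<phi> s * (edge_dir G i \<bullet> b)) * f n i s) = (- (LINT s|M. deriv \<phi> s *\<^sub>R Y n s)) \<bullet> b" for n
      proof -
        have "(LINT s|M. \<phi> s *\<^sub>R (\<Sum>i\<in>eidx G. f n i s *\<^sub>R edge_dir G i)) = (LINT s|M. \<phi> s *\<^sub>R V n s)"
        proof (rule integral_cong_AE)
          show "AE s in M. \<phi> s *\<^sub>R (\<Sum>i\<in>eidx G. f n i s *\<^sub>R edge_dir G i) = \<phi> s *\<^sub>R V n s"
            using velocity_eq_sum_edge_speed[OF YD(7,1,2), of n] by eventually_elim simp
          show "(\<lambda>s. \<phi> s *\<^sub>R (\<Sum>i\<in>eidx G. f n i s *\<^sub>R edge_dir G i)) \<in> borel_measurable M"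
            using f_Lp(3) by (intro borel_measurable_integrable \<phi>v Bochner_Integration.integrable_sum integrable_scaleR_left) auto
          show "(\<lambda>s. \<phi> s *\<^sub>R V n s) \<in> borel_measurable M"
            by (intro borel_measurable_integrable \<phi>v YD(6))
        qed
        also have "\<dots> = - (LINT s|M. deriv \<phi> s *\<^sub>R Y n s)"
          using YD(5)[of n] \<phi> unfolding has_weak_deriv_def by simp
        finally show ?thesis using comp[of "f n" b] f_Lp(3) by simp
      qed
      moreover have "(\<lambda>n. (- (LINT s|M. deriv \<phi> s *\<^sub>R Y n s)) \<bullet> b) \<longlonglongrightarrow> (- (LINT s|M. deriv \<phi> s *\<^sub>R y s)) \<bullet> b"
        by (intro tendsto_intros tendsto_integral_scaleR_Y dc)
      ultimately have lim: "(\<lambda>n. \<Sum>i\<in>eidx G. LINT s|M. (\<phi> s * (edge_dir G i \<bullet> b)) * f n i s) \<longlonglongrightarrow>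
          (- (LINT s|M. deriv \<phi> s *\<^sub>R y s)) \<bullet> b" by simp
      have "(\<Sum>i\<in>eidx G. LINT s|M. (\<phi> s * (edge_dir G i \<bullet> b)) * \<alpha> i s) = (- (LINT s|M. deriv \<phi> s *\<^sub>R y s)) \<bullet> b"
      proof (rule weak_limit_midhull[where C="K * norm b" and f=f and g=h])
        note [measurable] = measurable_continuous_Ioo[OF \<phi>c]
        show "(\<lambda>s. \<phi> s * (edge_dir G i \<bullet> b)) \<in> borel_measurable M" for i by measurable
        show "\<bar>\<phi> s * (edge_dir G i \<bullet> b)\<bar> \<le> K * norm b" if "i \<in> eidx G" "s \<in> space M" for i s
        proof -
          have "\<bar>edge_dir G i \<bullet> b\<bar> \<le> norm b"
            using Cauchy_Schwarz_ineq2[of "edge_dir G i" b] norm_edge_dir[OF that(1)] by simp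
          moreover have "\<bar>\<phi> s\<bar> \<le> K" using K(2)[of s] that(2) by simp
          ultimately show ?thesis unfolding abs_mult using K(1) by (intro mult_mono) auto
        qed
      qed (use f_Lp h \<alpha>int L1 lim in auto)
      then show ?thesis using comp[of \<alpha> b] \<alpha>int by (simp add: W_def)
    qed
    have "(LINT s|M. \<phi> s *\<^sub>R W s) = - (LINT s|M. deriv \<phi> s *\<^sub>R y s)" by (rule euclidean_eqI) (rule cmp)
    then show "(LINT s|M. deriv \<phi> s *\<^sub>R y s) = - (LINT s|M. \<phi> s *\<^sub>R W s)" by simp
  qed
  have "in_Lp p t T y"
    unfolding in_Lp_def
  proof (intro conjI measurable_continuous_Ioo y_cont integrable_continuous_Ioo)
    show "continuous_on {t..T} (\<lambda>s. norm (y s) powr p)"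
      using p y_cont by (intro continuous_on_powr' continuous_intros) auto
  qed
  moreover have "y t = x"
  proof -
    have "(\<lambda>n. Y n t) \<longlonglongrightarrow> y t" using tT by (intro tendsto_Y) auto
    then show ?thesis using YD(3) by (simp add: LIMSEQ_const_iff)
  qed
  ultimately have traj: "y \<in> trajectories G p T t x"
    using y_cont y_network W_Lp weak unfolding trajectories_def W1p_def by blast
  note yD = trajectoryD[OF traj]
  have W_eq: "AE s in M. weak_deriv p t T y s = W s"
    by (rule has_ac_deriv_unique[OF yD(7) weak_deriv_has_ac_deriv[OF y_cont W_int weak]])
  \<comment> \<open>That the velocity of \<open>y\<close> is 0 at vertices gives only a linear
    relation between the values \<open>\<alpha> i s\<close>. Each one is isolated by the function
    \<open>m\<close>: its derivative along \<open>y\<close> is \<open>P'\<close> times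
    \<open>\<alpha> i\<close>, with \<open>P'\<close> nonzero at the vertices, whereas
    \<open>m\<close> itself is 0 there.\<close>
  have vertex0: "AE s in M. y s \<in> edge_set G i \<inter> vertices G \<longrightarrow> \<alpha> i s = 0" if i: "i \<in> eidx G" for i
  proof -
    obtain P P' :: "real \<Rightarrow> real" where P: "\<And>z. (P has_real_derivative P' z) (at z)" "continuous_on UNIV P'" "continuous_on UNIV P"
      and P0: "\<And>x. x \<in> edge_set G i \<Longrightarrow> P (axis_coord G i x) = 0 \<longleftrightarrow> x \<in> vertices G"
      and P1: "\<And>x. x \<in> edge_set G i \<inter> vertices G \<Longrightarrow> P' (axis_coord G i x) \<noteq> 0"
      using edge_polynomial[OF i] by metis
    define m where "m x = (if x \<in> edge_set G i then P (axis_coord G i x) else 0)" for x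
    have m_cont: "continuous_on (network_set G) m"
      unfolding m_def[abs_def] using P0 by (intro continuous_edge_function i P(3)) auto
    have my: "continuous_on {t..T} (\<lambda>s. m (y s))"
      by (rule continuous_on_compose2[OF m_cont y_cont y_network])
    have P'y: "continuous_on {t..T} (\<lambda>s. P' (axis_coord G i (y s)))"
      by (rule continuous_on_compose2[OF P(2)]) (auto intro!: continuous_intros y_cont)
    obtain K where K: "K > 0" "\<And>s. s \<in> {t..T} \<Longrightarrow> norm (P' (axis_coord G i (y s))) \<le> K" by (rule bounded_on_Icc[OF P'y]) blast
    have "has_ac_deriv t T (\<lambda>s. m (y s)) (\<lambda>s. P' (axis_coord G i (y s)) * \<alpha> i s)"
      unfolding has_ac_deriv_def
    proof (intro conjI allI impI)
      show "integrable M (\<lambda>s. P' (axis_coord G i (y s)) * \<alpha> i s)"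
        using integrable_bounded_inner[OF \<alpha>int[OF i] P'y] by simp
      fix a b assume ab: "t \<le> a" "a \<le> b" "b \<le> T"
      have m_lim: "(\<lambda>n. m (Y n s)) \<longlonglongrightarrow> m (y s)" if s: "s \<in> {t..T}" for s
      proof (rule continuous_on_tendsto_compose[OF m_cont tendsto_Y[OF s]])
        show "y s \<in> network_set G" using y_network s by blast
        have "Y n s \<in> network_set G" for n using YD(2)[of n] s by blast
        then show "\<forall>\<^sub>F n in sequentially. Y n s \<in> network_set G" by simp
      qed
      have "(LINT s:{a<..b}|M. P' (axis_coord G i (Y n s)) * f n i s) = m (Y n b) - m (Y n a)" for n
        using has_ac_deriv_edge_function[OF YD(7,1,2) i P(1,2) P0] ab
        unfolding has_ac_deriv_def m_def by simp
      then have "(\<lambda>n. LINT s:{a<..b}|M. P' (axis_coord G i (Y n s)) * f n i s) \<longlonglongrightarrow> m (y b) - m (y a)"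
        using ab by (simp add: tendsto_diff m_lim)
      then have lim: "(\<lambda>n. LINT s:{a<..b}|M. P' (axis_coord G i (y s)) * f n i s) \<longlonglongrightarrow> m (y b) - m (y a)"
        by (rule frozen_weight_limit[OF i P(2)])
      \<comment> \<open>The singleton sum fits the general statement on weak limits, with the
        indicator of \<open>{a<..b}\<close> as part of the bounded weight.\<close>
      have "(\<Sum>k\<in>{i}. LINT s|M. (indicator {a<..b} s * P' (axis_coord G i (y s))) * \<alpha> k s) = m (y b) - m (y a)"
      proof (rule weak_limit_midhull[where C=K and f=f and g=h])
        note [measurable] = measurable_continuous_Ioo[OF P'y]
        show "(\<lambda>s. indicator {a<..b} s * P' (axis_coord G i (y s))) \<in> borel_measurable M" by measurable
        show "\<bar>indicator {a<..b} s * P' (axis_coord G i (y s))\<bar> \<le> K" if "s \<in> space M" for s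
          using K(2)[of s] K(1) that by (auto simp: indicator_def)
      qed (use i f_Lp h \<alpha>int L1 lim in \<open>auto simp: set_lebesgue_integral_def mult.assoc\<close>)
      then show "m (y b) - m (y a) = (LINT s:{a<..b}|M. P' (axis_coord G i (y s)) * \<alpha> i s)"
        by (simp add: set_lebesgue_integral_def mult.assoc)
    qed
    from has_ac_deriv_zero_set[OF this my] show ?thesis
    proof eventually_elim
      case (elim s)
      then show ?case using P0[of "y s"] P1[of "y s"] by (auto simp: m_def)
    qed
  qed
  have "AE s in M. \<forall>i\<in>eidx G. (\<lambda>n. h n i s) \<longlonglongrightarrow> \<alpha> i s"
    using conv by (intro AE_finite_allI) auto
  moreover have "AE s in M. \<forall>i\<in>eidx G. y s \<in> edge_set G i \<inter> vertices G \<longrightarrow> \<alpha> i s = 0"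
    using vertex0 by (intro AE_finite_allI) auto
  moreover have "AE s in M. s \<in> {t..T}" by (rule AE_I2) auto
  ultimately have "AE s in M. \<forall>i\<in>eidx G. (\<lambda>n. h n i s) \<longlonglongrightarrow> edge_speed y (weak_deriv p t T y) i s"
    using W_eq
  proof eventually_elim
    case (elim s)
    have ys: "y s \<in> network_set G" using elim(3) y_network by auto
    obtain d where d: "d > 0" "\<And>x'. dist x' (y s) < d \<Longrightarrow> star (y s) x'" using eventually_star[of "y s"] by blast
    obtain N where N: "\<And>n. n \<ge> N \<Longrightarrow> norm (Y n s - y s) < d" using unif[OF d(1)] elim(3) by blast
    \<comment> \<open>With \<open>s\<close> fixed, \<open>Y n s\<close> avoids edge \<open>k\<close>
      from some index on, so all generators of the late hulls have speed 0 at \<open>s\<close>, and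
      so have their midpoints.\<close>
    have off: "\<alpha> k s = 0" if k: "k \<in> eidx G" "y s \<notin> edge_set G k" for k
    proof -
      have zero: "f n k s = 0" if "n \<ge> N" for n
      proof -
        have "star (y s) (Y n s)" using N[OF that] d(2) by (simp add: dist_norm)
        then have "Y n s \<notin> edge_set G k" using k unfolding star_def by blast
        then show ?thesis by (simp add: edge_speed_def)
      qed
      have "a k s = 0" if "a \<in> midhull f n" "n \<ge> N" for a n
        using that by induction (auto intro: zero)
      then have "\<forall>\<^sub>F n in sequentially. h n k s = 0"
        using h by (auto simp: eventually_sequentially)
      then have "(\<lambda>n. h n k s) \<longlonglongrightarrow> 0" by (rule tendsto_eventually)
      with elim(1) k(1) show ?thesis using LIMSEQ_unique by blast
    qed
    have "\<alpha> i s = edge_speed y W i s" if i: "i \<in> eidx G" for i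
    proof (cases "y s \<in> edge_interior G i")
      case False
      then have "\<alpha> i s = 0" using off[OF i] elim(2) i by blast
      then show ?thesis using False by (simp add: edge_speed_def)
    next
      case True
      have "\<alpha> k s *\<^sub>R edge_dir G k = (if k = i then \<alpha> i s *\<^sub>R edge_dir G i else 0)" if k: "k \<in> eidx G" for k
      proof (cases "k = i")
        case False
        then have "y s \<notin> edge_set G k" using edge_interior_unique[OF i k True] by blast
        then show ?thesis using off[OF k] False by simp
      qed simp
      then have "W s = (\<Sum>k\<in>eidx G. if k = i then \<alpha> i s *\<^sub>R edge_dir G i else 0)"
        unfolding W_def by (rule sum.cong[OF refl])
      then have "W s = \<alpha> i s *\<^sub>R edge_dir G i" using i by simp
      then show ?thesis using True norm_edge_dir[OF i] by (simp add: edge_speed_def dot_square_norm)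
    qed
    moreover have "edge_speed y W i s = edge_speed y (weak_deriv p t T y) i s" for i
      using elim(4) by (simp add: edge_speed_def)
    ultimately show ?case using elim(1) by metis
  qed
  then have "AE s in M. (\<lambda>n. h n i s) \<longlonglongrightarrow> edge_speed y (weak_deriv p t T y) i s" if "i \<in> eidx G" for i
    by eventually_elim (use that in blast)
  with traj h show ?thesis by (rule that)
qed (use t in auto)

lemma running_cost_lsc:
  assumes R: "\<And>e. e > 0 \<Longrightarrow> \<exists>N. \<forall>n\<ge>N. (LINT s|M. L (Y n s) (V n s) s) \<le> R + e"
  shows "y \<in> trajectories G p T t x \<and> (LINT s|M. L (y s) (weak_deriv p t T y s) s) \<le> R"
proof -
  interpret M: finite_measure M by (rule finite_measure_M)
  obtain h where traj: "y \<in> trajectories G p T t x" and h: "\<And>n. h n \<in> midhull f n"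
    and conv: "\<And>i. i \<in> eidx G \<Longrightarrow> AE s in M. (\<lambda>n. h n i s) \<longlonglongrightarrow> edge_speed y (weak_deriv p t T y) i s"
    by (rule limit_trajectory) blast
  note yD = trajectoryD[OF traj]
  define \<alpha> where "\<alpha> = edge_speed y (weak_deriv p t T y)"
  define \<mu> where "\<mu> = measure M (space M)"
  have \<alpha>_Lp: "\<alpha> i \<in> borel_measurable M" "integrable M (\<lambda>s. \<bar>\<alpha> i s\<bar> powr p)" if "i \<in> eidx G" for i
    unfolding \<alpha>_def using edge_speed_Lp[OF yD(1,4) that] by auto
  have L_int: "integrable M (\<lambda>s. L (Y n s) (V n s) s)" for n
    by (rule integrable_running_cost[OF YD(1,2)]) (use f_Lp in auto)
  obtain C1 where C1: "C1 \<ge> 0" "\<And>s a. s \<in> {t..T} \<Longrightarrow> - C1 \<le> relaxed_cost y a s"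
    using relaxed_cost_bounded_below[OF y_cont y_network] by blast
  obtain c0 C0 where c0: "c0 > 0" "C0 \<ge> 0" "\<And>x w s. x \<in> network_set G \<Longrightarrow> s \<in> {0..T} \<Longrightarrow>
     c0 * (\<Sum>i\<in>eidx G. \<bar>indicator (edge_interior G i) x * (w \<bullet> edge_dir G i)\<bar> powr p) - C0 \<le> L x w s"
    using running_cost_coercive by blast
  define C where "C = max C0 C1"
  have L_ge: "0 \<le> L x w s + C" if "x \<in> network_set G" "s \<in> {0..T}" for x w s
  proof -
    have "0 \<le> c0 * (\<Sum>i\<in>eidx G. \<bar>indicator (edge_interior G i) x * (w \<bullet> edge_dir G i)\<bar> powr p)"
      using c0(1) by (intro mult_nonneg_nonneg sum_nonneg) auto
    then show ?thesis using c0(3)[OF that, of w] by (simp add: C_def)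
  qed
  have rel_ge: "0 \<le> relaxed_cost y a s + C" if "s \<in> {t..T}" for a s
    using C1(2)[OF that, of a] by (simp add: C_def)
  obtain k where k: "k \<ge> 0" "\<And>s x' w a. s \<in> {t..T} \<Longrightarrow> x' \<in> network_set G \<Longrightarrow> star (y s) x' \<Longrightarrow> norm (x' - y s) \<le> 1 \<Longrightarrow>
    (\<forall>i\<in>eidx G. a i s = indicator (edge_interior G i) x' * (w \<bullet> edge_dir G i)) \<Longrightarrow>
    relaxed_cost y a s \<le> L x' w s + k * norm (x' - y s) * (1 + (\<Sum>i\<in>eidx G. \<bar>a i s\<bar> powr p))"
    using relaxed_cost_compare[OF y_cont y_network] by blast
  \<comment> \<open>The radius within which \<open>star\<close> holds depends on \<open>s\<close>,
    so from a fixed index on the comparison of costs is available only on such a set of times. These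
    sets increase to the whole interval.\<close>
  define S where "S m = {s \<in> space M. \<forall>n\<ge>m. star (y s) (Y n s)}" for m
  have S_meas: "S m \<in> sets M" for m
  proof -
    note [measurable] = measurable_continuous_Ioo[OF YD(1)] measurable_continuous_Ioo[OF y_cont]
    have V_borel: "vertices G \<in> sets borel" by (intro borel_closed finite_imp_closed finite_vertices)
    have preimage: "{s \<in> space M. z s \<in> A} \<in> sets M" if "z \<in> borel_measurable M" "A \<in> sets borel" for z :: "real \<Rightarrow> 'a" and A
      using measurable_sets[OF that] by (simp add: vimage_def Int_def conj_commute)
    have "{s \<in> space M. star (y s) (Y n s)} \<in> sets M" for n
    proof -
      have 1: "{s \<in> space M. Y n s \<in> edge_set G i \<longrightarrow> y s \<in> edge_set G i} \<in> sets M" if "i \<in> eidx G" for i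
      proof -
        have "{s \<in> space M. Y n s \<in> edge_set G i} \<in> sets M" "{s \<in> space M. y s \<in> edge_set G i} \<in> sets M"
          by (intro preimage borel_edge_sets that measurable_continuous_Ioo YD(1) y_cont)+
        then show ?thesis by (intro sets.sets_Collect_imp)
      qed
      have 2: "{s \<in> space M. Y n s \<in> vertices G \<longrightarrow> y s = Y n s} \<in> sets M"
      proof -
        have "{s \<in> space M. Y n s \<in> vertices G} \<in> sets M"
          by (intro preimage V_borel measurable_continuous_Ioo YD(1))
        moreover have "{s \<in> space M. y s = Y n s} \<in> sets M" by measurable
        ultimately show ?thesis by (intro sets.sets_Collect_imp)
      qed
      have "{s \<in> space M. \<forall>i\<in>eidx G. Y n s \<in> edge_set G i \<longrightarrow> y s \<in> edge_set G i} \<in> sets M"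
        by (intro sets.sets_Collect_finite_All 1) simp_all
      with 2 show ?thesis unfolding star_def by (intro sets.sets_Collect_conj)
    qed
    then show ?thesis unfolding S_def
      by (intro sets.sets_Collect_countable_All sets.sets_Collect_imp sets.sets_Collect_const)
  qed
  have S_ev: "\<forall>\<^sub>F m in sequentially. s \<in> S m" if s: "s \<in> space M" for s
  proof -
    have s': "s \<in> {t..T}" using s by auto
    obtain d where d: "d > 0" "\<And>x'. dist x' (y s) < d \<Longrightarrow> star (y s) x'" using eventually_star[of "y s"] by blast
    obtain N where N: "\<And>n. n \<ge> N \<Longrightarrow> norm (Y n s - y s) < d" using unif[OF d(1)] s' by blast
    have "s \<in> S m" if "m \<ge> N" for m
      unfolding S_def using s that N d(2) by (auto simp: dist_norm)
    then show ?thesis unfolding eventually_sequentially by blast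
  qed
  have rel_int: "integrable M (relaxed_cost y a)"
    if "\<And>i. i \<in> eidx G \<Longrightarrow> a i \<in> borel_measurable M" "\<And>i. i \<in> eidx G \<Longrightarrow> integrable M (\<lambda>s. \<bar>a i s\<bar> powr p)" for a
    by (rule integrable_relaxed_cost[OF y_cont y_network that])
  have hull_Lp: "a i \<in> borel_measurable M" "integrable M (\<lambda>s. \<bar>a i s\<bar> powr p)" if "a \<in> midhull f n" "i \<in> eidx G" for a n i
    using midhull_Lp[of p n f i M B a] that p f_Lp bound by auto
  define \<Phi> where "\<Phi> m a s = indicator (S m) s * (relaxed_cost y a s + C)" for m a s
  have \<Phi>_int: "integrable M (\<Phi> m a)"
    if "\<And>i. i \<in> eidx G \<Longrightarrow> a i \<in> borel_measurable M" "\<And>i. i \<in> eidx G \<Longrightarrow> integrable M (\<lambda>s. \<bar>a i s\<bar> powr p)" for m a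
  proof -
    have "integrable M (\<lambda>s. relaxed_cost y a s + C)" using rel_int[of a] that by simp
    then have "integrable M (\<lambda>s. indicator (S m) s *\<^sub>R (relaxed_cost y a s + C))"
      using S_meas by (intro integrable_indicator_scaleR borel_measurable_indicator)
    then show ?thesis unfolding \<Phi>_def[abs_def] by simp
  qed
  have \<Phi>_nonneg: "0 \<le> \<Phi> m a s" if "s \<in> space M" for m a s
    unfolding \<Phi>_def using rel_ge[of s a] that by simp
  have step: "\<exists>N. \<forall>n\<ge>N. \<forall>a\<in>midhull f n. (LINT s|M. \<Phi> m a s) \<le> R + C * \<mu> + e" if e: "e > 0" for m e
  proof -
    define Q where "Q = \<mu> + (\<Sum>i\<in>eidx G. B)"
    have "0 \<le> (\<Sum>i\<in>eidx G. B)" by (rule sum_nonneg) (rule B_nonneg)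
    then have Q: "0 \<le> Q" unfolding Q_def \<mu>_def by (rule add_nonneg_nonneg[OF measure_nonneg])
    \<comment> \<open>\<open>Q\<close> bounds the integral of 1 plus the p-th powers of all speeds,
      so a distance \<open>d\<close> makes the Lipschitz error k d Q at most e/2. The cap 1 respects
      the range of the comparison.\<close>
    define d where "d = min 1 (e / (2 * (k * Q + 1)))"
    have kQ: "0 \<le> k * Q" using k(1) Q by simp
    have d: "d > 0" "d \<le> 1" using e kQ by (auto simp: d_def)
    have dQ: "k * d * Q \<le> e / 2"
    proof -
      have "k * d * Q = d * (k * Q)" by simp
      also have "\<dots> \<le> e / (2 * (k * Q + 1)) * (k * Q)" using kQ by (intro mult_right_mono) (auto simp: d_def)
      also have "\<dots> \<le> e / 2" using e kQ by (simp add: field_simps)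
      finally show ?thesis .
    qed
    obtain N1 where N1: "\<And>n s. n \<ge> N1 \<Longrightarrow> s \<in> {t..T} \<Longrightarrow> norm (Y n s - y s) < d" using unif[OF d(1)] by blast
    obtain N2 where N2: "\<And>n. n \<ge> N2 \<Longrightarrow> (LINT s|M. L (Y n s) (V n s) s) \<le> R + e / 2" using R[of "e / 2"] e by auto
    define N where "N = max m (max N1 N2)"
    have base: "(LINT s|M. \<Phi> m (f n) s) \<le> R + C * \<mu> + e" if n: "n \<ge> N" for n
    proof -
      let ?r = "\<lambda>s. L (Y n s) (V n s) s + C + k * d * (1 + (\<Sum>i\<in>eidx G. \<bar>f n i s\<bar> powr p))"
      have sum_int: "integrable M (\<lambda>s. \<Sum>i\<in>eidx G. \<bar>f n i s\<bar> powr p)"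
        using f_Lp by (intro Bochner_Integration.integrable_sum)
      have "(LINT s|M. \<Phi> m (f n) s) \<le> (LINT s|M. ?r s)"
      proof (rule integral_mono)
        show "integrable M (\<Phi> m (f n))" by (rule \<Phi>_int) (use f_Lp in auto)
        show "integrable M ?r" using L_int[of n] sum_int by simp
        fix s assume s: "s \<in> space M"
        then have s': "s \<in> {t..T}" "s \<in> {0..T}" using t by auto
        have YN: "Y n s \<in> network_set G" using YD(2) s' by blast
        have sum0: "0 \<le> (\<Sum>i\<in>eidx G. \<bar>f n i s\<bar> powr p)" by (intro sum_nonneg) auto
        have kd: "0 \<le> k * d" using k(1) d(1) by simp
        show "\<Phi> m (f n) s \<le> ?r s"
        proof (cases "s \<in> S m")
          case False
          then show ?thesis using L_ge[OF YN s'(2), of "V n s"] sum0 kd by (simp add: \<Phi>_def)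
        next
          case True
          have near: "norm (Y n s - y s) < d" using N1[of n s] n s' by (simp add: N_def)
          have "star (y s) (Y n s)" using True n by (simp add: S_def N_def)
          then have "relaxed_cost y (f n) s \<le> L (Y n s) (V n s) s + k * norm (Y n s - y s) * (1 + (\<Sum>i\<in>eidx G. \<bar>f n i s\<bar> powr p))"
            using near d(2) by (intro k(2)[OF s'(1) YN]) (auto simp: edge_speed_def)
          also have "k * norm (Y n s - y s) * (1 + (\<Sum>i\<in>eidx G. \<bar>f n i s\<bar> powr p)) \<le> k * d * (1 + (\<Sum>i\<in>eidx G. \<bar>f n i s\<bar> powr p))"
            using k(1) near sum0 by (intro mult_right_mono mult_left_mono) auto
          finally show ?thesis using True by (simp add: \<Phi>_def)
        qed
      qed
      also have "\<dots> = (LINT s|M. L (Y n s) (V n s) s) + C * \<mu> + k * d * (\<mu> + (LINT s|M. (\<Sum>i\<in>eidx G. \<bar>f n i s\<bar> powr p)))"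
        using L_int[of n] sum_int by (simp add: \<mu>_def mult.commute)
      also have "(LINT s|M. (\<Sum>i\<in>eidx G. \<bar>f n i s\<bar> powr p)) = (\<Sum>i\<in>eidx G. LINT s|M. \<bar>f n i s\<bar> powr p)"
        using f_Lp by (intro Bochner_Integration.integral_sum) auto
      also have "k * d * (\<mu> + (\<Sum>i\<in>eidx G. LINT s|M. \<bar>f n i s\<bar> powr p)) \<le> k * d * Q"
        unfolding Q_def using k(1) d(1) bound by (intro mult_left_mono add_left_mono sum_mono) auto
      also note dQ
      finally have "(LINT s|M. \<Phi> m (f n) s) \<le> (LINT s|M. L (Y n s) (V n s) s) + C * \<mu> + e / 2" by simp
      also have "(LINT s|M. L (Y n s) (V n s) s) \<le> R + e / 2" using N2[of n] n by (simp add: N_def)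
      finally show ?thesis by simp
    qed
    have "(LINT s|M. \<Phi> m a s) \<le> R + C * \<mu> + e" if "a \<in> midhull f n" "n \<ge> N" for a n
      using that(1)
    proof induction
      case (base j)
      then show ?case using \<open>n \<ge> N\<close> by (intro \<open>\<And>n. n \<ge> N \<Longrightarrow> (LINT s|M. \<Phi> m (f n) s) \<le> R + C * \<mu> + e\<close>) simp
    next
      case (mid a b)
      let ?c = "\<lambda>i s. (a i s + b i s) / 2"
      have ia: "integrable M (\<Phi> m a)" and ib: "integrable M (\<Phi> m b)"
        using hull_Lp[OF mid(1)] hull_Lp[OF mid(2)] by (auto intro!: \<Phi>_int)
      have ic: "integrable M (\<Phi> m ?c)"
        by (rule \<Phi>_int) (rule hull_Lp[OF midhull.mid[OF mid(1,2)]], assumption)+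
      have "(LINT s|M. \<Phi> m ?c s) \<le> (LINT s|M. (\<Phi> m a s + \<Phi> m b s) / 2)"
      proof (rule integral_mono[OF ic])
        show "integrable M (\<lambda>s. (\<Phi> m a s + \<Phi> m b s) / 2)" using ia ib by simp
        fix s assume "s \<in> space M"
        then have "s \<in> {0..T}" using t by auto
        from relaxed_cost_midpoint[OF this, of y a b]
        show "\<Phi> m ?c s \<le> (\<Phi> m a s + \<Phi> m b s) / 2" by (simp add: \<Phi>_def indicator_def)
      qed
      also have "\<dots> = ((LINT s|M. \<Phi> m a s) + (LINT s|M. \<Phi> m b s)) / 2" using ia ib by simp
      also have "\<dots> \<le> R + C * \<mu> + e"
      proof -
        have "(z + z') / 2 \<le> u" if "z \<le> u" "z' \<le> u" for z z' u :: real
          using that by (simp add: field_simps)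
        then show ?thesis using mid(3,4) by blast
      qed
      finally show ?case .
    qed
    then show ?thesis by blast
  qed
  have conv': "AE s in M. \<forall>i\<in>eidx G. (\<lambda>n. h n i s) \<longlonglongrightarrow> \<alpha> i s"
    unfolding \<alpha>_def using conv by (intro AE_finite_allI) auto
  have \<Phi>\<alpha>: "(LINT s|M. \<Phi> m \<alpha> s) \<le> R + C * \<mu> + e" if e: "e > 0" for m e
  proof -
    obtain N where N: "\<And>n a. n \<ge> N \<Longrightarrow> a \<in> midhull f n \<Longrightarrow> (LINT s|M. \<Phi> m a s) \<le> R + C * \<mu> + e"
      using step[OF e, of m] by blast
    show ?thesis
    proof (rule integral_le_of_AE_tendsto(2)[of M "\<lambda>n. \<Phi> m (h (n + N))"])
      show "integrable M (\<Phi> m (h (n + N)))" for n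
        by (rule \<Phi>_int) (use hull_Lp[OF h] in auto)
      show "AE s in M. 0 \<le> \<Phi> m (h (n + N)) s" for n by (intro AE_I2 \<Phi>_nonneg)
      show "(LINT s|M. \<Phi> m (h (n + N)) s) \<le> R + C * \<mu> + e" for n by (rule N[OF _ h]) simp
      show "\<Phi> m \<alpha> \<in> borel_measurable M" using \<Phi>_int[OF \<alpha>_Lp] by auto
      have "AE s in M. s \<in> space M" by (rule AE_space)
      with conv' show "AE s in M. (\<lambda>n. \<Phi> m (h (n + N)) s) \<longlonglongrightarrow> \<Phi> m \<alpha> s"
      proof eventually_elim
        case (elim s)
        then have "s \<in> {0..T}" using t by auto
        then have "(\<lambda>n. relaxed_cost y (h n) s) \<longlonglongrightarrow> relaxed_cost y \<alpha> s"
          using elim(1) by (intro tendsto_relaxed_cost) auto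
        from LIMSEQ_ignore_initial_segment[OF this, of N] show ?case
          unfolding \<Phi>_def by (intro tendsto_intros)
      qed
    qed
  qed
  have rel\<alpha>: "integrable M (relaxed_cost y \<alpha>)" using rel_int \<alpha>_Lp by blast
  \<comment> \<open>Second passage, in \<open>m\<close>: every time lies in \<open>S m\<close> from
    some \<open>m\<close> on.\<close>
  have "(LINT s|M. relaxed_cost y \<alpha> s + C) \<le> R + C * \<mu> + e" if e: "e > 0" for e
  proof (rule integral_le_of_AE_tendsto(2)[of M "\<lambda>m. \<Phi> m \<alpha>"])
    show "integrable M (\<Phi> m \<alpha>)" for m by (rule \<Phi>_int[OF \<alpha>_Lp])
    show "AE s in M. 0 \<le> \<Phi> m \<alpha> s" for m by (intro AE_I2 \<Phi>_nonneg)
    show "(LINT s|M. \<Phi> m \<alpha> s) \<le> R + C * \<mu> + e" for m by (rule \<Phi>\<alpha>[OF e])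
    show "(\<lambda>s. relaxed_cost y \<alpha> s + C) \<in> borel_measurable M" using rel\<alpha> by simp
    show "AE s in M. (\<lambda>m. \<Phi> m \<alpha> s) \<longlonglongrightarrow> relaxed_cost y \<alpha> s + C"
    proof (rule AE_I2)
      fix s assume "s \<in> space M"
      from S_ev[OF this] have "\<forall>\<^sub>F m in sequentially. \<Phi> m \<alpha> s = relaxed_cost y \<alpha> s + C"
        by eventually_elim (simp add: \<Phi>_def)
      then show "(\<lambda>m. \<Phi> m \<alpha> s) \<longlonglongrightarrow> relaxed_cost y \<alpha> s + C" by (rule tendsto_eventually)
    qed
  qed
  then have "(LINT s|M. relaxed_cost y \<alpha> s + C) \<le> R + C * \<mu>" by (rule field_le_epsilon)
  then have "(LINT s|M. relaxed_cost y \<alpha> s) \<le> R" using rel\<alpha> by (simp add: \<mu>_def mult.commute)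
  moreover have "(LINT s|M. relaxed_cost y \<alpha> s) = (LINT s|M. L (y s) (weak_deriv p t T y s) s)"
    unfolding \<alpha>_def using y_network by (intro Bochner_Integration.integral_cong refl relaxed_cost_eq) auto
  ultimately show ?thesis using traj by simp
qed

end

section \<open>Existence of a minimiser\<close>

context control_problem
begin

text \<open>Guarantees that the infimum runs over a nonempty set. A test function vanishes at
  \<open>t\<close> and \<open>T\<close>, so its derivative integrates to 0.\<close>

lemma constant_trajectory:
  assumes x: "x \<in> network_set G"
  shows "(\<lambda>_. x) \<in> trajectories G p T t x"
proof -
  have "has_weak_deriv t T (\<lambda>_. x) (\<lambda>_. 0)"
    unfolding has_weak_deriv_def
  proof (intro allI impI)
    fix \<phi> assume \<phi>: "test_function t T \<phi>"
    then obtain D where D: "\<And>s. (\<phi> has_vector_derivative D s) (at s)" "continuous_on UNIV D"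
      unfolding test_function_def C1_differentiable_on_def by auto
    have dD: "deriv \<phi> = D"
      using D(1) by (intro ext DERIV_imp_deriv) (simp add: has_real_derivative_iff_has_vector_derivative)
    have zero: "\<phi> s = 0" if "s \<notin> {t<..<T}" for s
    proof (rule ccontr)
      assume "\<phi> s \<noteq> 0"
      then have "s \<in> {s. \<phi> s \<noteq> 0}" by simp
      then have "s \<in> closure {s. \<phi> s \<noteq> 0}" by (rule subsetD[OF closure_subset])
      moreover have "closure {s. \<phi> s \<noteq> 0} \<subseteq> {t<..<T}" using \<phi> by (simp add: test_function_def)
      ultimately show False using that by (meson subsetD)
    qed
    have Di: "integrable M D" by (rule integrable_continuous_Ioo) (rule continuous_on_subset[OF D(2)], simp)
    have "(D has_integral (\<phi> T - \<phi> t)) {t..T}"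
    proof (rule fundamental_theorem_of_calculus)
      show "(\<phi> has_vector_derivative D s) (at s within {t..T})" for s
        by (rule has_vector_derivative_at_within[OF D(1)])
    qed (use t in auto)
    moreover have "\<phi> T = 0" "\<phi> t = 0" by (rule zero, simp)+
    ultimately have "integral {t..T} D = 0" by (simp add: integral_unique)
    then have "integral {t<..<T} D = 0" by (simp only: integral_open_interval_real)
    then have "(LINT s|M. D s) = 0" using lebesgue_integral_eq_integral[OF Di] by simp
    then show "(LINT s|M. deriv \<phi> s *\<^sub>R x) = - (LINT s|M. \<phi> s *\<^sub>R (0::'a))"
      using Di by (simp add: dD)
  qed
  moreover have "in_Lp p t T (\<lambda>_. x)" by (simp add: in_Lp_def)
  ultimately have "(\<lambda>_. x) \<in> W1p p t T" using in_Lp_zero[of p t T] p unfolding W1p_def by auto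
  then show ?thesis using x by (auto simp: trajectories_def)
qed

text \<open>Hoelder's inequality is replaced by |u| <= K + K^(1 - p) |u|^p with a free level
  \<open>K\<close>: up to \<open>K\<close> the first term suffices, beyond it the second. The number
  of edges enters because the speeds are bounded one by one.\<close>

lemma trajectory_modulus:
  assumes z: "z \<in> trajectories G p T t x"
    and B: "\<And>i. i \<in> eidx G \<Longrightarrow> (LINT s|M. \<bar>edge_speed z (weak_deriv p t T z) i s\<bar> powr p) \<le> B"
    and K: "K > 0" and ab: "t \<le> a" "a \<le> b" "b \<le> T"
  shows "norm (z b - z a) \<le> real (card (eidx G)) * (K * (b - a) + K powr (1 - p) * B)"
proof -
  note zD = trajectoryD[OF z]
  let ?v = "weak_deriv p t T z"
  let ?f = "\<lambda>i. edge_speed z ?v i"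
  have fp: "integrable M (\<lambda>s. \<bar>?f i s\<bar> powr p)" if "i \<in> eidx G" for i
    using edge_speed_Lp[OF zD(1,4) that] by auto
  define W where "W i s = K + K powr (1 - p) * \<bar>?f i s\<bar> powr p" for i s
  have W_int: "integrable M (W i)" if "i \<in> eidx G" for i
    unfolding W_def[abs_def] using fp[OF that] by simp
  have young: "\<bar>u\<bar> \<le> K + K powr (1 - p) * \<bar>u\<bar> powr p" for u
  proof (cases "\<bar>u\<bar> \<le> K")
    case True then show ?thesis by (simp add: add_increasing2)
  next
    case False
    then have "\<bar>u\<bar> = \<bar>u\<bar> powr (1 - p) * \<bar>u\<bar> powr p" using K by (simp flip: powr_add)
    also have "\<dots> \<le> K powr (1 - p) * \<bar>u\<bar> powr p"
      using False K p by (intro mult_right_mono powr_mono2') auto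
    finally show ?thesis using K by simp
  qed
  have ae: "AE s in M. norm (?v s) \<le> (\<Sum>i\<in>eidx G. W i s)"
    using velocity_eq_sum_edge_speed[OF zD(7,1,2)]
  proof eventually_elim
    case (elim s)
    have "norm (\<Sum>i\<in>eidx G. ?f i s *\<^sub>R edge_dir G i) \<le> (\<Sum>i\<in>eidx G. W i s)"
    proof (rule sum_norm_le)
      fix i assume "i \<in> eidx G"
      then show "norm (?f i s *\<^sub>R edge_dir G i) \<le> W i s"
        using norm_edge_dir young[of "?f i s"] by (simp add: W_def)
    qed
    then show ?case by (subst elim)
  qed
  have sW: "integrable M (\<lambda>s. \<Sum>i\<in>eidx G. W i s)" using W_int by (rule Bochner_Integration.integrable_sum)
  have "z b - z a = (LINT s:{a<..b}|M. ?v s)" using zD(7) ab by (simp add: has_ac_deriv_def)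
  moreover have "norm (LINT s:{a<..b}|M. ?v s) \<le> (LINT s:{a<..b}|M. \<Sum>i\<in>eidx G. W i s)"
    unfolding set_lebesgue_integral_def
  proof (rule order_trans[OF integral_norm_bound integral_mono_AE])
    show "integrable M (\<lambda>s. norm (indicator {a<..b} s *\<^sub>R ?v s))"
      using set_integrable_Ioc[OF zD(6), of a b] by (simp only: set_integrable_def integrable_norm)
    show "integrable M (\<lambda>s. indicator {a<..b} s *\<^sub>R (\<Sum>i\<in>eidx G. W i s))"
      using set_integrable_Ioc[OF sW, of a b] by (simp only: set_integrable_def)
    show "AE s in M. norm (indicator {a<..b} s *\<^sub>R ?v s) \<le> indicator {a<..b} s *\<^sub>R (\<Sum>i\<in>eidx G. W i s)"
      using ae by eventually_elim (simp add: indicator_def)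
  qed
  moreover have "(LINT s:{a<..b}|M. \<Sum>i\<in>eidx G. W i s) = (\<Sum>i\<in>eidx G. LINT s:{a<..b}|M. W i s)"
    unfolding set_lebesgue_integral_def scaleR_sum_right
    by (rule Bochner_Integration.integral_sum) (use set_integrable_Ioc[OF W_int] in \<open>simp only: set_integrable_def\<close>)
  moreover have "(\<Sum>i\<in>eidx G. LINT s:{a<..b}|M. W i s) \<le> (\<Sum>i\<in>eidx G. K * (b - a) + K powr (1 - p) * B)"
  proof (rule sum_mono)
    fix i assume i: "i \<in> eidx G"
    have "(LINT s:{a<..b}|M. W i s) = (LINT s:{a<..b}|M. K) + (LINT s:{a<..b}|M. K powr (1 - p) * \<bar>?f i s\<bar> powr p)"
      unfolding W_def using fp[OF i] by (intro set_integral_add(2) set_integrable_Ioc) auto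
    moreover have "(LINT s:{a<..b}|M. K) \<le> K * (b - a)" using ab K by (intro set_integral_const_Ioc_le) auto
    moreover have "(LINT s:{a<..b}|M. K powr (1 - p) * \<bar>?f i s\<bar> powr p) \<le> (LINT s|M. K powr (1 - p) * \<bar>?f i s\<bar> powr p)"
      unfolding set_lebesgue_integral_def
    proof (rule integral_mono)
      have "integrable M (\<lambda>s. K powr (1 - p) * \<bar>?f i s\<bar> powr p)" using fp[OF i] by simp
      from set_integrable_Ioc[OF this, of a b] this
      show "integrable M (\<lambda>s. indicator {a<..b} s *\<^sub>R (K powr (1 - p) * \<bar>?f i s\<bar> powr p))"
        "integrable M (\<lambda>s. K powr (1 - p) * \<bar>?f i s\<bar> powr p)" by (simp_all only: set_integrable_def)
    qed (simp add: indicator_def)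
    moreover have "(LINT s|M. K powr (1 - p) * \<bar>?f i s\<bar> powr p) \<le> K powr (1 - p) * B"
      using B[OF i] by (simp add: mult_left_mono)
    ultimately show "(LINT s:{a<..b}|M. W i s) \<le> K * (b - a) + K powr (1 - p) * B" by linarith
  qed
  ultimately show ?thesis by simp
qed

text \<open>\<open>K\<close> is chosen first and makes the energy term small regardless of the
  interval; the length \<open>d\<close> then takes care of the term linear in b - a.\<close>

lemma trajectories_equicontinuous:
  assumes "0 < e"
  shows "\<exists>d>0. \<forall>z\<in>trajectories G p T t x.
    (\<forall>i\<in>eidx G. (LINT s|M. \<bar>edge_speed z (weak_deriv p t T z) i s\<bar> powr p) \<le> B) \<longrightarrow>
    (\<forall>a\<in>{t..T}. \<forall>b\<in>{t..T}. \<bar>a - b\<bar> < d \<longrightarrow> norm (z a - z b) < e)"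
proof -
  define c where "c = real (card (eidx G))"
  have "((\<lambda>K. K powr (1 - p) * (c * B)) \<longlongrightarrow> 0 * (c * B)) at_top"
    using p by (intro tendsto_intros tendsto_neg_powr filterlim_ident) auto
  then have "\<forall>\<^sub>F K in at_top. K powr (1 - p) * (c * B) < e / 2"
    using assms by (intro order_tendstoD(2)) auto
  then have "\<forall>\<^sub>F K in at_top. 1 \<le> K \<and> K powr (1 - p) * (c * B) < e / 2"
    by (rule eventually_conj[OF eventually_ge_at_top])
  then obtain K where K: "1 \<le> K" "K powr (1 - p) * (c * B) < e / 2"
    using eventually_happens'[OF trivial_limit_at_top_linorder] by blast
  have cK: "0 \<le> c * K" using K(1) by (simp add: c_def)
  define d where "d = e / (2 * (c * K + 1))"
  have d: "d > 0" unfolding d_def using assms cK by (intro divide_pos_pos) auto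
  have dK: "c * K * d \<le> e / 2" unfolding d_def using assms cK by (simp add: field_simps)
  have main: "norm (z b - z a) < e"
    if z: "z \<in> trajectories G p T t x" and B: "\<And>i. i \<in> eidx G \<Longrightarrow> (LINT s|M. \<bar>edge_speed z (weak_deriv p t T z) i s\<bar> powr p) \<le> B"
      and ab: "t \<le> a" "a \<le> b" "b \<le> T" "b - a < d" for z a b
  proof -
    have "norm (z b - z a) \<le> c * (K * (b - a) + K powr (1 - p) * B)"
      unfolding c_def using K(1) by (intro trajectory_modulus[OF z B] ab) auto
    also have "\<dots> = c * K * (b - a) + K powr (1 - p) * (c * B)" by (simp add: algebra_simps)
    also have "\<dots> < e / 2 + e / 2"
    proof (rule add_le_less_mono[OF _ K(2)])
      have "c * K * (b - a) \<le> c * K * d" using cK ab by (intro mult_left_mono) auto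
      then show "c * K * (b - a) \<le> e / 2" using dK by linarith
    qed
    finally show ?thesis by simp
  qed
  show ?thesis
  proof (intro exI[of _ d] conjI d ballI impI)
    fix z a b
    assume z: "z \<in> trajectories G p T t x" "\<forall>i\<in>eidx G. (LINT s|M. \<bar>edge_speed z (weak_deriv p t T z) i s\<bar> powr p) \<le> B"
      and ab: "a \<in> {t..T}" "b \<in> {t..T}" "\<bar>a - b\<bar> < d"
    show "norm (z a - z b) < e"
    proof (cases "a \<le> b")
      case True
      then have "norm (z b - z a) < e" using z ab by (intro main) auto
      then show ?thesis by (simp add: norm_minus_commute)
    next
      case False
      then show ?thesis using z ab by (intro main) auto
    qed
  qed
qed

text \<open>Integrated coercivity plus the lower bound of the terminal cost. It makes the infimum
  finite and bounds the edge speeds in L^p along a minimising sequence.\<close>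

lemma total_cost_lower:
  "\<exists>c>0. \<exists>C. \<forall>z\<in>trajectories G p T t x.
    c * (\<Sum>i\<in>eidx G. LINT s|M. \<bar>edge_speed z (weak_deriv p t T z) i s\<bar> powr p) - C \<le> total_cost G ell ellv g gv p T t z"
proof -
  interpret finite_measure M by (rule finite_measure_M)
  obtain c C where c: "c > 0" "\<And>x w s. x \<in> network_set G \<Longrightarrow> s \<in> {0..T} \<Longrightarrow>
     c * (\<Sum>i\<in>eidx G. \<bar>indicator (edge_interior G i) x * (w \<bullet> edge_dir G i)\<bar> powr p) - C \<le> L x w s"
    using running_cost_coercive by blast
  obtain b where b: "\<And>x. x \<in> network_set G \<Longrightarrow> b \<le> terminal_cost G g gv x"
    using terminal_cost_bounded_below by blast
  have "c * (\<Sum>i\<in>eidx G. LINT s|M. \<bar>edge_speed z (weak_deriv p t T z) i s\<bar> powr p) - (C * measure M (space M) - b)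
      \<le> total_cost G ell ellv g gv p T t z" if z: "z \<in> trajectories G p T t x" for z
  proof -
    note zD = trajectoryD[OF z]
    let ?v = "weak_deriv p t T z"
    have fp: "integrable M (\<lambda>s. \<bar>edge_speed z ?v i s\<bar> powr p)" if "i \<in> eidx G" for i
      using edge_speed_Lp[OF zD(1,4) that] by auto
    have sp: "integrable M (\<lambda>s. \<Sum>i\<in>eidx G. \<bar>edge_speed z ?v i s\<bar> powr p)"
      using fp by (rule Bochner_Integration.integrable_sum)
    have "(LINT s|M. c * (\<Sum>i\<in>eidx G. \<bar>edge_speed z ?v i s\<bar> powr p) - C) \<le> (LINT s|M. L (z s) (?v s) s)"
    proof (rule integral_mono)
      show "integrable M (\<lambda>s. L (z s) (?v s) s)"
        by (rule integrable_running_cost[OF zD(1,2) edge_speed_Lp[OF zD(1,4)]])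
      show "integrable M (\<lambda>s. c * (\<Sum>i\<in>eidx G. \<bar>edge_speed z ?v i s\<bar> powr p) - C)" using sp by simp
      fix s assume "s \<in> space M"
      then have s: "s \<in> {t..T}" "s \<in> {0..T}" using t by auto
      then have "z s \<in> network_set G" using zD(2) by blast
      from c(2)[OF this s(2), of "?v s"]
      show "c * (\<Sum>i\<in>eidx G. \<bar>edge_speed z ?v i s\<bar> powr p) - C \<le> L (z s) (?v s) s"
        unfolding edge_speed_def .
    qed
    moreover have "(LINT s|M. c * (\<Sum>i\<in>eidx G. \<bar>edge_speed z ?v i s\<bar> powr p) - C) =
        c * (\<Sum>i\<in>eidx G. LINT s|M. \<bar>edge_speed z ?v i s\<bar> powr p) - C * measure M (space M)"
    proof -
      have "(LINT s|M. (\<Sum>i\<in>eidx G. \<bar>edge_speed z ?v i s\<bar> powr p)) = (\<Sum>i\<in>eidx G. LINT s|M. \<bar>edge_speed z ?v i s\<bar> powr p)"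
        by (rule Bochner_Integration.integral_sum) (rule fp)
      then show ?thesis using sp by (simp add: mult.commute)
    qed
    moreover have "b \<le> terminal_cost G g gv (z T)" using zD(2) t by (intro b) auto
    moreover have "E - (K - b) \<le> I + \<tau>" if "A \<le> I" "A = E - K" "b \<le> \<tau>" for A E K I \<tau> :: real
      using that by linarith
    ultimately show ?thesis unfolding total_cost_def by blast
  qed
  with c(1) show ?thesis by blast
qed

lemma trajectories_compact:
  assumes Z: "\<And>n. Z n \<in> trajectories G p T t x"
    and B: "\<And>n i. i \<in> eidx G \<Longrightarrow> (LINT s|M. \<bar>edge_speed (Z n) (weak_deriv p t T (Z n)) i s\<bar> powr p) \<le> B"
  shows "\<exists>y r. continuous_on {t..T} y \<and> strict_mono (r :: nat \<Rightarrow> nat) \<and>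
    (\<forall>e>0. \<exists>N. \<forall>n\<ge>N. \<forall>s\<in>{t..T}. norm (Z (r n) s - y s) < e)"
proof -
  \<comment> \<open>A bound for all positions: the modulus of continuity over the whole interval
    with level K = 1, started at \<open>x\<close>.\<close>
  define R where "R = norm x + real (card (eidx G)) * (1 * (T - t) + 1 powr (1 - p) * \<bar>B\<bar>)"
  have "norm (Z n s) \<le> R" if s: "s \<in> {t..T}" for n s
  proof -
    have "norm (Z n s - Z n t) \<le> real (card (eidx G)) * (1 * (s - t) + 1 powr (1 - p) * \<bar>B\<bar>)"
      using B s by (intro trajectory_modulus[OF Z]) (auto intro: order_trans[OF B abs_ge_self])
    also have "\<dots> \<le> real (card (eidx G)) * (1 * (T - t) + 1 powr (1 - p) * \<bar>B\<bar>)"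
      using s by (intro mult_left_mono) auto
    finally have "norm (Z n s - x) \<le> \<dots>" using trajectoryD(3)[OF Z] by simp
    then show ?thesis using norm_triangle_sub[of "Z n s" x] unfolding R_def by linarith
  qed
  moreover have "\<exists>d>0. \<forall>n s'. s' \<in> {t..T} \<and> norm (s - s') < d \<longrightarrow> norm (Z n s - Z n s') < e"
    if s: "s \<in> {t..T}" and e: "0 < e" for s e
  proof -
    obtain d where d: "d > 0" "\<And>z a b. z \<in> trajectories G p T t x \<Longrightarrow>
      (\<forall>i\<in>eidx G. (LINT s|M. \<bar>edge_speed z (weak_deriv p t T z) i s\<bar> powr p) \<le> B) \<Longrightarrow>
      a \<in> {t..T} \<Longrightarrow> b \<in> {t..T} \<Longrightarrow> \<bar>a - b\<bar> < d \<Longrightarrow> norm (z a - z b) < e"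
      using trajectories_equicontinuous[OF e, of x B] by blast
    show ?thesis using d(1) d(2)[OF Z _ s] B by (intro exI[of _ d]) auto
  qed
  ultimately obtain y r where "continuous_on {t..T} y" "strict_mono (r :: nat \<Rightarrow> nat)"
    and *: "\<And>e. 0 < e \<Longrightarrow> \<exists>N. \<forall>n s. n \<ge> N \<and> s \<in> {t..T} \<longrightarrow> norm (Z (r n) s - y s) < e"
    using Arzela_Ascoli[of "{t..T}" Z R] by (metis compact_Icc)
  moreover have "\<exists>N. \<forall>n\<ge>N. \<forall>s\<in>{t..T}. norm (Z (r n) s - y s) < e" if "0 < e" for e
    using *[OF that] by blast
  ultimately show ?thesis by blast
qed

lemma minimizer_exists:
  assumes x: "x \<in> network_set G"
  shows "\<exists>y\<in>trajectories G p T t x. \<forall>z\<in>trajectories G p T t x.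
    total_cost G ell ellv g gv p T t y \<le> total_cost G ell ellv g gv p T t z"
proof -
  let ?J = "total_cost G ell ellv g gv p T t"
  let ?tr = "trajectories G p T t x"
  let ?E = "\<lambda>z i. LINT s|M. \<bar>edge_speed z (weak_deriv p t T z) i s\<bar> powr p"
  obtain c C where c: "c > 0" "\<And>z. z \<in> ?tr \<Longrightarrow> c * (\<Sum>i\<in>eidx G. ?E z i) - C \<le> ?J z"
    using total_cost_lower[of x] by blast
  have E0: "0 \<le> ?E z i" for z i by (intro integral_nonneg_AE AE_I2) simp
  have bdd: "bdd_below (?J ` ?tr)"
  proof (rule bdd_belowI2)
    fix z assume "z \<in> ?tr"
    moreover have "0 \<le> c * (\<Sum>i\<in>eidx G. ?E z i)" using c(1) E0 by (intro mult_nonneg_nonneg sum_nonneg) auto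
    ultimately show "- C \<le> ?J z" using c(2)[of z] by linarith
  qed
  have ne: "?J ` ?tr \<noteq> {}" using constant_trajectory[OF x] by blast
  define m where "m = Inf (?J ` ?tr)"
  have m_le: "m \<le> ?J z" if "z \<in> ?tr" for z unfolding m_def using that bdd by (intro cInf_lower) auto
  have "\<exists>z\<in>?tr. ?J z < m + 1 / real (Suc n)" for n
    using cInf_lessD[OF ne, of "m + 1 / real (Suc n)"] unfolding m_def by auto
  then obtain Z where Z: "\<And>n. Z n \<in> ?tr" "\<And>n. ?J (Z n) < m + 1 / real (Suc n)" by metis
  \<comment> \<open>Solves c E - C <= m + 1, with the right side an upper bound for the costs of the
    sequence, for the energy E of a single edge; the energies of the other edges are
    nonnegative.\<close>
  define B where "B = (m + 1 + C) / c"
  have B: "?E (Z n) i \<le> B" if i: "i \<in> eidx G" for n i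
  proof -
    have "?E (Z n) i \<le> (\<Sum>i\<in>eidx G. ?E (Z n) i)" using i E0 by (intro member_le_sum) auto
    then have "c * ?E (Z n) i \<le> c * (\<Sum>i\<in>eidx G. ?E (Z n) i)" using c(1) by (intro mult_left_mono) auto
    moreover have "1 / real (Suc n) \<le> 1" by simp
    ultimately have "c * ?E (Z n) i \<le> m + 1 + C" using c(2)[OF Z(1), of n] Z(2)[of n] by linarith
    then show ?thesis unfolding B_def using c(1) by (simp add: pos_le_divide_eq mult.commute)
  qed
  obtain y r where y: "continuous_on {t..T} y" and r: "strict_mono (r :: nat \<Rightarrow> nat)"
    and unif: "\<And>e. 0 < e \<Longrightarrow> \<exists>N. \<forall>n\<ge>N. \<forall>s\<in>{t..T}. norm (Z (r n) s - y s) < e"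
    using trajectories_compact[where Z=Z, OF Z(1) B] by blast
  interpret lim: trajectory_limit G T p t ell ellv g gv "\<lambda>n. Z (r n)" y x B
    by unfold_locales (use Z(1) B y unif in auto)
  have TT: "T \<in> {t..T}" using t by auto
  \<comment> \<open>The terminal cost is only lower semicontinuous, so its value at the limit is
    subtracted: a loss of e/2 there and an excess of e/2 over the infimum leave the running costs
    below \<open>R + e\<close>.\<close>
  define R where "R = m - terminal_cost G g gv (y T)"
  have "\<exists>N. \<forall>n\<ge>N. (LINT s|M. L (Z (r n) s) (weak_deriv p t T (Z (r n)) s) s) \<le> R + e" if e: "e > 0" for e
  proof -
    have "\<forall>\<^sub>F n in sequentially. terminal_cost G g gv (y T) - e / 2 \<le> terminal_cost G g gv (Z (r n) T)"
    proof (rule terminal_cost_lsc)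
      show "Z (r n) T \<in> network_set G" for n using trajectoryD(2)[OF Z(1), of "r n"] TT by blast
      show "(\<lambda>n. Z (r n) T) \<longlonglongrightarrow> y T" by (rule lim.tendsto_Y[OF TT])
    qed (use e in simp)
    moreover have "\<forall>\<^sub>F n in sequentially. 1 / real (Suc n) < e / 2"
      using e by (intro order_tendstoD(2)[OF LIMSEQ_inverse_real_of_nat, unfolded inverse_eq_divide]) auto
    ultimately have "\<forall>\<^sub>F n in sequentially. (LINT s|M. L (Z (r n) s) (weak_deriv p t T (Z (r n)) s) s) \<le> R + e"
    proof eventually_elim
      case (elim n)
      have "1 / real (Suc (r n)) \<le> 1 / real (Suc n)" using seq_suble[OF r, of n] by (simp add: frac_le)
      then have "?J (Z (r n)) \<le> m + e / 2" using Z(2)[of "r n"] elim(2) by linarith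
      then show ?case using elim(1) unfolding total_cost_def R_def by linarith
    qed
    then show ?thesis unfolding eventually_sequentially .
  qed
  from lim.running_cost_lsc[OF this]
  have "y \<in> ?tr" and "?J y \<le> m" by (auto simp: total_cost_def R_def)
  then show ?thesis using m_le by (meson order_trans)
qed

end

text \<open>The infimum is taken in the extended reals, where a set of costs unbounded below would
  have infimum minus infinity. Equality with a real cost thus asserts a genuine minimum.\<close>

theorem mainTheorem10:
  fixes G :: "'a::euclidean_space network"
    and T p t :: real and x :: 'a
    and ell :: "nat \<Rightarrow> real \<Rightarrow> real \<Rightarrow> real \<Rightarrow> real" and ellv :: "nat \<Rightarrow> real \<Rightarrow> real"
    and g :: "nat \<Rightarrow> real \<Rightarrow> real" and gv :: "nat \<Rightarrow> real"
  assumes network: "is_network G"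
    and T: "0 < T" and p: "1 < p"
    and g_cont: "\<And>i. i \<in> eidx G \<Longrightarrow> continuous_on (edge_dom G i) (g i)"
    and g_bounded: "\<And>i. i \<in> eidx G \<Longrightarrow> bounded (g i ` edge_dom G i)"
    and ellv_cont: "\<And>j. j \<in> vidx G \<Longrightarrow> continuous_on {0..T} (ellv j)"
    and ell_cont: "\<And>i. i \<in> eidx G \<Longrightarrow>
      continuous_on (edge_dom G i \<times> UNIV \<times> {0..T}) (\<lambda>(y, a, s). ell i y a s)"
    and ell_diff: "\<And>i s. i \<in> eidx G \<Longrightarrow> s \<in> {0..T} \<Longrightarrow>
      (\<lambda>(y, a). ell i y a s) differentiable_on (edge_dom G i \<times> UNIV)"
    and partial_y_cont: "\<And>i. i \<in> eidx G \<Longrightarrow>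
      continuous_on (edge_dom G i \<times> UNIV \<times> {0..T}) (\<lambda>(y, a, s). partial_y G ell i y a s)"
    and partial_a_cont: "\<And>i. i \<in> eidx G \<Longrightarrow>
      continuous_on (edge_dom G i \<times> UNIV \<times> {0..T}) (\<lambda>(y, a, s). partial_a ell i y a s)"
    and H1: "\<And>i j. i \<in> eidx G \<Longrightarrow> j \<in> vidx G \<Longrightarrow>
      \<exists>C0>0. (\<forall>y\<in>edge_dom G i. \<forall>a. \<forall>s\<in>{0..T}. ell i y a s \<ge> C0 * (\<bar>a\<bar> powr p - 1)) \<and>
             (\<forall>s\<in>{0..T}. ellv j s \<ge> - C0)"
    and H2: "\<And>i r. i \<in> eidx G \<Longrightarrow> 0 < r \<Longrightarrow>
      \<exists>\<omega>. modulus_of_continuity \<omega> \<and>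
        (\<forall>y\<in>edge_dom G i \<inter> {0..r}. \<forall>a. \<forall>t1\<in>{0..T}. \<forall>t2\<in>{0..T}.
           \<bar>ell i y a t1 - ell i y a t2\<bar> \<le> (1 + \<bar>a\<bar> powr p) * \<omega> \<bar>t1 - t2\<bar>)"
    and H3: "\<And>i r. i \<in> eidx G \<Longrightarrow> 0 < r \<Longrightarrow>
      \<exists>c\<ge>0. \<forall>y\<in>edge_dom G i \<inter> {0..r}. \<forall>a. \<forall>s\<in>{0..T}.
           \<bar>partial_y G ell i y a s\<bar> \<le> c * (\<bar>a\<bar> powr p + 1) \<and>
           \<bar>partial_a ell i y a s\<bar> \<le> c * (\<bar>a\<bar> powr (p - 1) + 1)"
    and H4: "\<And>i y s. i \<in> eidx G \<Longrightarrow> y \<in> edge_dom G i \<Longrightarrow> s \<in> {0..T} \<Longrightarrow>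
      strictly_convex (\<lambda>a. ell i y a s)"
    and x: "x \<in> network_set G" and t: "t \<in> {0..T}"
  shows "\<exists>y \<in> trajectories G p T t x.
    ereal (total_cost G ell ellv g gv p T t y) =
      (INF z \<in> trajectories G p T t x. ereal (total_cost G ell ellv g gv p T t z))"
proof -
  have "control_problem G T p t ell ellv g"
    by unfold_locales (fact assms)+
  from control_problem.minimizer_exists[OF this x]
  obtain y where y: "y \<in> trajectories G p T t x"
    and min: "\<And>z. z \<in> trajectories G p T t x \<Longrightarrow> total_cost G ell ellv g gv p T t y \<le> total_cost G ell ellv g gv p T t z"
    by blast
  have "ereal (total_cost G ell ellv g gv p T t y) =
      (INF z \<in> trajectories G p T t x. ereal (total_cost G ell ellv g gv p T t z))"
    using y min by (intro antisym INF_greatest INF_lower) auto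
  with y show ?thesis by blast
qed

end
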